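(* Let $(R,\mathbf m)$ be a $d$-dimensional equicharacteristic regular local ring with $d\ge 3$, with a fixed regular system of parameters $x,y_2,\ldots,y_d$, and let $R_1 = R[\frac{\mathbf m}{x}]_{(x,\,y_2/x,\ldots,\,y_d/x)}$ with maximal ideal $\mathbf m_1=(x,u_2,\ldots,u_d)R_1$, where $u_j = y_j/x$. Let $I_1$ and $I_1'$ be complete $\mathbf m_1$-primary monomial ideals of $R_1$. Let $n_2,\ldots,n_d$ and $n_2',\ldots,n_d'$ be the integers such that $u_j^{n_j}\in\Delta(I_1)$ and $u_j^{n_j'}\in\Delta(I_1')$ for $2\le j\le d$. Set $$ n := \max\{n_2,\ldots,n_d\} + \max\{n_2',\ldots,n_d'\} - \max\{n_2+n_2',\ldots,n_d+n_d'\}.$$ Then $n$ is a nonnegative integer and $$\operatorname{CIT}(I_1) * \operatorname{CIT}(I_1') = \mathbf m^{n} * \operatorname{CIT}(I_1 * I_1').$$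
   Context: A monomial ideal of $R$ (resp. $R_1$) is an ideal generated by monomials with nonnegative exponents in $x,y_2,\ldots,y_d$ (resp. in $x,u_2,\ldots,u_d$). $\Delta(I)$ denotes the set of monomial minimal generators of a monomial ideal $I$. An ideal is complete if it is integrally closed. For ideals $I,J$, the $*$-product $I*J$ is the integral closure of $IJ$. Complete inverse transform: for an $\mathbf m_1$-primary monomial ideal $I_1$ of $R_1$ and a monomial $\alpha = x^{\alpha_1}u_2^{\alpha_2}\cdots u_d^{\alpha_d}$ put $\nu_x(\alpha)=\alpha_1-(\alpha_2+\cdots+\alpha_d)$, and set $\delta(I_1)=\max\{-\nu_x(\alpha) : \alpha\in\Delta(I_1)\}$. Then $x^{\delta(I_1)}\alpha\in R$ for each $\alpha\in\Delta(I_1)$. $\operatorname{CIT}(I_1)$ is the integral closure in $R$ of the ideal $$\big(\{x^{\delta(I_1)}\alpha : \alpha\in\Delta(I_1)\},\ y_2^{\delta(I_1)},\ldots,y_d^{\delta(I_1)}\big)R.$$ *)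

theory Defs
  imports "HOL-Algebra.Algebra" "HOL-Algebra.Algebraic_Closure_Type" "HOL-Library.Extended_Nat"
begin

section \<open>Commutative algebra over an arbitrary ring record\<close>

text \<open>
  Krull dimension: the supremum of the lengths \<open>n\<close> of strictly increasing chains
  \<open>P 0 \<subset> P 1 \<subset> \<dots> \<subset> P n\<close> of prime ideals.
\<close>
definition krull_dim :: "('a, 'b) ring_scheme \<Rightarrow> enat" where
  "krull_dim R = Sup {enat n | n. \<exists>P. (\<forall>i\<le>n. primeideal (P i) R) \<and> (\<forall>i<n. P i \<subset> P (Suc i))}"

definition local_ring :: "('a, 'b) ring_scheme \<Rightarrow> 'a set \<Rightarrow> bool" where
  "local_ring R M \<longleftrightarrow> cring R \<and> maximalideal M R \<and> (\<forall>N. maximalideal N R \<longrightarrow> N = M)"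

definition regular_local_ring :: "('a, 'b) ring_scheme \<Rightarrow> 'a set \<Rightarrow> bool" where
  "regular_local_ring R M \<longleftrightarrow> noetherian_ring R \<and> local_ring R M \<and>
     (\<exists>S. S \<subseteq> carrier R \<and> finite S \<and> M = genideal R S \<and> krull_dim R = enat (card S))"

text \<open>
  The characteristic is the nonnegative generator of the ideal of integers annihilating \<open>\<one>\<close>;
  it is \<open>0\<close> if no positive multiple of \<open>\<one>\<close> vanishes.
\<close>
definition ring_char :: "('a, 'b) ring_scheme \<Rightarrow> nat" where
  "ring_char R = Gcd {n :: nat. add_pow R n \<one>\<^bsub>R\<^esub> = \<zero>\<^bsub>R\<^esub>}"

definition equicharacteristic :: "('a, 'b) ring_scheme \<Rightarrow> 'a set \<Rightarrow> bool" where
  "equicharacteristic R M \<longleftrightarrow> ring_char R = ring_char (R Quot M)"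

definition ideal_radical :: "('a, 'b) ring_scheme \<Rightarrow> 'a set \<Rightarrow> 'a set" where
  "ideal_radical R I = {a \<in> carrier R. \<exists>n :: nat. a [^]\<^bsub>R\<^esub> n \<in> I}"

definition primary_ideal :: "('a, 'b) ring_scheme \<Rightarrow> 'a set \<Rightarrow> bool" where
  "primary_ideal R Q \<longleftrightarrow> ideal Q R \<and> Q \<noteq> carrier R \<and>
     (\<forall>a\<in>carrier R. \<forall>b\<in>carrier R. a \<otimes>\<^bsub>R\<^esub> b \<in> Q \<longrightarrow> a \<in> Q \<or> b \<in> ideal_radical R Q)"

definition primary_to :: "('a, 'b) ring_scheme \<Rightarrow> 'a set \<Rightarrow> 'a set \<Rightarrow> bool" where
  "primary_to R P Q \<longleftrightarrow> primary_ideal R Q \<and> ideal_radical R Q = P"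

definition ideal_power :: "('a, 'b) ring_scheme \<Rightarrow> 'a set \<Rightarrow> nat \<Rightarrow> 'a set" where
  "ideal_power R I n = I [^]\<^bsub>ideals_set R\<^esub> n"

text \<open>
  Integral closure of an ideal: all roots \<open>z\<close> of equations
  \<open>z\<^sup>n + a\<^sub>1 z\<^sup>n\<^sup>-\<^sup>1 + \<dots> + a\<^sub>n = 0\<close> with \<open>n \<ge> 1\<close> and \<open>a\<^sub>i \<in> I\<^sup>i\<close>.
\<close>
definition integral_closure :: "('a, 'b) ring_scheme \<Rightarrow> 'a set \<Rightarrow> 'a set" where
  "integral_closure R I = {z \<in> carrier R. \<exists>n\<ge>1. \<exists>a. (\<forall>i\<in>{1..n}. a i \<in> ideal_power R I i) \<and>
     z [^]\<^bsub>R\<^esub> (n::nat) \<oplus>\<^bsub>R\<^esub> (\<Oplus>\<^bsub>R\<^esub>i\<in>{1..n}. a i \<otimes>\<^bsub>R\<^esub> z [^]\<^bsub>R\<^esub> (n - i)) = \<zero>\<^bsub>R\<^esub>}"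

definition complete_ideal :: "('a, 'b) ring_scheme \<Rightarrow> 'a set \<Rightarrow> bool" where
  "complete_ideal R I \<longleftrightarrow> ideal I R \<and> integral_closure R I = I"

definition star_product :: "('a, 'b) ring_scheme \<Rightarrow> 'a set \<Rightarrow> 'a set \<Rightarrow> 'a set" where
  "star_product R I J = integral_closure R (ideal_prod R I J)"


section \<open>Subrings of a field and monomials\<close>

text \<open>
  A regular local ring \<open>R\<close> is a domain, and \<open>R[\<mm>/x]\<close> and its localization are formed inside the
  quotient field.  All these rings are given by their carriers inside a field containing \<open>R\<close>, which
  is a type of class \<open>field\<close>; elements outside the quotient field of \<open>R\<close> play no role.
\<close>
abbreviation field_ring :: "'k::field ring" where
  "field_ring \<equiv> ring_of_type_algebra"

definition ring_on :: "'k::field set \<Rightarrow> 'k ring" where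
  "ring_on A = field_ring\<lparr>carrier := A\<rparr>"

text \<open>
  The monomial in \<open>x, v 2, \<dots>, v d\<close> with exponents \<open>a 1, a 2, \<dots>, a d\<close>, where \<open>v\<close> stands for
  \<open>y\<close> or \<open>u\<close>; values of \<open>v\<close> and \<open>a\<close> at other indices are irrelevant.
\<close>
definition monomial :: "nat \<Rightarrow> 'k::field \<Rightarrow> (nat \<Rightarrow> 'k) \<Rightarrow> (nat \<Rightarrow> nat) \<Rightarrow> 'k" where
  "monomial d x v a = x ^ a 1 * (\<Prod>j=2..d. v j ^ a j)"

definition monomial_ideal ::
    "'k::field ring \<Rightarrow> nat \<Rightarrow> 'k \<Rightarrow> (nat \<Rightarrow> 'k) \<Rightarrow> 'k set \<Rightarrow> bool" where
  "monomial_ideal R d x v I \<longleftrightarrow> (\<exists>S \<subseteq> range (monomial d x v). I = genideal R S)"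

text \<open>
  Elements of irredundant monomial generating sets.  Over a local ring in which
  \<open>x, v 2, \<dots>, v d\<close> is a regular system of parameters, a monomial ideal has exactly one such
  generating set.
\<close>
definition min_monomial_gens ::
    "'k::field ring \<Rightarrow> nat \<Rightarrow> 'k \<Rightarrow> (nat \<Rightarrow> 'k) \<Rightarrow> 'k set \<Rightarrow> 'k set" where
  "min_monomial_gens R d x v I = \<Union> {S. S \<subseteq> range (monomial d x v) \<and>
     genideal R S = I \<and> (\<forall>T. T \<subset> S \<longrightarrow> genideal R T \<noteq> I)}"


section \<open>The local quadratic transform and the complete inverse transform\<close>

definition param_ideal :: "'k::field set \<Rightarrow> nat \<Rightarrow> 'k \<Rightarrow> (nat \<Rightarrow> 'k) \<Rightarrow> 'k set" where
  "param_ideal A d x v = genideal (ring_on A) (insert x (v ` {2..d}))"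

definition transform_param :: "'k::field \<Rightarrow> (nat \<Rightarrow> 'k) \<Rightarrow> nat \<Rightarrow> 'k" where
  "transform_param x y j = y j / x"

text \<open>The affine chart \<open>R[\<mm>/x]\<close>, where \<open>\<mm> = (x, y 2, \<dots>, y d)\<close>.\<close>
definition blowup_chart :: "'k::field set \<Rightarrow> nat \<Rightarrow> 'k \<Rightarrow> (nat \<Rightarrow> 'k) \<Rightarrow> 'k set" where
  "blowup_chart A d x y = generate_ring field_ring (A \<union> {a / x | a. a \<in> param_ideal A d x y})"

definition quadratic_transform :: "'k::field set \<Rightarrow> nat \<Rightarrow> 'k \<Rightarrow> (nat \<Rightarrow> 'k) \<Rightarrow> 'k set" where
  "quadratic_transform A d x y =
     (let B = blowup_chart A d x y; P = param_ideal B d x (transform_param x y)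
      in {b / c | b c. b \<in> B \<and> c \<in> B \<and> c \<notin> P})"

definition nu_x :: "nat \<Rightarrow> (nat \<Rightarrow> nat) \<Rightarrow> int" where
  "nu_x d a = int (a 1) - (\<Sum>j=2..d. int (a j))"

definition Delta1 :: "'k::field set \<Rightarrow> nat \<Rightarrow> 'k \<Rightarrow> (nat \<Rightarrow> 'k) \<Rightarrow> 'k set \<Rightarrow> 'k set" where
  "Delta1 A d x y I1 = min_monomial_gens (ring_on (quadratic_transform A d x y)) d x
     (transform_param x y) I1"

text \<open>
  The exponent functions \<open>a\<close> are unconstrained outside \<open>{1..d}\<close>, but \<open>nu_x\<close> ignores those values, so
  for a regular system of parameters the maximum is over a finite set.  It is positive for ideals
  primary to the maximal ideal, since these have a minimal generator \<open>u j ^ n\<close> with \<open>n > 0\<close>; hence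
  nothing is lost by the truncation \<open>nat\<close> in \<open>CIT\<close>.
\<close>
definition cit_delta :: "'k::field set \<Rightarrow> nat \<Rightarrow> 'k \<Rightarrow> (nat \<Rightarrow> 'k) \<Rightarrow> 'k set \<Rightarrow> int" where
  "cit_delta A d x y I1 =
     Max {- nu_x d a | a. monomial d x (transform_param x y) a \<in> Delta1 A d x y I1}"

definition CIT :: "'k::field set \<Rightarrow> nat \<Rightarrow> 'k \<Rightarrow> (nat \<Rightarrow> 'k) \<Rightarrow> 'k set \<Rightarrow> 'k set" where
  "CIT A d x y I1 =
     (let e = nat (cit_delta A d x y I1)
      in integral_closure (ring_on A) (genideal (ring_on A)
           ({x ^ e * \<alpha> | \<alpha>. \<alpha> \<in> Delta1 A d x y I1} \<union> {y j ^ e | j. j \<in> {2..d}})))"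

end

theory Submission
  imports Defs "HOL-Computational_Algebra.Polynomial"
begin

text \<open>
  By the valuative criterion (\<open>valuative_criterion\<close>), the integral closure of an ideal \<open>I\<close> of \<open>R\<close> consists
  of the elements of \<open>R\<close> that lie in \<open>I V\<close> for every valuation ring \<open>V \<supseteq> R\<close> of the field.  Hence the two
  sides agree as soon as the ideals under the closures have the same extension to every such \<open>V\<close>.
  The identity comes from a case distinction on which of the parameters \<open>x, y 2, \<dots>, y d\<close> generates
  \<open>\<mm> V\<close>; write \<open>\<delta>, \<delta>', \<delta>''\<close> for the numbers \<open>\<delta>\<close> of \<open>I1\<close>, \<open>I1'\<close> and \<open>I1 * I1'\<close>.

  If \<open>x\<close> generates \<open>\<mm> V\<close>, then all \<open>u j = y j / x\<close> lie in \<open>V\<close>, the generator \<open>y j ^ \<delta> = x ^ \<delta> * u j ^ \<delta>\<close> is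
  a multiple of \<open>x ^ \<delta> * u j ^ n j\<close>, and \<open>CIT(I1)\<close> extends to \<open>x ^ \<delta>\<close> times the ideal generated by the
  monomials of \<open>I1\<close>.  Both sides then extend to \<open>x ^ (\<delta> + \<delta>')\<close> times the ideal generated by the
  products of monomials of \<open>I1\<close> and \<open>I1'\<close>; passing from these products to the monomials of \<open>I1 * I1'\<close>
  does not change the extension, since a monomial integral over \<open>I1 I1'\<close> has a power that is divisible by a
  product of as many monomials of \<open>I1 I1'\<close> (\<open>integral_monomial\<close>).

  If some \<open>y l\<close> generates \<open>\<mm> V\<close>, then every generator \<open>x ^ \<delta> * \<alpha>\<close> of \<open>CIT(I1)\<close> has degree at least \<open>\<delta>\<close> in
  \<open>x, y 2, \<dots>, y d\<close>, while \<open>y l ^ \<delta>\<close> is itself a generator; so \<open>CIT(I1)\<close> extends to \<open>y l ^ \<delta> V\<close>, and both sides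
  extend to \<open>y l ^ (\<delta> + \<delta>') V\<close>.

  In both cases the exponents match because \<open>\<delta> + \<delta>' = n + \<delta>''\<close>, that is, because \<open>\<delta>\<close> of a complete monomial
  ideal is the largest exponent \<open>n j\<close> (\<open>tdeg_min_exps\<close>): a minimal generator \<open>\<alpha>\<close> with a larger
  value of \<open>- nu_x\<close> could be divided by some \<open>u j\<close> and would stay integral over the ideal.

  Two facts make this argument meaningful.  First, monomials behave as formal monomials: one that lies
  in an ideal generated by monomials is divisible by one of them, in the sense of exponents.  For \<open>R\<close> this is
  derived from the hypothesis that the maximal ideal has as many generators as the length of a chain of primes:
  an exchange property of primes, which is Krull's principal ideal theorem in disguise
  (\<open>prime_exchange\<close>), shows that every subset of the parameters generates a prime ideal
  (\<open>regular_primes\<close>).  The property passes to \<open>R1\<close> by clearing denominators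
  (\<open>mon_in_span_R1\<close>).  Second, \<open>I1 * I1'\<close> is again a monomial ideal
  (\<open>int_closure_monomial\<close>), which follows from a leading form argument with respect to an order of the monomials
  that refines the order given by a valuation.

  All rings occurring here are subrings of one field, so ideals are handled as sets of field elements;
  only the last section speaks about ring records.
\<close>

section \<open>Subrings, ideals and linear spans\<close>

locale comm_subring =
  fixes A :: "'a::comm_ring_1 set"
  assumes one_closed [simp]: "1 \<in> A"
    and add_closed: "a \<in> A \<Longrightarrow> b \<in> A \<Longrightarrow> a + b \<in> A"
    and mult_closed: "a \<in> A \<Longrightarrow> b \<in> A \<Longrightarrow> a * b \<in> A"
    and neg_closed: "a \<in> A \<Longrightarrow> - a \<in> A"
begin

lemma zero_closed [simp]: "0 \<in> A"
  using add_closed[OF one_closed neg_closed[OF one_closed]] by simp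

lemma diff_closed: "a \<in> A \<Longrightarrow> b \<in> A \<Longrightarrow> a - b \<in> A"
  using add_closed[of a "- b"] neg_closed[of b] by simp

lemma power_closed: "a \<in> A \<Longrightarrow> a ^ n \<in> A"
  by (induction n) (auto intro: mult_closed)

lemma sum_closed: "(\<And>i. i \<in> F \<Longrightarrow> f i \<in> A) \<Longrightarrow> sum f F \<in> A"
  by (induction F rule: infinite_finite_induct) (auto intro: add_closed)

lemma prod_closed: "(\<And>i. i \<in> F \<Longrightarrow> f i \<in> A) \<Longrightarrow> prod f F \<in> A"
  by (induction F rule: infinite_finite_induct) (auto intro: mult_closed)

end

text \<open>
  For \<open>S \<subseteq> A\<close> this is the ideal generated by \<open>S\<close>.  Generators outside \<open>A\<close> occur too: the affine chart \<open>R[\<mm>/x]\<close>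
  is described below as a span over \<open>R\<close>.
\<close>
inductive_set lin_span :: "'a::comm_ring_1 set \<Rightarrow> 'a set \<Rightarrow> 'a set" for A S where
  zero: "0 \<in> lin_span A S"
| step: "z \<in> lin_span A S \<Longrightarrow> a \<in> A \<Longrightarrow> s \<in> S \<Longrightarrow> a * s + z \<in> lin_span A S"

definition is_ideal :: "'a::comm_ring_1 set \<Rightarrow> 'a set \<Rightarrow> bool" where
  "is_ideal A I \<longleftrightarrow> I \<subseteq> A \<and> 0 \<in> I \<and> (\<forall>a\<in>I. \<forall>b\<in>I. a + b \<in> I) \<and> (\<forall>r\<in>A. \<forall>a\<in>I. r * a \<in> I)"

definition prime_in :: "'a::comm_ring_1 set \<Rightarrow> 'a set \<Rightarrow> bool" where
  "prime_in A P \<longleftrightarrow> is_ideal A P \<and> 1 \<notin> P \<and> (\<forall>a\<in>A. \<forall>b\<in>A. a * b \<in> P \<longrightarrow> a \<in> P \<or> b \<in> P)"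

lemma is_idealD:
  assumes "is_ideal A I"
  shows "a \<in> I \<Longrightarrow> a \<in> A" "0 \<in> I" "a \<in> I \<Longrightarrow> b \<in> I \<Longrightarrow> a + b \<in> I" "r \<in> A \<Longrightarrow> a \<in> I \<Longrightarrow> r * a \<in> I"
  using assms by (auto simp: is_ideal_def)

lemma prime_inD:
  assumes "prime_in A P"
  shows "is_ideal A P" "1 \<notin> P" "a \<in> A \<Longrightarrow> b \<in> A \<Longrightarrow> a * b \<in> P \<Longrightarrow> a \<in> P \<or> b \<in> P"
  using assms by (auto simp: prime_in_def)

lemma prime_in_power:
  assumes "prime_in A P" "comm_subring A" "a \<in> A" "a ^ n \<in> P"
  shows "a \<in> P"
  using assms(4)
proof (induction n)
  case 0
  then show ?case using prime_inD(2)[OF assms(1)] by simp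
next
  case (Suc n)
  then show ?case
    using prime_inD(3)[OF assms(1), of a "a ^ n"] comm_subring.power_closed[OF assms(2,3)] assms(3) by auto
qed

lemma lin_span_add: "z \<in> lin_span A S \<Longrightarrow> w \<in> lin_span A S \<Longrightarrow> z + w \<in> lin_span A S"
  by (induction z rule: lin_span.induct) (auto intro: lin_span.intros simp: add.assoc)

lemma lin_span_sum: "(\<And>i. i \<in> F \<Longrightarrow> f i \<in> lin_span A S) \<Longrightarrow> sum f F \<in> lin_span A S"
  by (induction F rule: infinite_finite_induct) (auto intro: lin_span_add lin_span.zero)

lemma lin_span_scale: "a \<in> A \<Longrightarrow> s \<in> S \<Longrightarrow> a * s \<in> lin_span A S"
  using lin_span.step[OF lin_span.zero] by fastforce

lemma lin_span_least:
  assumes "0 \<in> N" "\<And>a b. a \<in> N \<Longrightarrow> b \<in> N \<Longrightarrow> a + b \<in> N" "\<And>a s. a \<in> A \<Longrightarrow> s \<in> S \<Longrightarrow> a * s \<in> N"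
  shows "lin_span A S \<subseteq> N"
proof
  fix z assume "z \<in> lin_span A S"
  then show "z \<in> N" by induction (auto intro: assms)
qed

lemma lin_span_mono: "A \<subseteq> B \<Longrightarrow> S \<subseteq> T \<Longrightarrow> lin_span A S \<subseteq> lin_span B T"
  by (rule lin_span_least) (auto intro: lin_span.zero lin_span_add lin_span_scale)

context comm_subring
begin

lemma lin_span_incl: "s \<in> S \<Longrightarrow> s \<in> lin_span A S"
  using lin_span_scale[of 1 A s S] by simp

lemma lin_span_mult: "z \<in> lin_span A S \<Longrightarrow> a \<in> A \<Longrightarrow> a * z \<in> lin_span A S"
proof (induction z rule: lin_span.induct)
  case (step z b s)
  then show ?case using lin_span.step[of "a * z" A S "a * b" s] mult_closed by (simp add: algebra_simps)
qed (auto intro: lin_span.zero)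

lemma lin_span_neg: "z \<in> lin_span A S \<Longrightarrow> - z \<in> lin_span A S"
  using lin_span_mult[of z S "-1"] neg_closed by simp

lemma lin_span_diff: "z \<in> lin_span A S \<Longrightarrow> w \<in> lin_span A S \<Longrightarrow> z - w \<in> lin_span A S"
  using lin_span_add[of z A S "- w"] lin_span_neg[of w] by simp

lemma lin_span_subset_span:
  assumes "S \<subseteq> lin_span A T" shows "lin_span A S \<subseteq> lin_span A T"
  using assms by (intro lin_span_least) (auto intro: lin_span.zero lin_span_add lin_span_mult)

lemma lin_span_subset_ideal: "is_ideal A I \<Longrightarrow> S \<subseteq> I \<Longrightarrow> lin_span A S \<subseteq> I"
  by (rule lin_span_least) (auto dest: is_idealD)

lemma lin_span_closed: "S \<subseteq> A \<Longrightarrow> lin_span A S \<subseteq> A"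
  by (rule lin_span_least) (auto intro: add_closed mult_closed)

lemma is_ideal_lin_span: "S \<subseteq> A \<Longrightarrow> is_ideal A (lin_span A S)"
  unfolding is_ideal_def
  using lin_span_closed by (auto intro: lin_span.zero lin_span_add lin_span_mult)

lemma lin_span_ideal: "is_ideal A I \<Longrightarrow> lin_span A I = I"
  using lin_span_subset_ideal[of I I] lin_span_incl by blast

lemma ideal_neg: "is_ideal A I \<Longrightarrow> a \<in> I \<Longrightarrow> - a \<in> I"
  using is_idealD(4)[of A I "-1" a] neg_closed by simp

lemma ideal_diff: "is_ideal A I \<Longrightarrow> a \<in> I \<Longrightarrow> b \<in> I \<Longrightarrow> a - b \<in> I"
  using is_idealD(3)[of A I a "- b"] ideal_neg[of I b] by simp

lemma lin_span_insert: "z \<in> lin_span A (insert s S) \<longleftrightarrow> (\<exists>a\<in>A. z - a * s \<in> lin_span A S)"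
proof
  assume "z \<in> lin_span A (insert s S)"
  then show "\<exists>a\<in>A. z - a * s \<in> lin_span A S"
  proof induction
    case zero
    show ?case by (rule bexI[of _ 0]) (auto intro: lin_span.zero)
  next
    case (step z b t)
    then obtain a where a: "a \<in> A" "z - a * s \<in> lin_span A S" by blast
    show ?case
    proof (cases "t = s")
      case True
      then show ?thesis using a step
        by (intro bexI[of _ "a + b"]) (auto simp: algebra_simps intro: add_closed)
    next
      case False
      then have "b * t + (z - a * s) \<in> lin_span A S"
        using step a by (intro lin_span.step) auto
      then show ?thesis using a by (intro bexI[of _ a]) (auto simp: algebra_simps)
    qed
  qed
next
  assume "\<exists>a\<in>A. z - a * s \<in> lin_span A S"
  then obtain a where a: "a \<in> A" "z - a * s \<in> lin_span A S" by blast
  have "a * s + (z - a * s) \<in> lin_span A (insert s S)"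
    using a lin_span_mono[of A A S "insert s S"] by (intro lin_span_add lin_span_scale) auto
  then show "z \<in> lin_span A (insert s S)" by simp
qed

lemma lin_span_Un:
  "z \<in> lin_span A (S \<union> T) \<longleftrightarrow> (\<exists>p\<in>lin_span A S. \<exists>q\<in>lin_span A T. z = p + q)"
proof
  have "lin_span A (S \<union> T) \<subseteq> {p + q |p q. p \<in> lin_span A S \<and> q \<in> lin_span A T}"
  proof (rule lin_span_least)
    show "0 \<in> {p + q |p q. p \<in> lin_span A S \<and> q \<in> lin_span A T}"
      by (auto intro!: exI[of _ 0] lin_span.zero)
  next
    fix a b assume "a \<in> {p + q |p q. p \<in> lin_span A S \<and> q \<in> lin_span A T}"
      "b \<in> {p + q |p q. p \<in> lin_span A S \<and> q \<in> lin_span A T}"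
    then obtain p q p' q' where "a = p + q" "b = p' + q'" "p \<in> lin_span A S" "q \<in> lin_span A T"
      "p' \<in> lin_span A S" "q' \<in> lin_span A T" by blast
    then show "a + b \<in> {p + q |p q. p \<in> lin_span A S \<and> q \<in> lin_span A T}"
      by (intro CollectI exI[of _ "p + p'"] exI[of _ "q + q'"]) (auto simp: algebra_simps intro: lin_span_add)
  next
    fix a s assume "a \<in> A" "s \<in> S \<union> T"
    then show "a * s \<in> {p + q |p q. p \<in> lin_span A S \<and> q \<in> lin_span A T}"
      using lin_span_scale[of a A s S] lin_span_scale[of a A s T] lin_span.zero[of A S] lin_span.zero[of A T]
      by (force intro: exI[of _ "0::'a"])
  qed
  then show "z \<in> lin_span A (S \<union> T) \<Longrightarrow> \<exists>p\<in>lin_span A S. \<exists>q\<in>lin_span A T. z = p + q" by blast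
  show "\<exists>p\<in>lin_span A S. \<exists>q\<in>lin_span A T. z = p + q \<Longrightarrow> z \<in> lin_span A (S \<union> T)"
    using lin_span_mono[of A A S "S \<union> T"] lin_span_mono[of A A T "S \<union> T"] by (auto intro!: lin_span_add)
qed

lemma lin_span_span_Un: "lin_span A (lin_span A S \<union> T) = lin_span A (S \<union> T)"
proof
  show "lin_span A (lin_span A S \<union> T) \<subseteq> lin_span A (S \<union> T)"
    using lin_span_mono[of A A S "S \<union> T"] lin_span_incl[of _ "S \<union> T"] by (intro lin_span_subset_span) auto
  show "lin_span A (S \<union> T) \<subseteq> lin_span A (lin_span A S \<union> T)"
    using lin_span_incl by (intro lin_span_mono) auto
qed

end

section \<open>Chains of primes in Noetherian rings\<close>

text \<open>
  For a prime \<open>Q\<close> of \<open>A\<close> and an ideal \<open>N\<close> this is the contraction to \<open>A\<close> of the extension of \<open>N\<close> to the localization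
  at \<open>Q\<close>.  Working with saturated ideals replaces the localizations and residue class rings of the
  classical proofs, which would not be subrings of the given field.
\<close>
definition saturate :: "'a::comm_ring_1 set \<Rightarrow> 'a set \<Rightarrow> 'a set \<Rightarrow> 'a set" where
  "saturate A Q N = {r \<in> A. \<exists>t\<in>A - Q. t * r \<in> N}"

definition saturated :: "'a::comm_ring_1 set \<Rightarrow> 'a set \<Rightarrow> 'a set \<Rightarrow> bool" where
  "saturated A Q N \<longleftrightarrow> is_ideal A N \<and> (\<forall>t\<in>A - Q. \<forall>r\<in>A. t * r \<in> N \<longrightarrow> r \<in> N)"

lemma saturatedD:
  "saturated A Q N \<Longrightarrow> is_ideal A N"
  "saturated A Q N \<Longrightarrow> t \<in> A \<Longrightarrow> t \<notin> Q \<Longrightarrow> r \<in> A \<Longrightarrow> t * r \<in> N \<Longrightarrow> r \<in> N"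
  by (auto simp: saturated_def)

lemma prime_complement_mult:
  "prime_in A Q \<Longrightarrow> s \<in> A - Q \<Longrightarrow> t \<in> A - Q \<Longrightarrow> s * t \<notin> Q"
  by (auto simp: prime_in_def)

context comm_subring
begin

lemma is_ideal_Int: "is_ideal A I \<Longrightarrow> is_ideal A J \<Longrightarrow> is_ideal A (I \<inter> J)"
  by (auto simp: is_ideal_def)

lemma saturated_Int: "saturated A Q I \<Longrightarrow> saturated A Q J \<Longrightarrow> saturated A Q (I \<inter> J)"
  by (auto simp: saturated_def is_ideal_Int)

lemma saturate_incl:
  assumes "prime_in A Q" "is_ideal A N" shows "N \<subseteq> saturate A Q N"
  using assms by (auto simp: saturate_def prime_in_def is_ideal_def intro!: bexI[of _ 1])

lemma saturated_saturate:
  assumes Q: "prime_in A Q" and N: "is_ideal A N"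
  shows "saturated A Q (saturate A Q N)"
  unfolding saturated_def is_ideal_def
proof (intro conjI ballI impI)
  show "saturate A Q N \<subseteq> A" by (auto simp: saturate_def)
  show "0 \<in> saturate A Q N" using saturate_incl[OF Q N] is_idealD(2)[OF N] by auto
next
  fix a b assume "a \<in> saturate A Q N" "b \<in> saturate A Q N"
  then obtain s t where st: "a \<in> A" "b \<in> A" "s \<in> A - Q" "t \<in> A - Q" "s * a \<in> N" "t * b \<in> N"
    by (auto simp: saturate_def)
  have "(s * t) * (a + b) = t * (s * a) + s * (t * b)" by (simp add: algebra_simps)
  also have "\<dots> \<in> N" using st by (simp add: is_idealD(3)[OF N] is_idealD(4)[OF N])
  finally show "a + b \<in> saturate A Q N"
    using st prime_complement_mult[OF Q, of s t] by (auto simp: saturate_def intro!: add_closed bexI[of _ "s * t"] mult_closed)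
next
  fix r a assume r: "r \<in> A" and "a \<in> saturate A Q N"
  then obtain s where s: "a \<in> A" "s \<in> A - Q" "s * a \<in> N" by (auto simp: saturate_def)
  have "s * (r * a) = r * (s * a)" by (simp add: algebra_simps)
  also have "\<dots> \<in> N" by (rule is_idealD(4)[OF N r s(3)])
  finally show "r * a \<in> saturate A Q N"
    using s r by (auto simp: saturate_def intro: mult_closed)
next
  fix t r assume t: "t \<in> A - Q" and r: "r \<in> A" and "t * r \<in> saturate A Q N"
  then obtain s where s: "s \<in> A - Q" "s * (t * r) \<in> N" by (auto simp: saturate_def)
  then show "r \<in> saturate A Q N"
    using t r prime_complement_mult[OF Q, of s t]
    by (auto simp: saturate_def mult.assoc intro!: bexI[of _ "s * t"] mult_closed)
qed

lemma saturate_least: "saturated A Q I \<Longrightarrow> N \<subseteq> I \<Longrightarrow> saturate A Q N \<subseteq> I"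
  by (auto simp: saturate_def saturated_def)

lemma saturate_mono: "N \<subseteq> M \<Longrightarrow> saturate A Q N \<subseteq> saturate A Q M"
  by (auto simp: saturate_def)

lemma saturated_prime:
  assumes "prime_in A P" "P \<subseteq> Q" shows "saturated A Q P"
  using assms by (auto simp: saturated_def prime_in_def)

lemma saturated_weaken: "saturated A Q N \<Longrightarrow> Q \<subseteq> Q' \<Longrightarrow> saturated A Q' N"
  by (auto simp: saturated_def)

end

locale noetherian_subring = comm_subring +
  assumes maximal_ideal_in_family:
    "F \<noteq> {} \<Longrightarrow> (\<And>I. I \<in> F \<Longrightarrow> is_ideal A I) \<Longrightarrow> \<exists>M\<in>F. \<forall>I\<in>F. M \<subseteq> I \<longrightarrow> I = M"
begin

lemma obtain_maximal_ideal:
  assumes "K \<in> F" "\<And>I. I \<in> F \<Longrightarrow> is_ideal A I"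
  obtains M where "M \<in> F" "\<And>I. I \<in> F \<Longrightarrow> M \<subseteq> I \<Longrightarrow> I = M"
  using maximal_ideal_in_family[of F] assms by blast

text \<open>
  Nakayama's lemma for the localization at \<open>Q\<close>.  Among the saturated ideals that contain \<open>N\<close> but not \<open>M\<close>, take a
  maximal one, \<open>N'\<close>.  Any \<open>q * g\<close> with \<open>q \<in> Q\<close> and \<open>g \<in> M\<close> must lie in \<open>N'\<close>: otherwise \<open>g\<close> would be, up to a
  factor outside \<open>Q\<close>, congruent to a multiple of \<open>q * g\<close> modulo \<open>N'\<close>, and \<open>t - a * q\<close> is a unit of the localization.
\<close>
lemma nakayama_saturate:
  assumes Q: "prime_in A Q" and N: "is_ideal A N" and M: "M \<subseteq> A"
    and sub: "M \<subseteq> saturate A Q (lin_span A (N \<union> {q * g |q g. q \<in> Q \<and> g \<in> M}))"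
  shows "M \<subseteq> saturate A Q N"
proof (rule ccontr)
  assume nM: "\<not> M \<subseteq> saturate A Q N"
  define F where "F = {N'. saturated A Q N' \<and> N \<subseteq> N' \<and> \<not> M \<subseteq> N'}"
  have mem: "saturate A Q N \<in> F"
    using nM saturated_saturate[OF Q N] saturate_incl[OF Q N] by (auto simp: F_def)
  have Fi: "\<And>I. I \<in> F \<Longrightarrow> is_ideal A I" by (auto simp: F_def saturated_def)
  obtain N' where N'F: "N' \<in> F" and max: "\<And>I. I \<in> F \<Longrightarrow> N' \<subseteq> I \<Longrightarrow> I = N'"
    using obtain_maximal_ideal[OF mem, of thesis] Fi by blast
  have N': "saturated A Q N'" "N \<subseteq> N'" "\<not> M \<subseteq> N'" "is_ideal A N'"
    using N'F by (auto simp: F_def saturated_def)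
  have QA: "Q \<subseteq> A" using prime_inD(1)[OF Q] by (auto simp: is_ideal_def)
  have qg: "q * g \<in> N'" if q: "q \<in> Q" and g: "g \<in> M" for q g
  proof (rule ccontr)
    assume nqg: "q * g \<notin> N'"
    have qA: "q \<in> A" and gA: "g \<in> A" using q g QA M by auto
    have gN': "g \<notin> N'" using nqg is_idealD(4)[OF N'(4) qA] by blast
    let ?L = "lin_span A (insert (q * g) N')"
    have L: "is_ideal A ?L"
      using N'(4) qA gA by (intro is_ideal_lin_span) (auto intro: mult_closed dest: is_idealD)
    have sL: "saturated A Q (saturate A Q ?L)" by (rule saturated_saturate[OF Q L])
    have incl: "?L \<subseteq> saturate A Q ?L" by (rule saturate_incl[OF Q L])
    have "N' \<subseteq> saturate A Q ?L" using incl lin_span_incl by blast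
    moreover have "q * g \<in> saturate A Q ?L" using incl lin_span_incl by blast
    ultimately have "saturate A Q ?L \<notin> F" using max nqg by blast
    then have "M \<subseteq> saturate A Q ?L"
      using sL N'(2) \<open>N' \<subseteq> saturate A Q ?L\<close> by (auto simp: F_def)
    then obtain t where t: "t \<in> A - Q" "t * g \<in> ?L" using g by (auto simp: saturate_def)
    then obtain a where a: "a \<in> A" "t * g - a * (q * g) \<in> N'"
      using lin_span_insert[of "t * g" "q * g" N'] lin_span_ideal[OF N'(4)] by auto
    have "(t - a * q) * g \<in> N'" using a(2) by (simp add: algebra_simps)
    moreover have "t - a * q \<notin> Q"
    proof
      assume "t - a * q \<in> Q"
      then have "(t - a * q) + a * q \<in> Q"
        using a q by (intro is_idealD(3)[OF prime_inD(1)[OF Q]] is_idealD(4)[OF prime_inD(1)[OF Q]]) auto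
      then show False using t by simp
    qed
    ultimately have "g \<in> N'"
      using saturatedD(2)[OF N'(1), of "t - a * q" g] t a qA gA by (auto intro: diff_closed mult_closed)
    then show False using gN' by simp
  qed
  have "lin_span A (N \<union> {q * g |q g. q \<in> Q \<and> g \<in> M}) \<subseteq> N'"
    using N' qg by (intro lin_span_subset_ideal) auto
  then show False using sub saturate_least[OF N'(1)] N'(3) by blast
qed

lemma decreasing_chain:
  assumes "\<And>j. T (Suc j) \<subseteq> T j" "i \<le> j" shows "(T j :: 'b set) \<subseteq> T i"
  using assms by (simp add: lift_Suc_antimono_le)

text \<open>
  Between \<open>I\<close> and \<open>I'\<close> with \<open>Q I' \<subseteq> I\<close> the saturated ideals are the subspaces of a vector space over the residue
  field of \<open>Q\<close>, where the ascending chain condition implies the descending one by taking complements.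
  The maximal \<open>W\<close> with \<open>W \<inter> T j = I\<close> for some \<open>j\<close> is such a complement.
\<close>
lemma dcc_layer:
  assumes Q: "prime_in A Q" and I: "saturated A Q I" and I': "saturated A Q I'"
    and QI: "\<And>q r. q \<in> Q \<Longrightarrow> r \<in> I' \<Longrightarrow> q * r \<in> I"
    and T: "\<And>j. saturated A Q (T j)" "\<And>j. I \<subseteq> T j" "\<And>j. T j \<subseteq> I'" "\<And>j. T (Suc j) \<subseteq> T j"
  shows "\<exists>J. \<forall>j\<ge>J. T j = T J"
proof -
  define F where "F = {W. saturated A Q W \<and> I \<subseteq> W \<and> W \<subseteq> I' \<and> (\<exists>j. W \<inter> T j = I)}"
  have mem: "I \<in> F" using I T(2,3) by (force simp: F_def)
  have Fi: "\<And>I. I \<in> F \<Longrightarrow> is_ideal A I" by (auto simp: F_def saturated_def)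
  obtain W where WF: "W \<in> F" and max: "\<And>K. K \<in> F \<Longrightarrow> W \<subseteq> K \<Longrightarrow> K = W"
    using obtain_maximal_ideal[OF mem, of thesis] Fi by blast
  from WF obtain J where W: "saturated A Q W" "I \<subseteq> W" "W \<subseteq> I'" "W \<inter> T J = I" by (auto simp: F_def)
  have Wi: "is_ideal A W" using W(1) by (auto simp: saturated_def)
  have Ti: "is_ideal A (T j)" for j using T(1) by (auto simp: saturated_def)
  have Ii': "is_ideal A I'" and Ii: "is_ideal A I" using I I' by (auto simp: saturated_def)
  have "T j = T J" if "j \<ge> J" for j
  proof (rule ccontr)
    assume "T j \<noteq> T J"
    moreover have sub: "T j \<subseteq> T J" using decreasing_chain[of T J j] T(4) that by blast
    ultimately obtain z where z: "z \<in> T J" "z \<notin> T j" by blast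
    have zA: "z \<in> A" using z Ti by (auto dest: is_idealD)
    let ?L = "lin_span A (insert z W)"
    have L: "is_ideal A ?L"
      using Wi zA by (intro is_ideal_lin_span) (auto dest: is_idealD)
    let ?W = "saturate A Q ?L"
    have incl: "?L \<subseteq> ?W" by (rule saturate_incl[OF Q L])
    have zW: "z \<in> ?W" and WW: "W \<subseteq> ?W" using incl lin_span_incl by blast+
    have WI': "?W \<subseteq> I'"
      using W(3) z T(3) by (intro saturate_least[OF I'] lin_span_subset_ideal[OF Ii']) auto
    have "?W \<inter> T j = I"
    proof
      show "I \<subseteq> ?W \<inter> T j" using WW W T(2) by auto
      show "?W \<inter> T j \<subseteq> I"
      proof
        fix r assume r: "r \<in> ?W \<inter> T j"
        then obtain t where t: "t \<in> A - Q" "t * r \<in> ?L" by (auto simp: saturate_def)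
        then obtain c where c: "c \<in> A" "t * r - c * z \<in> W"
          using lin_span_insert[of "t * r" z W] lin_span_ideal[OF Wi] by auto
        have rA: "r \<in> A" using r Ti by (auto dest: is_idealD)
        have trj: "t * r \<in> T j" using r t by (auto intro: is_idealD(4)[OF Ti])
        have "t * r - c * z \<in> T J"
          using trj sub c z by (intro ideal_diff[OF Ti]) (auto intro: is_idealD(4)[OF Ti])
        then have wI: "t * r - c * z \<in> I" using c(2) W(4) by auto
        show "r \<in> I"
        proof (cases "c \<in> Q")
          case True
          then have "c * z \<in> I" using QI z T(3) by blast
          then have "(t * r - c * z) + c * z \<in> I" using wI by (intro is_idealD(3)[OF Ii])
          then show ?thesis using saturatedD(2)[OF I, of t r] t rA by simp
        next
          case False
          have "t * r - (t * r - c * z) \<in> T j"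
            by (rule ideal_diff[OF Ti trj]) (use wI T(2) in blast)
          then have "c * z \<in> T j" by simp
          then have "z \<in> T j" using saturatedD(2)[OF T(1), of c z] False c zA by simp
          then show ?thesis using z by simp
        qed
      qed
    qed
    then have "?W \<in> F" using saturated_saturate[OF Q L] WW W(2) WI' by (auto simp: F_def)
    then have "?W = W" using max WW by blast
    then have "z \<in> I" using zW z W(4) by blast
    then show False using z T(2) by blast
  qed
  then show ?thesis by blast
qed

text \<open>
  If \<open>Q\<close> is the only prime between \<open>I0\<close> and \<open>Q\<close>, then the localization at \<open>Q\<close> modulo \<open>I0\<close> is Artinian.  By
  Noetherian induction on \<open>I\<close>: a maximal annihilator of an element modulo \<open>I\<close> is prime, hence equal to \<open>Q\<close>,
  and the corresponding element enlarges \<open>I\<close> by one layer.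
\<close>
lemma dcc_above:
  assumes Q: "prime_in A Q" and I0: "is_ideal A I0" and I: "saturated A Q I" "I0 \<subseteq> I"
    and only: "\<And>P. prime_in A P \<Longrightarrow> I0 \<subseteq> P \<Longrightarrow> P \<subseteq> Q \<Longrightarrow> P = Q"
    and T: "\<And>j. saturated A Q (T j)" "\<And>j. I \<subseteq> T j" "\<And>j. T (Suc j) \<subseteq> T j"
  shows "\<exists>J. \<forall>j\<ge>J. T j = T J"
proof (rule ccontr)
  assume nT: "\<not> (\<exists>J. \<forall>j\<ge>J. T j = T J)"
  define bad where "bad = (\<lambda>I T. (\<forall>j. saturated A Q (T j) \<and> I \<subseteq> T j \<and> T (Suc j) \<subseteq> T j) \<and>
      \<not> (\<exists>J. \<forall>j\<ge>J. T j = T J))"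
  define F where "F = {I. saturated A Q I \<and> I0 \<subseteq> I \<and> (\<exists>T. bad I T)}"
  have "bad I T" using T nT unfolding bad_def by blast
  then have mem: "I \<in> F" using I by (auto simp: F_def)
  have Fi: "\<And>I. I \<in> F \<Longrightarrow> is_ideal A I" by (auto simp: F_def saturated_def)
  obtain M where MF: "M \<in> F" and max: "\<And>K. K \<in> F \<Longrightarrow> M \<subseteq> K \<Longrightarrow> K = M"
    using obtain_maximal_ideal[OF mem, of thesis] Fi by blast
  from MF obtain U where M: "saturated A Q M" "I0 \<subseteq> M" and U: "bad M U" by (auto simp: F_def)
  have Us: "saturated A Q (U j)" "M \<subseteq> U j" "U (Suc j) \<subseteq> U j" for j using U by (auto simp: bad_def)
  have Mi: "is_ideal A M" using M(1) by (auto simp: saturated_def)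
  have Ui: "is_ideal A (U j)" for j using Us by (auto simp: saturated_def)
  have QA: "Q \<subseteq> A" using prime_inD(1)[OF Q] by (auto simp: is_ideal_def)
  have "M \<noteq> A"
  proof
    assume "M = A"
    then have "U j = A" for j using Us(2) Ui by (auto dest: is_idealD)
    then show False using U by (auto simp: bad_def)
  qed
  define ann where "ann = (\<lambda>g. {r \<in> A. r * g \<in> M})"
  have ann_ideal: "is_ideal A (ann g)" if "g \<in> A" for g
    using Mi that by (auto simp: is_ideal_def ann_def distrib_right mult.assoc intro: add_closed mult_closed)
  obtain g0 where g0: "g0 \<in> A - M" using \<open>M \<noteq> A\<close> Mi by (auto dest: is_idealD)
  obtain G where G: "G \<in> ann ` (A - M)" "\<And>I. I \<in> ann ` (A - M) \<Longrightarrow> G \<subseteq> I \<Longrightarrow> I = G"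
    using obtain_maximal_ideal[of "ann g0" "ann ` (A - M)" thesis] g0 ann_ideal by blast
  from G(1) obtain g where g: "g \<in> A - M" and Gg: "G = ann g" by (rule imageE)
  have gmax: "ann h = ann g" if "h \<in> A - M" "ann g \<subseteq> ann h" for h
    using G(2)[of "ann h"] that by (simp add: Gg)
  have prime: "prime_in A (ann g)"
    unfolding prime_in_def
  proof (intro conjI ballI impI)
    show "is_ideal A (ann g)" using ann_ideal g by blast
    show "1 \<notin> ann g" using g by (auto simp: ann_def)
    fix a b assume ab: "a \<in> A" "b \<in> A" "a * b \<in> ann g"
    show "a \<in> ann g \<or> b \<in> ann g"
    proof (rule disjCI)
      assume "b \<notin> ann g"
      then have "b * g \<in> A - M" using ab g by (auto simp: ann_def intro: mult_closed)
      moreover have "ann g \<subseteq> ann (b * g)"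
        using is_idealD(4)[OF Mi, of b] ab by (auto simp: ann_def mult.left_commute[of _ b])
      ultimately have "ann (b * g) = ann g" by (rule gmax)
      moreover have "a \<in> ann (b * g)" using ab by (auto simp: ann_def mult.assoc)
      ultimately show "a \<in> ann g" by simp
    qed
  qed
  have "I0 \<subseteq> ann g"
    using M(2) g Mi is_idealD(4)[OF Mi, of g] is_idealD(1)[OF I0] by (auto simp: ann_def mult.commute)
  moreover have "ann g \<subseteq> Q"
    using saturatedD(2)[OF M(1), of _ g] g by (auto simp: ann_def)
  ultimately have annQ: "ann g = Q" using only prime by blast
  let ?L = "lin_span A (insert g M)"
  let ?M = "saturate A Q ?L"
  have L: "is_ideal A ?L" using Mi g by (intro is_ideal_lin_span) (auto dest: is_idealD)
  have incl: "?L \<subseteq> ?M" by (rule saturate_incl[OF Q L])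
  have gM: "g \<in> ?M" and MM: "M \<subseteq> ?M" using incl lin_span_incl by blast+
  have satM: "saturated A Q ?M" by (rule saturated_saturate[OF Q L])
  have iM: "is_ideal A ?M" using satM by (auto simp: saturated_def)
  have QM: "q * r \<in> M" if q: "q \<in> Q" and r: "r \<in> ?M" for q r
  proof -
    obtain t where t: "t \<in> A - Q" "t * r \<in> ?L" and rA: "r \<in> A" using r by (auto simp: saturate_def)
    then obtain c where c: "c \<in> A" "t * r - c * g \<in> M"
      using lin_span_insert[of "t * r" g M] lin_span_ideal[OF Mi] by auto
    have "q * g \<in> M" using annQ q by (auto simp: ann_def)
    then have "q * (t * r - c * g) + c * (q * g) \<in> M"
      using is_idealD(4)[OF Mi _ c(2), of q] is_idealD(4)[OF Mi c(1)] q QA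
      by (intro is_idealD(3)[OF Mi]) auto
    then have "t * (q * r) \<in> M" by (simp add: algebra_simps)
    then show ?thesis using saturatedD(2)[OF M(1), of t "q * r"] t rA q QA by (auto intro: mult_closed)
  qed
  have "\<exists>J. \<forall>j\<ge>J. U j \<inter> ?M = U J \<inter> ?M"
    using QM M Us MM satM
    by (intro dcc_layer[OF Q M(1) satM]) (auto intro: saturated_Int dest: subsetD[OF Us(3)])
  then obtain J1 where J1: "\<And>j. j \<ge> J1 \<Longrightarrow> U j \<inter> ?M = U J1 \<inter> ?M" by blast
  define V where "V = (\<lambda>j. saturate A Q (lin_span A (U j \<union> ?M)))"
  have Vi: "is_ideal A (lin_span A (U j \<union> ?M))" for j
    using Ui iM by (intro is_ideal_lin_span) (auto dest: is_idealD)
  have "\<not> bad ?M V"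
  proof
    assume "bad ?M V"
    then have "?M \<in> F" using satM MM M(2) by (auto simp: F_def)
    then show False using max MM gM g by blast
  qed
  moreover have "saturated A Q (V j)" "?M \<subseteq> V j" "V (Suc j) \<subseteq> V j" for j
  proof -
    show "saturated A Q (V j)" unfolding V_def by (rule saturated_saturate[OF Q Vi])
    show "?M \<subseteq> V j" using saturate_incl[OF Q Vi[of j]] lin_span_incl by (auto simp: V_def)
    show "V (Suc j) \<subseteq> V j" unfolding V_def
      using Us(3) by (intro saturate_mono lin_span_mono) auto
  qed
  ultimately obtain J2 where J2: "\<And>j. j \<ge> J2 \<Longrightarrow> V j = V J2" by (auto simp: bad_def)
  define J where "J = max J1 J2"
  have "U j = U J" if j: "j \<ge> J" for j
  proof
    show sub: "U j \<subseteq> U J" using decreasing_chain[of U J j] Us(3) j by blast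
    show "U J \<subseteq> U j"
    proof
      fix r assume r: "r \<in> U J"
      have rA: "r \<in> A" using r Ui by (auto dest: is_idealD)
      have "V J = V j" using J2[of j] J2[of J] j by (auto simp: J_def)
      moreover have "r \<in> V J" using r saturate_incl[OF Q Vi[of J]] lin_span_incl by (auto simp: V_def)
      ultimately obtain t where t: "t \<in> A - Q" "t * r \<in> lin_span A (U j \<union> ?M)"
        by (auto simp: V_def saturate_def)
      then obtain p q where pq: "p \<in> U j" "q \<in> ?M" "t * r = p + q"
        using lin_span_Un[of "t * r" "U j" ?M] lin_span_ideal[OF Ui] lin_span_ideal[OF iM] by auto
      have "t * r - p \<in> U J"
        using r t pq sub by (intro ideal_diff[OF Ui] is_idealD(4)[OF Ui]) auto
      then have "q \<in> U J \<inter> ?M" using pq by simp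
      then have "q \<in> U j" using J1[of j] J1[of J] j by (auto simp: J_def)
      then have "t * r \<in> U j" using pq is_idealD(3)[OF Ui] by simp
      then show "r \<in> U j" using saturatedD(2)[OF Us(1), of t r] t rA by simp
    qed
  qed
  moreover have "\<not> (\<exists>J. \<forall>j\<ge>J. U j = U J)" using U unfolding bad_def by (rule conjunct2)
  ultimately show False by blast
qed

text \<open>
  Krull's principal ideal theorem for the localization at \<open>Q'\<close> modulo \<open>P\<close>, stated as an exchange property: the middle
  prime can be chosen to contain any prescribed \<open>x \<in> Q'\<close>.  Otherwise \<open>Q'\<close> is the only prime between \<open>P + (x)\<close> and
  \<open>Q'\<close>, and the symbolic powers \<open>L j\<close> of \<open>Q\<close> satisfy \<open>L j \<subseteq> L (j + 1) + x L j\<close> for some \<open>j\<close> after localization,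
  by the descending chain condition modulo \<open>x\<close>.  Nakayama's lemma, applied first at \<open>Q'\<close> and then at \<open>Q\<close>, gives
  \<open>L j \<subseteq> P\<close>, although \<open>L j\<close> contains the \<open>j\<close>-th powers of the elements of \<open>Q\<close>.
\<close>
lemma prime_exchange:
  assumes P: "prime_in A P" and Q: "prime_in A Q" and Q': "prime_in A Q'"
    and PQ: "P \<subset> Q" "Q \<subset> Q'" and x: "x \<in> Q'"
  shows "\<exists>P'. prime_in A P' \<and> P \<subset> P' \<and> P' \<subset> Q' \<and> x \<in> P'"
proof (rule ccontr)
  assume no: "\<not> ?thesis"
  then have xQ: "x \<notin> Q" using Q PQ by blast
  have Pi: "is_ideal A P" and Qi: "is_ideal A Q" and Qi': "is_ideal A Q'"
    using P Q Q' by (auto simp: prime_in_def)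
  have xA: "x \<in> A" using x Qi' by (auto dest: is_idealD)
  let ?I0 = "lin_span A (insert x P)"
  have I0: "is_ideal A ?I0" using xA Pi by (intro is_ideal_lin_span) (auto dest: is_idealD)
  have only: "P' = Q'" if "prime_in A P'" "?I0 \<subseteq> P'" "P' \<subseteq> Q'" for P'
    using no that xQ PQ lin_span_incl[of _ "insert x P"] by blast
  \<comment> \<open>Symbolic powers of \<open>Q\<close> modulo \<open>P\<close>.\<close>
  define next_power where "next_power = (\<lambda>L. lin_span A (P \<union> {q * g |q g. q \<in> Q \<and> g \<in> L}))"
  define L where "L = (\<lambda>j. ((\<lambda>L. saturate A Q (next_power L)) ^^ j) A)"
  have L0: "L 0 = A" and LSuc: "L (Suc j) = saturate A Q (next_power (L j))" for j
    by (auto simp: L_def)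
  have satA: "saturated A Q A" by (auto simp: saturated_def is_ideal_def intro: add_closed mult_closed)
  have np: "is_ideal A (next_power N)" if "N \<subseteq> A" for N
    unfolding next_power_def using that Pi Qi by (intro is_ideal_lin_span) (auto intro: mult_closed dest: is_idealD)
  have Lsat: "saturated A Q (L j)" for j
  proof (cases j)
    case (Suc i)
    have "L i \<subseteq> A" by (cases i) (auto simp: L0 LSuc saturate_def)
    then show ?thesis using Suc saturated_saturate[OF Q np] by (simp add: LSuc)
  qed (simp add: L0 satA)
  have Li: "is_ideal A (L j)" for j using Lsat by (auto simp: saturated_def)
  have LA: "L j \<subseteq> A" for j using Li by (auto dest: is_idealD)
  have npmono: "N \<subseteq> N' \<Longrightarrow> next_power N \<subseteq> next_power N'" for N N'
    unfolding next_power_def by (intro lin_span_mono) auto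
  have Ldec: "L (Suc j) \<subseteq> L j" for j
  proof (induction j)
    case 0
    then show ?case using LA[of "Suc 0"] by (simp add: L0)
  next
    case (Suc j)
    then show ?case unfolding LSuc[of "Suc j"] LSuc[of j]
      by (intro saturate_mono npmono) (simp add: LSuc[symmetric])
  qed
  have PL: "P \<subseteq> L j" for j
  proof (cases j)
    case (Suc i)
    then show ?thesis using saturate_incl[OF Q np[OF LA[of i]]] lin_span_incl
      by (auto simp: LSuc next_power_def)
  qed (use Pi in \<open>auto simp: L0 dest: is_idealD\<close>)
  define N where "N = (\<lambda>j. saturate A Q' (lin_span A (insert x (L j))))"
  have Nspan: "is_ideal A (lin_span A (insert x (L j)))" for j
    using xA LA by (intro is_ideal_lin_span) auto
  have Nsat: "saturated A Q' (N j)" for j unfolding N_def by (rule saturated_saturate[OF Q' Nspan])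
  have "\<exists>J. \<forall>j\<ge>J. N j = N J"
  proof (rule dcc_above[OF Q' I0 _ _ only])
    show "saturated A Q' (saturate A Q' ?I0)" by (rule saturated_saturate[OF Q' I0])
    show "?I0 \<subseteq> saturate A Q' ?I0" by (rule saturate_incl[OF Q' I0])
    show "saturated A Q' (N j)" for j by (rule Nsat)
    show "saturate A Q' ?I0 \<subseteq> N j" for j unfolding N_def
      using PL by (intro saturate_mono lin_span_mono) auto
    show "N (Suc j) \<subseteq> N j" for j unfolding N_def
      using Ldec[of j] by (intro saturate_mono lin_span_mono) auto
  qed auto
  then obtain J where "N (Suc J) = N J" using le_Suc_eq by blast
  have "L J \<subseteq> saturate A Q' (L (Suc J))"
  proof (rule nakayama_saturate[OF Q' Li LA])
    show "L J \<subseteq> saturate A Q' (lin_span A (L (Suc J) \<union> {q * g |q g. q \<in> Q' \<and> g \<in> L J}))"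
    proof
      fix r assume r: "r \<in> L J"
      then have "r \<in> N (Suc J)"
        using saturate_incl[OF Q' Nspan[of J]] lin_span_incl \<open>N (Suc J) = N J\<close> by (auto simp: N_def)
      then obtain s where s: "s \<in> A - Q'" "s * r \<in> lin_span A (insert x (L (Suc J)))" and rA: "r \<in> A"
        by (auto simp: N_def saturate_def)
      then obtain b where b: "b \<in> A" "s * r - b * x \<in> L (Suc J)"
        using lin_span_insert[of "s * r" x "L (Suc J)"] lin_span_ideal[OF Li] by auto
      have "s * r - (s * r - b * x) \<in> L J"
      proof (rule ideal_diff[OF Li])
        show "s * r \<in> L J" using r s by (intro is_idealD(4)[OF Li]) auto
        show "s * r - b * x \<in> L J" using b Ldec by blast
      qed
      then have "x * b \<in> L J" by (simp add: mult.commute)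
      then have bL: "b \<in> L J" using saturatedD(2)[OF Lsat, of x b] xA xQ b by simp
      have "(s * r - b * x) + x * b \<in> lin_span A (L (Suc J) \<union> {q * g |q g. q \<in> Q' \<and> g \<in> L J})"
        using b bL x by (intro lin_span_add lin_span_incl) auto
      then have "s * r \<in> lin_span A (L (Suc J) \<union> {q * g |q g. q \<in> Q' \<and> g \<in> L J})"
        by (simp add: mult.commute)
      then show "r \<in> saturate A Q' (lin_span A (L (Suc J) \<union> {q * g |q g. q \<in> Q' \<and> g \<in> L J}))"
        using s rA by (auto simp: saturate_def)
    qed
  qed
  also have "saturate A Q' (L (Suc J)) \<subseteq> L (Suc J)"
    using PQ by (intro saturate_least saturated_weaken[OF Lsat]) auto
  finally have "L J \<subseteq> saturate A Q (lin_span A (P \<union> {q * g |q g. q \<in> Q \<and> g \<in> L J}))"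
    by (simp add: LSuc next_power_def)
  then have "L J \<subseteq> saturate A Q P" by (rule nakayama_saturate[OF Q Pi LA])
  also have "\<dots> \<subseteq> P" using PQ by (intro saturate_least saturated_prime[OF P]) auto
  finally have LP: "L J \<subseteq> P" .
  obtain q where q: "q \<in> Q" "q \<notin> P" using PQ by blast
  have qA: "q \<in> A" using q Qi by (auto dest: is_idealD)
  have "q ^ j \<in> L j" for j
  proof (induction j)
    case (Suc j)
    then have "q * q ^ j \<in> next_power (L j)"
      using q unfolding next_power_def by (intro lin_span_incl) auto
    then show ?case using saturate_incl[OF Q np[OF LA[of j]]] by (auto simp: LSuc)
  qed (simp add: L0)
  then have "q ^ J \<in> P" using LP by blast
  then have "q \<in> P" by (rule prime_in_power[OF P comm_subring_axioms qA])
  then show False using q by simp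
qed

end

section \<open>Regular systems of parameters\<close>

locale noetherian_local_subring = noetherian_subring +
  fixes m
  assumes prime_max: "prime_in A m"
    and unit_outside: "a \<in> A \<Longrightarrow> a \<notin> m \<Longrightarrow> \<exists>b\<in>A. a * b = 1"
begin

lemma prime_le_max: assumes "prime_in A P" shows "P \<subseteq> m"
proof
  fix p assume p: "p \<in> P"
  have Pi: "is_ideal A P" using assms by (rule prime_inD)
  show "p \<in> m"
  proof (rule ccontr)
    assume "p \<notin> m"
    then obtain b where "b \<in> A" "p * b = 1" using unit_outside is_idealD(1)[OF Pi p] by blast
    then have "1 \<in> P" using is_idealD(4)[OF Pi _ p, of b] by (simp add: mult.commute)
    then show False using prime_inD(2)[OF assms] by simp
  qed
qed

lemma max_closed: "a \<in> m \<Longrightarrow> a \<in> A"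
  using is_idealD(1)[OF prime_inD(1)[OF prime_max]] .

lemma nakayama_local:
  assumes N: "is_ideal A N" and M: "M \<subseteq> A"
    and sub: "M \<subseteq> lin_span A (N \<union> {q * g |q g. q \<in> m \<and> g \<in> M})"
  shows "M \<subseteq> N"
proof -
  have "is_ideal A (lin_span A (N \<union> {q * g |q g. q \<in> m \<and> g \<in> M}))"
    using N M max_closed by (intro is_ideal_lin_span) (auto intro: mult_closed dest: is_idealD)
  then have "M \<subseteq> saturate A m (lin_span A (N \<union> {q * g |q g. q \<in> m \<and> g \<in> M}))"
    using sub saturate_incl[OF prime_max] by blast
  then have "M \<subseteq> saturate A m N" by (rule nakayama_saturate[OF prime_max N M])
  also have "saturate A m N \<subseteq> N"
  proof
    fix r assume "r \<in> saturate A m N"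
    then obtain t where t: "t \<in> A - m" "t * r \<in> N" by (auto simp: saturate_def)
    obtain b where "b \<in> A" "t * b = 1" using unit_outside t by blast
    moreover from this have "b * (t * r) \<in> N" using is_idealD(4)[OF N] t by blast
    moreover have "b * (t * r) = (t * b) * r" by (simp add: algebra_simps)
    ultimately show "r \<in> N" by simp
  qed
  finally show ?thesis .
qed

end

primrec chain_above :: "'a::comm_ring_1 set \<Rightarrow> nat \<Rightarrow> 'a set \<Rightarrow> bool" where
  "chain_above A 0 P = prime_in A P"
| "chain_above A (Suc n) P = (prime_in A P \<and> (\<exists>P'. P \<subset> P' \<and> chain_above A n P'))"

lemma chain_above_prime: "chain_above A n P \<Longrightarrow> prime_in A P"
  by (cases n) auto

context noetherian_local_subring
begin

text \<open>
  A chain of primes can be rerouted, from its top downwards, such that its first step already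
  contains a given element of the maximal ideal.
\<close>
lemma chain_through:
  assumes "chain_above A (Suc n) P" "x \<in> m"
  shows "\<exists>P'. P \<subset> P' \<and> x \<in> P' \<and> chain_above A n P'"
  using assms(1)
proof (induction n arbitrary: P)
  case 0
  then obtain P' where "P \<subset> P'" "prime_in A P'" by auto
  then show ?case using prime_le_max[of P'] prime_max assms(2) by (intro exI[of _ m]) auto
next
  case (Suc n)
  then obtain P1 where P: "prime_in A P" and P1: "P \<subset> P1" "chain_above A (Suc n) P1"
    by (auto simp del: chain_above.simps(2) simp: chain_above.simps(2)[of A "Suc n"])
  obtain P2 where P2: "P1 \<subset> P2" "x \<in> P2" "chain_above A n P2" using Suc.IH[OF P1(2)] by blast
  obtain P' where "prime_in A P'" "P \<subset> P'" "P' \<subset> P2" "x \<in> P'"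
    using prime_exchange[OF P chain_above_prime[OF P1(2)] chain_above_prime[OF P2(3)] P1(1) P2(1,2)] by blast
  then show ?case using P2 by (intro exI[of _ P']) auto
qed

text \<open>
  Krull's height theorem above \<open>P\<close>: rerouting the chain through the generators one after the other uses up one step
  per generator.
\<close>
lemma height_bound:
  assumes "finite T" "w ` T \<subseteq> m" "m \<subseteq> lin_span A (P \<union> w ` T)"
  shows "\<not> chain_above A (Suc (card T)) P"
  using assms
proof (induction T arbitrary: P rule: finite_induct)
  case empty
  show ?case
  proof
    assume "chain_above A (Suc (card {})) P"
    then obtain P' where P: "prime_in A P" and P': "P \<subset> P'" "prime_in A P'" by auto
    then have "P' \<subseteq> P" using prime_le_max[of P'] empty lin_span_ideal[OF prime_inD(1)[OF P]] by auto
    then show False using P' by blast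
  qed
next
  case (insert i T)
  show ?case
  proof
    assume c: "chain_above A (Suc (card (insert i T))) P"
    obtain P' where P': "P \<subset> P'" "w i \<in> P'" "chain_above A (card (insert i T)) P'"
      using chain_through[OF c, of "w i"] insert.prems by auto
    have "m \<subseteq> lin_span A (P \<union> w ` insert i T)" using insert.prems by simp
    also have "\<dots> \<subseteq> lin_span A (P' \<union> w ` T)" using P' by (intro lin_span_mono) auto
    finally have "\<not> chain_above A (Suc (card T)) P'" using insert.IH insert.prems by auto
    then show False using P'(3) insert.hyps by (simp del: chain_above.simps)
  qed
qed

text \<open>
  A chain of the maximal possible length makes the generators behave like variables.  By induction on the number of
  generators, reroute the chain through one of them, \<open>w i\<close>, with first step \<open>P'\<close>; the claim for \<open>P'\<close> and the
  remaining generators is known.  It implies that \<open>P'\<close> meets \<open>P + (w i) + (w j : j \<in> U')\<close> only in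
  \<open>P + (w i) + \<mm> P'\<close>, so that \<open>P' = P + (w i)\<close> by Nakayama's lemma, and the claim for \<open>P\<close> follows.
\<close>
lemma regular_primes:
  assumes "finite T" "w ` T \<subseteq> m" "m \<subseteq> lin_span A (P \<union> w ` T)" "chain_above A (card T) P" "U \<subseteq> T"
  shows "prime_in A (lin_span A (P \<union> w ` U)) \<and> (\<forall>j\<in>T - U. w j \<notin> lin_span A (P \<union> w ` U))"
  using assms
proof (induction "card T" arbitrary: T P U rule: less_induct)
  case less
  note T = less.prems
  have P: "prime_in A P" using chain_above_prime T(4) .
  have Pi: "is_ideal A P" using P by (rule prime_inD)
  have PA: "P \<subseteq> A" using Pi by (auto dest: is_idealD)
  have wA: "w j \<in> A" if "j \<in> T" for j using T(2) that max_closed by blast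
  show ?case
  proof (cases "U = {}")
    case True
    have "w j \<notin> P" if j: "j \<in> T" for j
    proof
      assume "w j \<in> P"
      then have "P \<union> w ` T = P \<union> w ` (T - {j})" by auto
      then have "\<not> chain_above A (Suc (card (T - {j}))) P"
        using T by (intro height_bound) auto
      then show False using T(4) card_Suc_Diff1[OF T(1) j] by simp
    qed
    then show ?thesis using True P by (simp add: lin_span_ideal[OF Pi])
  next
    case False
    then obtain i where i: "i \<in> U" by blast
    have iT: "i \<in> T" using i T(5) by blast
    define n where "n = card (T - {i})"
    have card: "card T = Suc n" using card_Suc_Diff1[OF T(1) iT] by (simp add: n_def)
    obtain P' where P': "P \<subset> P'" "w i \<in> P'" "chain_above A n P'"
      using chain_through[of n P "w i"] T(2,4) iT card by auto
    have P'p: "prime_in A P'" using chain_above_prime P'(3) .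
    have P'i: "is_ideal A P'" using P'p by (rule prime_inD)
    have P'A: "P' \<subseteq> A" using P'i by (auto dest: is_idealD)
    have mP': "m \<subseteq> lin_span A (P' \<union> w ` (T - {i}))"
    proof -
      have "lin_span A (P \<union> w ` T) \<subseteq> lin_span A (P' \<union> w ` (T - {i}))"
        using P' by (intro lin_span_mono) auto
      then show ?thesis using T(3) by blast
    qed
    have IH: "prime_in A (lin_span A (P' \<union> w ` U')) \<and> (\<forall>j\<in>T - {i} - U'. w j \<notin> lin_span A (P' \<union> w ` U'))"
      if "U' \<subseteq> T - {i}" for U'
      using less.hyps[of "T - {i}" P' U'] that T mP' P'(3) card n_def by auto
    let ?N = "lin_span A (insert (w i) P)"
    have N: "is_ideal A ?N" using PA wA[OF iT] by (intro is_ideal_lin_span) auto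
    have NP': "?N \<subseteq> P'" using P' by (intro lin_span_subset_ideal[OF P'i]) auto
    let ?K = "lin_span A (?N \<union> {q * g |q g. q \<in> m \<and> g \<in> P'})"
    \<comment> \<open>The remaining generators are independent modulo \<open>P'\<close>, so relations among them have coefficients in \<open>P'\<close>.\<close>
    have step: "P' \<inter> lin_span A (?N \<union> w ` U') \<subseteq> ?K" if "finite U'" "U' \<subseteq> T - {i}" for U'
      using that
    proof (induction U' rule: finite_induct)
      case empty
      then show ?case using lin_span_mono[of A A ?N "?N \<union> {q * g |q g. q \<in> m \<and> g \<in> P'}"] by auto
    next
      case (insert j U')
      show ?case
      proof
        fix p assume p: "p \<in> P' \<inter> lin_span A (?N \<union> w ` insert j U')"
        then obtain c where c: "c \<in> A" "p - c * w j \<in> lin_span A (?N \<union> w ` U')"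
          using lin_span_insert[of p "w j" "?N \<union> w ` U'"] by auto
        let ?Q = "lin_span A (P' \<union> w ` U')"
        have jT: "j \<in> T" using insert.prems by auto
        have Q: "prime_in A ?Q" "w j \<notin> ?Q" using IH[of U'] insert by auto
        have "lin_span A (?N \<union> w ` U') \<subseteq> ?Q" using NP' by (intro lin_span_mono) auto
        then have "p - c * w j \<in> ?Q" using c(2) by blast
        then have "p - (p - c * w j) \<in> ?Q"
          by (rule lin_span_diff[OF lin_span_incl, rotated]) (use p in blast)
        then have "c \<in> ?Q" using prime_inD(3)[OF Q(1) c(1) wA[OF jT]] Q(2) by simp
        then obtain p' q where pq: "p' \<in> P'" "q \<in> lin_span A (w ` U')" "c = p' + q"
          using lin_span_Un[of c P' "w ` U'"] lin_span_ideal[OF P'i] by auto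
        have "w j * q \<in> lin_span A (w ` U')" by (rule lin_span_mult[OF pq(2) wA[OF jT]])
        then have "w j * q \<in> lin_span A (?N \<union> w ` U')" using lin_span_mono[of A A "w ` U'" "?N \<union> w ` U'"] by blast
        then have "(p - c * w j) + w j * q \<in> lin_span A (?N \<union> w ` U')" using c(2) by (rule lin_span_add[rotated])
        then have "p - w j * p' \<in> lin_span A (?N \<union> w ` U')" by (simp add: pq(3) algebra_simps)
        moreover have "p - w j * p' \<in> P'"
          using p pq(1) wA[OF jT] by (intro ideal_diff[OF P'i]) (auto intro: is_idealD(4)[OF P'i])
        ultimately have "p - w j * p' \<in> ?K" using insert by auto
        moreover have "w j * p' \<in> ?K"
          using T(2) jT pq(1) by (intro lin_span_incl) blast
        ultimately have "(p - w j * p') + w j * p' \<in> ?K" by (rule lin_span_add)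
        then show "p \<in> ?K" by simp
      qed
    qed
    have "P' \<subseteq> ?K"
    proof -
      have "P' \<subseteq> m" by (rule prime_le_max[OF P'p])
      also have "m \<subseteq> lin_span A (P \<union> w ` T)" by (rule T(3))
      also have "\<dots> \<subseteq> lin_span A (?N \<union> w ` (T - {i}))"
        using lin_span_incl by (intro lin_span_mono) auto
      finally show ?thesis using step[of "T - {i}"] T(1) by auto
    qed
    then have "P' \<subseteq> ?N" by (rule nakayama_local[OF N P'A])
    then have P'eq: "P' = ?N" using NP' by blast
    have "P \<union> w ` U = insert (w i) P \<union> w ` (U - {i})" using i by auto
    then have "lin_span A (P \<union> w ` U) = lin_span A (P' \<union> w ` (U - {i}))"
      by (simp add: P'eq lin_span_span_Un)
    then show ?thesis using IH[of "U - {i}"] T(5) i by auto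
  qed
qed

end

definition mon :: "'i set \<Rightarrow> ('i \<Rightarrow> 'a::comm_ring_1) \<Rightarrow> ('i \<Rightarrow> nat) \<Rightarrow> 'a" where
  "mon T w a = (\<Prod>i\<in>T. w i ^ a i)"

text \<open>
  What \<open>regular_primes\<close> says about a regular system of parameters; it makes the elements a regular
  sequence in any order.
\<close>
locale prime_sequence = comm_subring A for A :: "'a::comm_ring_1 set" +
  fixes T :: "'i set" and w :: "'i \<Rightarrow> 'a"
  assumes finT: "finite T" and wA: "i \<in> T \<Longrightarrow> w i \<in> A"
    and prime_span: "U \<subseteq> T \<Longrightarrow> prime_in A (lin_span A (w ` U))"
    and notin_span: "U \<subseteq> T \<Longrightarrow> j \<in> T \<Longrightarrow> j \<notin> U \<Longrightarrow> w j \<notin> lin_span A (w ` U)"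
begin

definition pow_ideal :: "('i \<Rightarrow> nat) \<Rightarrow> 'i set \<Rightarrow> 'a set" where
  "pow_ideal k U = lin_span A ((\<lambda>j. w j ^ k j) ` U)"

lemma pow_ideal_mult: "z \<in> pow_ideal k U \<Longrightarrow> a \<in> A \<Longrightarrow> a * z \<in> pow_ideal k U"
  unfolding pow_ideal_def by (rule lin_span_mult)

lemma pow_ideal_add: "z \<in> pow_ideal k U \<Longrightarrow> z' \<in> pow_ideal k U \<Longrightarrow> z + z' \<in> pow_ideal k U"
  unfolding pow_ideal_def by (rule lin_span_add)

lemma pow_ideal_diff: "z \<in> pow_ideal k U \<Longrightarrow> z' \<in> pow_ideal k U \<Longrightarrow> z - z' \<in> pow_ideal k U"
  unfolding pow_ideal_def by (rule lin_span_diff)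

lemma pow_ideal_remove:
  assumes "j \<in> U"
  shows "z \<in> pow_ideal k U \<longleftrightarrow> (\<exists>r\<in>A. z - r * w j ^ k j \<in> pow_ideal k (U - {j}))"
proof -
  have "(\<lambda>j. w j ^ k j) ` U = insert (w j ^ k j) ((\<lambda>j. w j ^ k j) ` (U - {j}))" using assms by auto
  then show ?thesis unfolding pow_ideal_def by (simp only: lin_span_insert)
qed

lemma pow_ideal_cong: "(\<And>j. j \<in> U \<Longrightarrow> k j = k' j) \<Longrightarrow> pow_ideal k U = pow_ideal k' U"
  unfolding pow_ideal_def by (intro arg_cong[of _ _ "lin_span A"] image_cong) auto

text \<open>
  Pure powers of the elements of a prime sequence again form a regular sequence.  By induction on the sum of the exponents: an
  exponent \<open>k j \<ge> 2\<close> is first lowered by one and then set to \<open>1\<close>, both of which make the sum smaller.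
\<close>
lemma pow_ideal_nonzerodivisor:
  assumes "U \<subseteq> T" "i \<in> T" "i \<notin> U" "\<forall>j\<in>U. k j \<ge> 1" "c \<in> A" "c * w i \<in> pow_ideal k U"
  shows "c \<in> pow_ideal k U"
  using assms
proof (induction "sum k U" arbitrary: U k i c rule: less_induct)
  case less
  note p = less.prems
  have finU: "finite U" using p(1) finT finite_subset by blast
  show ?case
  proof (cases "\<forall>j\<in>U. k j = 1")
    case True
    then have "pow_ideal k U = lin_span A (w ` U)"
      unfolding pow_ideal_def by (intro arg_cong[of _ _ "lin_span A"] image_cong) auto
    then show ?thesis
      using prime_inD(3)[OF prime_span[OF p(1)] p(5) wA[OF p(2)]] p(6) notin_span[OF p(1,2,3)] by auto
  next
    case False
    then obtain j where j: "j \<in> U" "k j \<ge> 2" using p(4) by force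
    let ?I = "pow_ideal k (U - {j})"
    let ?e = "k j - 1"
    have e: "k j = Suc ?e" "?e \<ge> 1" using j by auto
    have jT: "j \<in> T" using j p(1) by blast
    have sub: "pow_ideal (k(j := l)) (U - {j}) = ?I" for l by (rule pow_ideal_cong) auto
    have smaller: "sum (k(j := l)) U < sum k U" if "l < k j" for l
      using that j finU by (intro sum_strict_mono_ex1) auto
    obtain r where r: "r \<in> A" "c * w i - r * w j ^ k j \<in> ?I"
      using p(6) unfolding pow_ideal_remove[OF j(1)] by (rule bexE)
    have "c * w i \<in> pow_ideal (k(j := ?e)) U"
    proof -
      have "c * w i - (r * w j) * w j ^ ?e = c * w i - r * w j ^ k j"
        by (subst e(1)) (simp add: mult.assoc)
      then show ?thesis using r mult_closed[OF r(1) wA[OF jT]]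
        unfolding pow_ideal_remove[OF j(1), of "c * w i" "k(j := ?e)"] sub fun_upd_same
        by (intro bexI[of _ "r * w j"]) simp_all
    qed
    then have "c \<in> pow_ideal (k(j := ?e)) U"
      by (rule less.hyps[OF smaller p(1-3) _ p(5), rotated 2]) (use p(4) e in auto)
    then obtain s where s: "s \<in> A" "c - s * w j ^ ?e \<in> ?I"
      using pow_ideal_remove[OF j(1), of c "k(j := ?e)"] sub by auto
    have cancel: "b \<in> ?I" if "b \<in> A" "b * w j ^ l \<in> ?I" for b l
      using that
    proof (induction l)
      case (Suc l)
      have "sum k (U - {j}) < sum k U" using j finU by (simp add: sum.remove)
      moreover have "(b * w j ^ l) * w j \<in> ?I" using Suc.prems by (simp add: mult_ac)
      moreover have "b * w j ^ l \<in> A" using Suc.prems wA[OF jT] by (intro mult_closed power_closed)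
      ultimately have "b * w j ^ l \<in> ?I"
        using p jT by (intro less.hyps[of k "U - {j}" j "b * w j ^ l"]) auto
      then show ?case using Suc by blast
    qed simp
    have "(c * w i - r * w j ^ k j) - w i * (c - s * w j ^ ?e) \<in> ?I"
      by (rule pow_ideal_diff[OF r(2) pow_ideal_mult[OF s(2) wA[OF p(2)]]])
    moreover have "(c * w i - r * w j ^ k j) - w i * (c - s * w j ^ ?e) = (s * w i - r * w j) * w j ^ ?e"
      by (subst e(1)) (simp add: algebra_simps)
    ultimately have "s * w i - r * w j \<in> ?I"
      using cancel[of "s * w i - r * w j" ?e] r s wA[OF jT] wA[OF p(2)] by (auto intro: diff_closed mult_closed)
    then have "s * w i \<in> pow_ideal (k(j := 1)) U"
      using pow_ideal_remove[OF j(1), of "s * w i" "k(j := 1)"] sub r by auto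
    then have "s \<in> pow_ideal (k(j := 1)) U"
      by (rule less.hyps[OF smaller p(1-3) _ s(1), rotated 2]) (use p(4) j in auto)
    then obtain t where t: "t \<in> A" "s - t * w j \<in> ?I"
      using pow_ideal_remove[OF j(1), of s "k(j := 1)"] sub by auto
    have "(c - s * w j ^ ?e) + w j ^ ?e * (s - t * w j) \<in> ?I"
      by (rule pow_ideal_add[OF s(2) pow_ideal_mult[OF t(2) power_closed[OF wA[OF jT]]]])
    moreover have "(c - s * w j ^ ?e) + w j ^ ?e * (s - t * w j) = c - t * w j ^ k j"
      by (subst (3) e(1)) (simp add: algebra_simps)
    ultimately have "c - t * w j ^ k j \<in> ?I" by (simp only:)
    then show ?thesis using t(1) unfolding pow_ideal_remove[OF j(1)] by (rule rev_bexI[rotated])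
  qed
qed

lemma pow_ideal_cancel_power:
  assumes "U \<subseteq> T" "i \<in> T" "i \<notin> U" "\<forall>j\<in>U. k j \<ge> 1" "c \<in> A" "c * w i ^ l \<in> pow_ideal k U"
  shows "c \<in> pow_ideal k U"
  using assms(6)
proof (induction l)
  case (Suc l)
  have "(c * w i ^ l) * w i \<in> pow_ideal k U" using Suc.prems by (simp add: mult_ac)
  then have "c * w i ^ l \<in> pow_ideal k U"
    by (rule pow_ideal_nonzerodivisor[OF assms(1-4), rotated])
      (use assms in \<open>auto intro: mult_closed power_closed wA\<close>)
  then show ?case by (rule Suc.IH)
qed simp

text \<open>
  The ideal quotient of \<open>(w i ^ (a i + 1) : i \<in> T)\<close> by the monomial with exponents \<open>a\<close> is \<open>(w i : i \<in> T)\<close>, by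
  cancelling the powers of one variable after the other.
\<close>
lemma colon_pow_ideal:
  assumes "U \<subseteq> T" "c \<in> A" "c * mon U w a \<in> pow_ideal (\<lambda>j. if j \<in> U then Suc (a j) else 1) T"
  shows "c \<in> lin_span A (w ` T)"
proof -
  have "finite U" using assms(1) finT finite_subset by blast
  then show ?thesis using assms
  proof (induction U rule: finite_induct)
    case empty
    then show ?case by (simp add: mon_def pow_ideal_def)
  next
    case (insert i U)
    let ?e = "\<lambda>j. if j \<in> insert i U then Suc (a j) else 1"
    let ?e' = "\<lambda>j. if j \<in> U then Suc (a j) else 1"
    have iT: "i \<in> T" and UT: "U \<subseteq> T" using insert.prems by auto
    define c' where "c' = c * mon U w a"
    have c'A: "c' \<in> A" unfolding c'_def mon_def using insert.prems UT wA
      by (intro mult_closed prod_closed power_closed) auto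
    have same: "pow_ideal ?e (T - {i}) = pow_ideal ?e' (T - {i})" by (rule pow_ideal_cong) auto
    have "c' * w i ^ a i \<in> pow_ideal ?e T"
      using insert by (simp add: c'_def mon_def mult_ac)
    then obtain r where r: "r \<in> A" "c' * w i ^ a i - r * w i ^ Suc (a i) \<in> pow_ideal ?e (T - {i})"
      using pow_ideal_remove[OF iT, of "c' * w i ^ a i" ?e] by auto
    have "(c' - r * w i) * w i ^ a i \<in> pow_ideal ?e (T - {i})"
      using r by (simp add: algebra_simps)
    then have "c' - r * w i \<in> pow_ideal ?e (T - {i})"
      using r c'A wA[OF iT] iT
      by (rule_tac pow_ideal_cancel_power[of "T - {i}" i ?e _ "a i"]) (auto intro: diff_closed mult_closed)
    then have "c' \<in> pow_ideal ?e' T"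
      using pow_ideal_remove[OF iT, of c' ?e'] r same insert.hyps by auto
    then show ?case using insert.IH UT insert.prems by (simp add: c'_def)
  qed
qed

text \<open>
  A monomial whose exponents are not bounded by those of \<open>a\<close> lies in \<open>(w i ^ (a i + 1) : i \<in> T)\<close>, and this ideal does not contain the
  monomial with exponents \<open>a\<close> by \<open>colon_pow_ideal\<close>.
\<close>
lemma mon_in_span:
  assumes "mon T w a \<in> lin_span A (mon T w ` S)"
  shows "\<exists>b\<in>S. \<forall>i\<in>T. b i \<le> a i"
proof (rule ccontr)
  assume no: "\<not> ?thesis"
  let ?I = "pow_ideal (\<lambda>j. if j \<in> T then Suc (a j) else 1) T"
  have "mon T w b \<in> ?I" if b: "b \<in> S" for b
  proof -
    obtain i where i: "i \<in> T" "a i < b i" using no b by force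
    have "mon T w b = w i ^ b i * (\<Prod>j\<in>T - {i}. w j ^ b j)"
      using finT i by (simp add: mon_def prod.remove)
    also have "w i ^ b i = w i ^ (b i - Suc (a i)) * w i ^ Suc (a i)"
      using i by (simp only: power_add[symmetric]) simp
    finally have "mon T w b = (w i ^ (b i - Suc (a i)) * (\<Prod>j\<in>T - {i}. w j ^ b j)) * w i ^ Suc (a i)"
      by (simp only: mult_ac)
    moreover have "w i ^ (b i - Suc (a i)) * (\<Prod>j\<in>T - {i}. w j ^ b j) \<in> A"
      using wA i by (intro mult_closed prod_closed power_closed) auto
    moreover have "w i ^ Suc (a i) \<in> (\<lambda>j. w j ^ (if j \<in> T then Suc (a j) else 1)) ` T"
      using i by (intro image_eqI[of _ _ i]) auto
    ultimately show ?thesis unfolding pow_ideal_def by (metis lin_span_scale)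
  qed
  then have "lin_span A (mon T w ` S) \<subseteq> ?I"
    unfolding pow_ideal_def by (intro lin_span_subset_span) auto
  then have "1 * mon T w a \<in> ?I" using assms by auto
  then have "1 \<in> lin_span A (w ` T)" by (intro colon_pow_ideal[of T 1 a]) auto
  then show False using prime_inD(2)[OF prime_span[of T]] by simp
qed

end

context noetherian_local_subring
begin

text \<open>
  The chain must start at \<open>0\<close>, because otherwise \<open>0\<close> could be put in front of it, against \<open>height_bound\<close>; so
  \<open>regular_primes\<close> applies with \<open>P = {0}\<close>.
\<close>
lemma regular_parameters:
  assumes "finite T" "w ` T \<subseteq> m" "m \<subseteq> lin_span A (w ` T)" and zero: "prime_in A {0}"
    and chain: "chain_above A (card T) P"
  shows "prime_sequence A T w"
proof -
  have P: "prime_in A P" using chain_above_prime chain .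
  have mspan: "m \<subseteq> lin_span A ({0} \<union> w ` T)"
    using assms(3) lin_span_mono[of A A "w ` T" "{0} \<union> w ` T"] by blast
  have "P = {0}"
  proof (rule ccontr)
    assume "P \<noteq> {0}"
    then have "{0} \<subset> P" using is_idealD(2)[OF prime_inD(1)[OF P]] by auto
    then have "chain_above A (Suc (card T)) {0}" using zero chain by auto
    then show False using height_bound[OF assms(1,2) mspan] by simp
  qed
  then have reg: "prime_in A (lin_span A ({0} \<union> w ` U)) \<and> (\<forall>j\<in>T - U. w j \<notin> lin_span A ({0} \<union> w ` U))"
    if "U \<subseteq> T" for U
    using regular_primes[OF assms(1,2) mspan _ that] chain by simp
  have span0: "lin_span A ({0} \<union> S) = lin_span A S" for S
    using lin_span_subset_span[of "{0} \<union> S" S] lin_span_mono[of A A S "{0} \<union> S"]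
      lin_span_incl[of _ S] lin_span.zero[of A S] by blast
  show ?thesis
    using reg[unfolded span0] assms(1,2) max_closed by unfold_locales auto
qed

end

section \<open>Valuation rings and integral closure\<close>

locale valuation_ring = comm_subring V for V :: "'k::field set" +
  assumes total: "z \<in> V \<or> inverse z \<in> V"

text \<open>
  Divisibility in \<open>V\<close>, extended to the whole field.  For a valuation \<open>v\<close> with ring \<open>V\<close>, \<open>vdvd V s z\<close> means
  \<open>v s \<le> v z\<close>, and \<open>vcov V S z\<close> means that \<open>z\<close> lies in the \<open>V\<close>-module generated by \<open>S\<close>.
\<close>
definition vdvd :: "'k::field set \<Rightarrow> 'k \<Rightarrow> 'k \<Rightarrow> bool" where
  "vdvd V s z \<longleftrightarrow> (\<exists>v\<in>V. z = s * v)"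

definition vcov :: "'k::field set \<Rightarrow> 'k set \<Rightarrow> 'k \<Rightarrow> bool" where
  "vcov V S z \<longleftrightarrow> (\<exists>s\<in>S. vdvd V s z)"

context valuation_ring
begin

lemma vdvd_refl [simp]: "vdvd V z z"
  unfolding vdvd_def by (rule bexI[of _ 1]) auto

lemma vdvd_zero [simp]: "vdvd V z 0"
  unfolding vdvd_def by (rule bexI[of _ 0]) auto

lemma vdvd_trans: "vdvd V a b \<Longrightarrow> vdvd V b c \<Longrightarrow> vdvd V a c"
  unfolding vdvd_def by (metis mult.assoc mult_closed)

lemma vdvd_mult: "vdvd V a b \<Longrightarrow> vdvd V c d \<Longrightarrow> vdvd V (a * c) (b * d)"
proof -
  assume "vdvd V a b" "vdvd V c d"
  then obtain v w where "v \<in> V" "w \<in> V" "b = a * v" "d = c * w" by (auto simp: vdvd_def)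
  then show ?thesis unfolding vdvd_def by (intro bexI[of _ "v * w"] mult_closed) auto
qed

lemma vdvd_add: "vdvd V a b \<Longrightarrow> vdvd V a c \<Longrightarrow> vdvd V a (b + c)"
  unfolding vdvd_def by (metis add_closed distrib_left)

lemma vdvd_scale: "vdvd V a b \<Longrightarrow> v \<in> V \<Longrightarrow> vdvd V a (v * b)"
  unfolding vdvd_def by (metis mult.left_commute mult_closed)

lemma vdvd_power: "vdvd V a b \<Longrightarrow> vdvd V (a ^ n) (b ^ n)"
  by (induction n) (auto intro: vdvd_mult)

lemma vdvd_total: "vdvd V a b \<or> vdvd V b a"
proof (cases "a = 0 \<or> b = 0")
  case False
  then have "b = a * (b / a)" "a = b * inverse (b / a)" by auto
  then show ?thesis using total[of "b / a"] unfolding vdvd_def by metis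
qed auto

lemma vdvd_cancel: "c \<noteq> 0 \<Longrightarrow> vdvd V (c * a) (c * b) \<longleftrightarrow> vdvd V a b"
  by (auto simp: vdvd_def mult.assoc)

lemma not_vdvd_imp_vdvd: "\<not> vdvd V b a \<Longrightarrow> vdvd V a b"
  using vdvd_total by blast

lemma not_vdvd_mult:
  assumes "\<not> vdvd V b a" "vdvd V c d" "c \<noteq> 0"
  shows "\<not> vdvd V (b * d) (a * c)"
proof
  assume "vdvd V (b * d) (a * c)"
  moreover have "vdvd V (b * c) (b * d)" using vdvd_mult[OF vdvd_refl assms(2)] .
  ultimately have "vdvd V (c * b) (c * a)" by (metis vdvd_trans mult.commute)
  then show False using assms vdvd_cancel by blast
qed

lemma not_vdvd_add:
  assumes "\<not> vdvd V b a" "\<not> vdvd V c a" shows "\<not> vdvd V (b + c) a"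
proof
  assume a: "vdvd V (b + c) a"
  have "vdvd V b (b + c) \<or> vdvd V c (b + c)"
    using vdvd_total[of b c] vdvd_add vdvd_refl by blast
  then show False using a assms vdvd_trans by blast
qed

lemma not_vdvd_sum:
  assumes "a \<noteq> 0" "\<And>i. i \<in> F \<Longrightarrow> \<not> vdvd V (f i) a" shows "\<not> vdvd V (sum f F) a"
  using assms
proof (induction F rule: infinite_finite_induct)
  case (insert x F)
  then show ?case by (simp add: not_vdvd_add)
qed (auto simp: vdvd_def)

lemma not_vdvd_scale:
  assumes "\<not> vdvd V b a" "v \<in> V" shows "\<not> vdvd V (v * b) a"
  using vdvd_scale[OF vdvd_refl assms(2), of b] assms(1) vdvd_trans by blast

lemma vcov_incl: "z \<in> S \<Longrightarrow> vcov V S z"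
  unfolding vcov_def by (rule bexI[of _ z]) auto

lemma vcov_vdvd: "vcov V S a \<Longrightarrow> vdvd V a z \<Longrightarrow> vcov V S z"
  unfolding vcov_def using vdvd_trans by blast

lemma vcov_trans: "vcov V T z \<Longrightarrow> (\<And>t. t \<in> T \<Longrightarrow> vcov V S t) \<Longrightarrow> vcov V S z"
  unfolding vcov_def using vdvd_trans by blast

lemma vcov_add: "vcov V S a \<Longrightarrow> vcov V S b \<Longrightarrow> vcov V S (a + b)"
  unfolding vcov_def using vdvd_total by (metis vdvd_add vdvd_trans)

lemma vcov_mult: "vcov V S a \<Longrightarrow> vcov V T b \<Longrightarrow> vcov V {s * t |s t. s \<in> S \<and> t \<in> T} (a * b)"
  unfolding vcov_def using vdvd_mult by blast

lemma vcov_span: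
  assumes "A \<subseteq> V" "S \<noteq> {}" "a \<in> lin_span A S" shows "vcov V S a"
  using assms(3)
proof induction
  case zero
  then show ?case using assms(2) by (auto simp: vcov_def)
next
  case (step z a s)
  then show ?case using assms(1) vdvd_scale[OF vdvd_refl, of a s]
    by (intro vcov_add) (auto simp: vcov_def)
qed

end

text \<open>
  Existence of a valuation ring whose maximal ideal contains \<open>J\<close>.  By Zorn's lemma there is a maximal ring \<open>V\<close>
  above \<open>B\<close> in which \<open>J\<close> generates a proper ideal \<open>N\<close>.  Maximality makes the elements \<open>1 - j\<close> with \<open>j \<in> N\<close>
  invertible, and it produces, for \<open>t \<notin> V\<close>, a relation that expresses \<open>1\<close> as a polynomial in \<open>t\<close> with coefficients in
  \<open>N\<close>.  If neither \<open>t\<close> nor its inverse were in \<open>V\<close>, the two relations of least degree would reduce each other.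
\<close>
lemma exists_valuation_ring:
  fixes B :: "'k::field set"
  assumes B: "comm_subring B" and J: "J \<subseteq> B" and 1: "1 \<notin> lin_span B J"
  shows "\<exists>V. valuation_ring V \<and> B \<subseteq> V \<and> 1 \<notin> lin_span V J"
proof -
  define F where "F = {V. comm_subring V \<and> B \<subseteq> V \<and> 1 \<notin> lin_span V J}"
  have "F \<noteq> {}" using B 1 by (auto simp: F_def)
  moreover have "\<Union>C \<in> F" if C: "C \<noteq> {}" "subset.chain F C" for C
  proof -
    have CF: "V \<in> C \<Longrightarrow> V \<in> F" for V using C by (auto simp: subset.chain_def)
    have lin: "V \<subseteq> W \<or> W \<subseteq> V" if "V \<in> C" "W \<in> C" for V W
      using C that by (auto simp: subset.chain_def)
    have two: "\<exists>W\<in>C. a \<in> W \<and> b \<in> W" if "a \<in> \<Union>C" "b \<in> \<Union>C" for a b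
      using that lin by blast
    have sub: "comm_subring V" if "V \<in> C" for V using CF[OF that] by (simp add: F_def)
    have "comm_subring (\<Union>C)"
    proof
      show "1 \<in> \<Union>C" using C(1) sub comm_subring.one_closed by blast
      show "a + b \<in> \<Union>C" "a * b \<in> \<Union>C" if "a \<in> \<Union>C" "b \<in> \<Union>C" for a b
        using two[OF that] sub comm_subring.add_closed comm_subring.mult_closed by blast+
      show "- a \<in> \<Union>C" if "a \<in> \<Union>C" for a
        using that sub comm_subring.neg_closed by blast
    qed
    moreover have "B \<subseteq> \<Union>C" using C(1) CF by (auto simp: F_def)
    moreover have "\<exists>V\<in>C. z \<in> lin_span V J" if "z \<in> lin_span (\<Union>C) J" for z
      using that
    proof induction
      case zero
      then show ?case using C(1) by (auto intro: lin_span.zero)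
    next
      case (step z a s)
      then obtain V W where VW: "V \<in> C" "W \<in> C" "z \<in> lin_span V J" "a \<in> W" by blast
      then obtain X' where X': "X' \<in> C" "V \<subseteq> X'" "W \<subseteq> X'" using lin by blast
      then have "z \<in> lin_span X' J" using VW lin_span_mono[of V X' J J] by blast
      then show ?case using X' VW step by (intro bexI[of _ X'] lin_span.step) auto
    qed
    ultimately show ?thesis using CF by (auto simp: F_def)
  qed
  ultimately obtain V where VF: "V \<in> F" and max: "\<And>W. W \<in> F \<Longrightarrow> V \<subseteq> W \<Longrightarrow> W = V"
    using subset_Zorn_nonempty[of F] by blast
  interpret V: comm_subring V using VF by (simp add: F_def)
  have BV: "B \<subseteq> V" and V1: "1 \<notin> lin_span V J" using VF by (auto simp: F_def)
  define N where "N = lin_span V J"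
  have N: "is_ideal V N" unfolding N_def using J BV by (intro V.is_ideal_lin_span) auto
  have N1: "1 \<notin> N" using V1 by (simp add: N_def)
  have NV: "a \<in> N \<Longrightarrow> a \<in> V" for a using is_idealD(1)[OF N] .
  have unit: "inverse (1 - j) \<in> V" if j: "j \<in> N" for j
  proof -
    have j0: "1 - j \<noteq> 0" using N1 j by auto
    have jV: "1 - j \<in> V" using NV[OF j] by (intro V.diff_closed) auto
    define W where "W = {b / (1 - j) ^ k |b k. b \<in> V}"
    have "comm_subring W"
    proof
      show "1 \<in> W" unfolding W_def by (intro CollectI exI[of _ 1] exI[of _ 0]) auto
      show "- a \<in> W" if "a \<in> W" for a
      proof -
        obtain b k where "a = b / (1 - j) ^ k" "b \<in> V" using \<open>a \<in> W\<close> by (auto simp: W_def)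
        then show ?thesis unfolding W_def
          by (intro CollectI exI[of _ "- b"] exI[of _ k]) (auto intro: V.neg_closed)
      qed
      fix a b assume "a \<in> W" "b \<in> W"
      then obtain a' b' k l where ab: "a = a' / (1 - j) ^ k" "b = b' / (1 - j) ^ l" "a' \<in> V" "b' \<in> V"
        by (auto simp: W_def)
      have "a + b = (a' * (1 - j) ^ l + b' * (1 - j) ^ k) / (1 - j) ^ (k + l)"
        using j0 by (simp add: ab field_simps power_add)
      moreover have "a' * (1 - j) ^ l + b' * (1 - j) ^ k \<in> V"
        using ab jV by (intro V.add_closed V.mult_closed V.power_closed) auto
      ultimately show "a + b \<in> W" unfolding W_def by blast
      have "a * b = (a' * b') / (1 - j) ^ (k + l)"
        by (simp add: ab power_add)
      moreover have "a' * b' \<in> V" using ab by (intro V.mult_closed)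
      ultimately show "a * b \<in> W" unfolding W_def by blast
    qed
    moreover have VW: "V \<subseteq> W"
    proof
      fix b assume "b \<in> V"
      then show "b \<in> W" unfolding W_def by (intro CollectI exI[of _ b] exI[of _ 0]) auto
    qed
    moreover have "1 \<notin> lin_span W J"
    proof
      have "lin_span W J \<subseteq> {b / (1 - j) ^ k |b k. b \<in> N}"
      proof (rule lin_span_least)
        show "0 \<in> {b / (1 - j) ^ k |b k. b \<in> N}"
          using is_idealD(2)[OF N] by (intro CollectI exI[of _ 0] exI[of _ 0]) auto
        fix a b
        assume "a \<in> {b / (1 - j) ^ k |b k. b \<in> N}" "b \<in> {b / (1 - j) ^ k |b k. b \<in> N}"
        then obtain a' b' k l where ab: "a = a' / (1 - j) ^ k" "b = b' / (1 - j) ^ l" "a' \<in> N" "b' \<in> N"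
          by auto
        have "a + b = ((1 - j) ^ l * a' + (1 - j) ^ k * b') / (1 - j) ^ (k + l)"
          using j0 by (simp add: ab field_simps power_add)
        moreover have "(1 - j) ^ l * a' + (1 - j) ^ k * b' \<in> N"
          using ab V.power_closed[OF jV] by (intro is_idealD(3)[OF N] is_idealD(4)[OF N]) auto
        ultimately show "a + b \<in> {b / (1 - j) ^ k |b k. b \<in> N}" by blast
      next
        fix a s assume "a \<in> W" "s \<in> J"
        then obtain b k where "a = b / (1 - j) ^ k" "b \<in> V" by (auto simp: W_def)
        moreover from this have "b * s \<in> N" unfolding N_def using \<open>s \<in> J\<close> by (intro lin_span_scale)
        ultimately show "a * s \<in> {b / (1 - j) ^ k |b k. b \<in> N}"
          by (intro CollectI exI[of _ "b * s"] exI[of _ k]) auto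
      qed
      moreover assume "1 \<in> lin_span W J"
      ultimately obtain b k where b: "1 = b / (1 - j) ^ k" "b \<in> N" by blast
      then have bk: "(1 - j) ^ k \<in> N" using j0 by (simp add: field_simps)
      have "1 - (1 - j) ^ k \<in> N"
      proof (induction k)
        case (Suc k)
        have "1 - (1 - j) ^ Suc k = (1 - (1 - j) ^ k) + (1 - j) ^ k * j" by (simp add: algebra_simps)
        then show ?case
          using is_idealD(3)[OF N Suc is_idealD(4)[OF N V.power_closed[OF jV] j]] by (simp only:)
      qed (use is_idealD(2)[OF N] in simp)
      then have "(1 - (1 - j) ^ k) + (1 - j) ^ k \<in> N" using bk by (rule is_idealD(3)[OF N])
      then show False using N1 by simp
    qed
    ultimately have "W = V" using max BV by (auto simp: F_def)
    moreover have "inverse (1 - j) \<in> W" unfolding W_def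
      by (intro CollectI exI[of _ 1] exI[of _ 1]) (auto simp: field_simps)
    ultimately show ?thesis by simp
  qed
  define rel where "rel = (\<lambda>t n. \<exists>p. (\<forall>i. Polynomial.coeff p i \<in> N) \<and> poly p t = 1 \<and> Polynomial.degree p = n)"
  have ex_rel: "\<exists>n. rel t n" if t: "t \<notin> V" for t
  proof -
    define W where "W = {poly p t |p. \<forall>i. Polynomial.coeff p i \<in> V}"
    have "comm_subring W"
    proof
      show "1 \<in> W" unfolding W_def by (intro CollectI exI[of _ 1]) (auto simp: coeff_1)
      fix a b assume "a \<in> W" "b \<in> W"
      then obtain p q where pq: "a = poly p t" "b = poly q t"
        "\<forall>i. Polynomial.coeff p i \<in> V" "\<forall>i. Polynomial.coeff q i \<in> V" by (auto simp: W_def)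
      show "a + b \<in> W" unfolding W_def using pq
        by (intro CollectI exI[of _ "p + q"]) (auto intro: V.add_closed)
      show "a * b \<in> W" unfolding W_def using pq
        by (intro CollectI exI[of _ "p * q"]) (auto simp: coeff_mult intro: V.sum_closed V.mult_closed)
      show "- a \<in> W" unfolding W_def using pq
        by (intro CollectI exI[of _ "- p"]) (auto intro: V.neg_closed)
    qed
    moreover have VW: "V \<subseteq> W"
    proof
      fix b assume "b \<in> V"
      then show "b \<in> W" unfolding W_def
        by (intro CollectI exI[of _ "[:b:]"]) (auto simp: coeff_pCons split: nat.split)
    qed
    moreover have "t \<in> W" unfolding W_def
      by (intro CollectI exI[of _ "[:0, 1:]"]) (auto simp: coeff_pCons split: nat.split)
    ultimately have "1 \<in> lin_span W J" using max[of W] t BV by (auto simp: F_def)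
    moreover have "lin_span W J \<subseteq> {poly p t |p. \<forall>i. Polynomial.coeff p i \<in> N}"
    proof (rule lin_span_least)
      show "0 \<in> {poly p t |p. \<forall>i. Polynomial.coeff p i \<in> N}"
        using is_idealD(2)[OF N] by (intro CollectI exI[of _ 0]) auto
      fix a b assume "a \<in> {poly p t |p. \<forall>i. Polynomial.coeff p i \<in> N}" "b \<in> {poly p t |p. \<forall>i. Polynomial.coeff p i \<in> N}"
      then obtain p q where pq: "a = poly p t" "b = poly q t"
        "\<forall>i. Polynomial.coeff p i \<in> N" "\<forall>i. Polynomial.coeff q i \<in> N" by auto
      then show "a + b \<in> {poly p t |p. \<forall>i. Polynomial.coeff p i \<in> N}"
        by (intro CollectI exI[of _ "p + q"]) (auto intro: is_idealD(3)[OF N])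
    next
      fix a s assume "a \<in> W" "s \<in> J"
      then obtain p where p: "a = poly p t" "\<forall>i. Polynomial.coeff p i \<in> V" by (auto simp: W_def)
      then show "a * s \<in> {poly p t |p. \<forall>i. Polynomial.coeff p i \<in> N}"
        using \<open>s \<in> J\<close>
        by (intro CollectI exI[of _ "smult s p"])
          (auto simp: N_def mult.commute[of s] intro: lin_span_scale)
    qed
    ultimately obtain p where "1 = poly p t" "\<forall>i. Polynomial.coeff p i \<in> N" by blast
    then show ?thesis unfolding rel_def by metis
  qed
  \<comment> \<open>Solving the second relation for \<open>t ^ n\<close> removes the top coefficient of the first one.\<close>
  have reduce: "\<exists>n'<n. rel t n'" if rel: "rel t n" "rel (inverse t) m" "m \<le> n" and t: "t \<noteq> 0" for t n m
  proof -
    obtain p q where p: "\<And>i. Polynomial.coeff p i \<in> N" "poly p t = 1" "Polynomial.degree p = n"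
      and q: "\<And>i. Polynomial.coeff q i \<in> N" "poly q (inverse t) = 1" "Polynomial.degree q = m"
      using rel unfolding rel_def by blast
    have n: "n \<noteq> 0"
    proof
      assume "n = 0"
      then obtain c where "p = [:c:]" using p(3) by (auto elim: degree_eq_zeroE)
      then have "Polynomial.coeff p 0 = 1" using p(2) by simp
      then show False using p(1)[of 0] N1 by simp
    qed
    define b where "b = Polynomial.coeff q"
    define a where "a = Polynomial.coeff p n"
    define r where "r = (\<Sum>i\<in>{1..m}. Polynomial.monom (b i) (n - i))"
    define u where "u = inverse (1 - b 0)"
    have b0: "1 - b 0 \<noteq> 0" using N1 q(1)[of 0] by (auto simp: b_def)
    have uV: "u \<in> V" unfolding u_def b_def using unit q(1) by blast
    have "1 = (\<Sum>i\<le>m. b i * inverse t ^ i)" using q(2,3) by (simp add: poly_altdef b_def)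
    also have "\<dots> = b 0 + (\<Sum>i\<in>{1..m}. b i * inverse t ^ i)"
      by (simp add: sum.atMost_shift sum.atLeast1_atMost_eq)
    finally have "1 - b 0 = (\<Sum>i\<in>{1..m}. b i * inverse t ^ i)" by (simp add: algebra_simps)
    then have "t ^ n * (1 - b 0) = (\<Sum>i\<in>{1..m}. t ^ n * (b i * inverse t ^ i))"
      by (simp add: sum_distrib_left)
    also have "\<dots> = (\<Sum>i\<in>{1..m}. b i * t ^ (n - i))"
    proof (rule sum.cong)
      fix i assume "i \<in> {1..m}"
      then have "t ^ n = t ^ (n - i) * t ^ i" using rel(3) by (simp flip: power_add)
      then show "t ^ n * (b i * inverse t ^ i) = b i * t ^ (n - i)"
        using t by (simp add: field_simps)
    qed simp
    also have "\<dots> = poly r t" by (simp add: r_def poly_sum poly_monom)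
    finally have r: "t ^ n = u * poly r t" using b0 by (simp add: u_def field_simps)
    define p' where "p' = p - Polynomial.monom a n + smult (a * u) r"
    have "poly p' t = 1" by (simp add: p'_def poly_monom r p(2) mult.assoc)
    moreover have coeffr: "Polynomial.coeff r i \<in> N" for i
    proof -
      have "Polynomial.coeff r i = (\<Sum>j\<in>{1..m}. if n - j = i then b j else 0)"
        by (simp add: r_def Polynomial.coeff_sum)
      also have "\<dots> \<in> N"
      proof -
        have "sum f K \<in> N" if "\<And>j. j \<in> K \<Longrightarrow> f j \<in> N" for f and K :: "nat set"
          using that by (induction K rule: infinite_finite_induct) (auto intro: is_idealD(2,3)[OF N])
        then show ?thesis using q(1) is_idealD(2)[OF N] by (auto simp: b_def)
      qed
      finally show ?thesis .
    qed
    moreover have "Polynomial.coeff p' i \<in> N" for i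
    proof -
      have "p' = p + (smult (a * u) r + Polynomial.monom (- a) n)"
        by (simp add: p'_def minus_monom)
      then have "Polynomial.coeff p' i = Polynomial.coeff p i + (a * u * Polynomial.coeff r i + (if n = i then - a else 0))"
        by simp
      moreover have "(if n = i then - a else 0) \<in> N"
        using p(1) is_idealD(2)[OF N] V.ideal_neg[OF N] by (auto simp: a_def)
      moreover have "a * u * Polynomial.coeff r i \<in> N"
        using coeffr p(1) NV uV by (intro is_idealD(4)[OF N]) (auto simp: a_def intro: V.mult_closed)
      ultimately show ?thesis using p(1) by (simp only: is_idealD(3)[OF N])
    qed
    moreover have "Polynomial.degree p' < n"
    proof -
      have "Polynomial.coeff p' i = 0" if i: "i \<ge> n" for i
      proof -
        have "Polynomial.coeff r i = (\<Sum>j\<in>{1..m}. if n - j = i then b j else 0)"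
          by (simp add: r_def Polynomial.coeff_sum)
        also have "\<dots> = 0"
          using n i by (intro sum.neutral) auto
        finally show ?thesis using i p(3) coeff_eq_0[of p i]
          by (cases "i = n") (auto simp: p'_def a_def)
      qed
      then have "Polynomial.degree p' \<le> n - 1" by (intro degree_le) auto
      then show ?thesis using n by simp
    qed
    ultimately show ?thesis unfolding rel_def by blast
  qed
  have "valuation_ring V"
  proof
    fix t show "t \<in> V \<or> inverse t \<in> V"
    proof (rule ccontr)
      assume t: "\<not> (t \<in> V \<or> inverse t \<in> V)"
      then have t0: "t \<noteq> 0" by auto
      define n where "n = (LEAST n. rel t n)"
      define m where "m = (LEAST m. rel (inverse t) m)"
      have n: "rel t n" "\<And>n'. n' < n \<Longrightarrow> \<not> rel t n'"
        using ex_rel[of t] t not_less_Least unfolding n_def by (auto intro: LeastI_ex)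
      have m: "rel (inverse t) m" "\<And>n'. n' < m \<Longrightarrow> \<not> rel (inverse t) n'"
        using ex_rel[of "inverse t"] t not_less_Least unfolding m_def by (auto intro: LeastI_ex)
      show False
      proof (cases "m \<le> n")
        case True
        then show False using reduce[OF n(1) m(1)] n(2) t0 by blast
      next
        case False
        then show False using reduce[of "inverse t" m n] m n(1) t0 by auto
      qed
    qed
  qed
  then show ?thesis using BV V1 by blast
qed

primrec ipow :: "'a::comm_ring_1 set \<Rightarrow> 'a set \<Rightarrow> nat \<Rightarrow> 'a set" where
  "ipow A I 0 = A"
| "ipow A I (Suc n) = lin_span A {a * b |a b. a \<in> ipow A I n \<and> b \<in> I}"

definition int_closure :: "'a::comm_ring_1 set \<Rightarrow> 'a set \<Rightarrow> 'a set" where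
  "int_closure A I = {z \<in> A. \<exists>n\<ge>1. \<exists>a. (\<forall>i\<in>{1..n}. a i \<in> ipow A I i) \<and>
     z ^ n + (\<Sum>i\<in>{1..n}. a i * z ^ (n - i)) = 0}"

context comm_subring
begin

lemma is_ideal_ipow: "I \<subseteq> A \<Longrightarrow> is_ideal A (ipow A I n)"
proof (induction n)
  case 0
  then show ?case by (auto simp: is_ideal_def intro: add_closed mult_closed)
next
  case (Suc n)
  then show ?case by (auto intro!: is_ideal_lin_span mult_closed dest: is_idealD)
qed

lemma ipow_mult:
  assumes "I \<subseteq> A" "a \<in> ipow A I i" "b \<in> ipow A I j" shows "a * b \<in> ipow A I (i + j)"
  using assms(3)
proof (induction j arbitrary: b)
  case 0
  then show ?case using is_idealD(4)[OF is_ideal_ipow[OF assms(1)], of b a i] assms(2) by (simp add: mult.commute)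
next
  case (Suc j)
  have "lin_span A {c * d |c d. c \<in> ipow A I j \<and> d \<in> I} \<subseteq> {b. a * b \<in> ipow A I (i + Suc j)}"
  proof (rule lin_span_least)
    show "0 \<in> {b. a * b \<in> ipow A I (i + Suc j)}" by (auto intro: lin_span.zero)
    show "x + y \<in> {b. a * b \<in> ipow A I (i + Suc j)}"
      if "x \<in> {b. a * b \<in> ipow A I (i + Suc j)}" "y \<in> {b. a * b \<in> ipow A I (i + Suc j)}" for x y
      using that by (auto simp: distrib_left intro: lin_span_add)
    show "r * s \<in> {b. a * b \<in> ipow A I (i + Suc j)}"
      if r: "r \<in> A" and s: "s \<in> {c * d |c d. c \<in> ipow A I j \<and> d \<in> I}" for r s
    proof -
      obtain c d where cd: "s = c * d" "c \<in> ipow A I j" "d \<in> I" using s by blast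
      have "r * ((a * c) * d) \<in> ipow A I (i + Suc j)"
        using cd Suc.IH r by (auto intro!: lin_span_scale)
      then show ?thesis by (simp add: cd mult_ac)
    qed
  qed
  then show ?case using Suc.prems by auto
qed

lemma int_closure_subset: "int_closure A I \<subseteq> A"
  by (auto simp: int_closure_def)

end

text \<open>
  If the value of \<open>z\<close> is strictly smaller than the values on \<open>I\<close>, then the value of \<open>z\<close> to the power \<open>n\<close>
  is strictly smaller than the values on the \<open>n\<close>-th power of \<open>I\<close>, for \<open>n > 0\<close>.
\<close>
lemma ipow_valuation:
  fixes z :: "'k::field"
  assumes V: "valuation_ring V" "A \<subseteq> V" and z: "z \<noteq> 0" and I: "\<And>a. a \<in> I \<Longrightarrow> \<not> vdvd V a z"
  shows "c \<in> ipow A I (Suc n) \<Longrightarrow> \<not> vdvd V c (z ^ Suc n)"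
proof (induction n arbitrary: c)
  case 0
  interpret V: valuation_ring V by (rule V)
  have "lin_span A {a * b |a b. a \<in> ipow A I 0 \<and> b \<in> I} \<subseteq> {c. \<not> vdvd V c z}"
  proof (rule lin_span_least)
    show "0 \<in> {c. \<not> vdvd V c z}" using z by (auto simp: vdvd_def)
    show "\<And>a b. a \<in> {c. \<not> vdvd V c z} \<Longrightarrow> b \<in> {c. \<not> vdvd V c z} \<Longrightarrow> a + b \<in> {c. \<not> vdvd V c z}"
      by (auto simp: V.not_vdvd_add)
    fix r s assume r: "r \<in> A" and "s \<in> {a * b |a b. a \<in> ipow A I 0 \<and> b \<in> I}"
    then obtain a b where ab: "s = a * b" "a \<in> A" "b \<in> I" by auto
    then have "\<not> vdvd V (a * b) z" using I V(2) by (intro V.not_vdvd_scale) auto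
    then show "r * s \<in> {c. \<not> vdvd V c z}" using r V(2) ab(1) by (auto dest: V.not_vdvd_scale)
  qed
  then show ?case using 0 by auto
next
  case (Suc n)
  interpret V: valuation_ring V by (rule V)
  let ?z = "z ^ Suc (Suc n)"
  have "lin_span A {a * b |a b. a \<in> ipow A I (Suc n) \<and> b \<in> I} \<subseteq> {c. \<not> vdvd V c ?z}"
  proof (rule lin_span_least)
    show "0 \<in> {c. \<not> vdvd V c ?z}" using z by (auto simp: vdvd_def)
    show "\<And>a b. a \<in> {c. \<not> vdvd V c ?z} \<Longrightarrow> b \<in> {c. \<not> vdvd V c ?z} \<Longrightarrow> a + b \<in> {c. \<not> vdvd V c ?z}"
      by (auto simp: V.not_vdvd_add)
    fix r s assume r: "r \<in> A" and "s \<in> {a * b |a b. a \<in> ipow A I (Suc n) \<and> b \<in> I}"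
    then obtain a b where ab: "s = a * b" "a \<in> ipow A I (Suc n)" "b \<in> I" by blast
    have "vdvd V z b" using I[OF ab(3)] by (rule V.not_vdvd_imp_vdvd)
    then have "\<not> vdvd V (a * b) (z ^ Suc n * z)" using Suc.IH[OF ab(2)] z by (intro V.not_vdvd_mult)
    then show "r * s \<in> {c. \<not> vdvd V c ?z}"
      using r V(2) ab(1) V.not_vdvd_scale[of "a * b" ?z r] by (auto simp: mult_ac)
  qed
  then show ?case using Suc.prems by auto
qed

text \<open>
  An equation of integral dependence is impossible in a valuation ring in which \<open>z \<notin> I V\<close>, because \<open>z ^ n\<close> has
  strictly smaller value than the other terms.  Conversely, let \<open>B\<close> be the ring generated over \<open>A\<close> by the quotients
  \<open>a / z\<close> with \<open>a \<in> I\<close>.  Its elements are the values at \<open>1 / z\<close> of the polynomials in the Rees algebra of \<open>I\<close>.  If the quotients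
  generated a proper ideal of \<open>B\<close>, they would lie in the maximal ideal of some valuation ring \<open>V\<close>, and then
  \<open>z \<notin> I V\<close>.  So they generate the unit ideal, and clearing denominators in the resulting expression of
  \<open>1\<close> gives an equation of integral dependence.
\<close>
theorem valuative_criterion:
  fixes A :: "'k::field set"
  assumes A: "comm_subring A" and I: "is_ideal A I"
  shows "z \<in> int_closure A I \<longleftrightarrow> z \<in> A \<and> (\<forall>V. valuation_ring V \<longrightarrow> A \<subseteq> V \<longrightarrow> vcov V I z)"
proof (intro iffI conjI allI impI)
  assume "z \<in> int_closure A I"
  then obtain n a where zA: "z \<in> A" and n: "n \<ge> 1" and a: "\<And>i. i \<in> {1..n} \<Longrightarrow> a i \<in> ipow A I i"
    and eq: "z ^ n + (\<Sum>i\<in>{1..n}. a i * z ^ (n - i)) = 0"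
    unfolding int_closure_def by blast
  show "z \<in> A" by (rule zA)
  fix V assume V: "valuation_ring V" "A \<subseteq> V"
  interpret V: valuation_ring V by (rule V)
  show "vcov V I z"
  proof (rule ccontr)
    assume "\<not> vcov V I z"
    then have no: "\<not> vdvd V a z" if "a \<in> I" for a using that by (auto simp: vcov_def)
    have z0: "z \<noteq> 0" using no[OF is_idealD(2)[OF I]] by auto
    have "\<not> vdvd V (a i * z ^ (n - i)) (z ^ n)" if i: "i \<in> {1..n}" for i
    proof -
      obtain j where j: "i = Suc j" using i by (cases i) auto
      have "\<not> vdvd V (a i) (z ^ i)"
        using ipow_valuation[OF V z0 no, where c = "a i" and n = j] a[OF i] j by simp
      then have "\<not> vdvd V (a i * z ^ (n - i)) (z ^ i * z ^ (n - i))"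
        using z0 by (intro V.not_vdvd_mult) auto
      then show ?thesis using i by (simp flip: power_add)
    qed
    then have "\<not> vdvd V (\<Sum>i\<in>{1..n}. a i * z ^ (n - i)) (z ^ n)"
      using z0 by (intro V.not_vdvd_sum) auto
    moreover have "z ^ n = (\<Sum>i\<in>{1..n}. a i * z ^ (n - i)) * (- 1)"
      using eq by (simp add: add_eq_0_iff2)
    ultimately show False using V.neg_closed[OF V.one_closed] unfolding vdvd_def by blast
  qed
next
  assume z: "z \<in> A \<and> (\<forall>V. valuation_ring V \<longrightarrow> A \<subseteq> V \<longrightarrow> vcov V I z)"
  interpret A: comm_subring A by (rule A)
  have IA: "I \<subseteq> A" using I by (auto dest: is_idealD)
  have Ii: "is_ideal A (ipow A I i)" for i by (rule A.is_ideal_ipow[OF IA])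
  have I0: "0 \<in> ipow A I i" for i by (rule is_idealD(2)[OF Ii])
  have ipow1: "a \<in> ipow A I (Suc 0)" if "a \<in> I" for a
  proof -
    have "1 * a \<in> {a * b |a b. a \<in> ipow A I 0 \<and> b \<in> I}" using that A.one_closed unfolding ipow.simps(1) by blast
    then have "1 * a \<in> ipow A I (Suc 0)" unfolding ipow.simps(2) by (rule A.lin_span_incl)
    then show ?thesis by (simp only: mult_1)
  qed
  show "z \<in> int_closure A I"
  proof (cases "z = 0")
    case True
    then show ?thesis using I0 z
      by (auto simp: int_closure_def intro!: exI[of _ "Suc 0"] exI[of _ "\<lambda>_. 0"] simp del: ipow.simps)
  next
    case False
    define rees where "rees = {p. \<forall>i. Polynomial.coeff p i \<in> ipow A I i}"
    define B where "B = {poly p (inverse z) |p. p \<in> rees}"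
    define J where "J = {a * inverse z |a. a \<in> I}"
    have sum_ipow: "sum f K \<in> ipow A I i" if "\<And>j. j \<in> K \<Longrightarrow> f j \<in> ipow A I i" for f i and K :: "nat set"
      using that by (induction K rule: infinite_finite_induct) (auto intro: I0 is_idealD(3)[OF Ii])
    have rees_add: "p + q \<in> rees" if "p \<in> rees" "q \<in> rees" for p q
      using that by (auto simp: rees_def intro: is_idealD(3)[OF Ii])
    have rees_mult: "p * q \<in> rees" if pq: "p \<in> rees" "q \<in> rees" for p q
    proof -
      have "Polynomial.coeff p j * Polynomial.coeff q (i - j) \<in> ipow A I i" if "j \<le> i" for i j
        using A.ipow_mult[OF IA, of "Polynomial.coeff p j" j "Polynomial.coeff q (i - j)" "i - j"] pq that
        by (auto simp: rees_def)
      then show ?thesis by (auto simp: rees_def coeff_mult intro!: sum_ipow)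
    qed
    have rees_const: "[:c:] \<in> rees" if "c \<in> A" for c
      using that I0 by (auto simp: rees_def coeff_pCons split: nat.split simp del: ipow.simps(2))
    have rees_monom: "Polynomial.monom a 1 \<in> rees" if "a \<in> I" for a
      using that I0 ipow1 by (auto simp: rees_def simp del: ipow.simps(2))
    have B: "comm_subring B"
    proof
      show "1 \<in> B" unfolding B_def using rees_const[of 1] by (intro CollectI exI[of _ "[:1:]"]) auto
      fix a b assume "a \<in> B" "b \<in> B"
      then obtain p q where pq: "a = poly p (inverse z)" "b = poly q (inverse z)" "p \<in> rees" "q \<in> rees"
        by (auto simp: B_def)
      show "a + b \<in> B" unfolding B_def using pq rees_add
        by (intro CollectI exI[of _ "p + q"]) auto
      show "a * b \<in> B" unfolding B_def using pq rees_mult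
        by (intro CollectI exI[of _ "p * q"]) auto
      show "- a \<in> B" unfolding B_def using pq rees_mult[OF rees_const[of "-1"], of p] A.neg_closed[of 1]
        by (intro CollectI exI[of _ "[:-1:] * p"]) auto
    qed
    have AB: "A \<subseteq> B"
    proof
      fix c assume "c \<in> A"
      then show "c \<in> B" unfolding B_def using rees_const by (intro CollectI exI[of _ "[:c:]"]) auto
    qed
    have J_poly: "a * inverse z = poly (Polynomial.monom a 1) (inverse z)" for a by (simp add: poly_monom)
    have JB: "J \<subseteq> B" unfolding J_def B_def using rees_monom J_poly by blast
    have "1 \<in> lin_span B J"
    proof (rule ccontr)
      assume "1 \<notin> lin_span B J"
      then obtain V where V: "valuation_ring V" "B \<subseteq> V" "1 \<notin> lin_span V J"
        using exists_valuation_ring[OF B JB] by blast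
      then have "vcov V I z" using z AB by blast
      then obtain a v where av: "a \<in> I" "v \<in> V" "z = a * v" by (auto simp: vcov_def vdvd_def)
      then have "v * (a * inverse z) \<in> lin_span V J" by (intro lin_span_scale) (auto simp: J_def)
      moreover have "v * (a * inverse z) = 1" using av(3) False by (simp add: field_simps)
      ultimately show False using V(3) by simp
    qed
    moreover have "lin_span B J \<subseteq> {poly p (inverse z) |p. p \<in> rees \<and> Polynomial.coeff p 0 = 0}"
    proof (rule lin_span_least)
      show "0 \<in> {poly p (inverse z) |p. p \<in> rees \<and> Polynomial.coeff p 0 = 0}"
        using rees_const[of 0] by (intro CollectI exI[of _ 0]) auto
      fix a b assume "a \<in> {poly p (inverse z) |p. p \<in> rees \<and> Polynomial.coeff p 0 = 0}"
        "b \<in> {poly p (inverse z) |p. p \<in> rees \<and> Polynomial.coeff p 0 = 0}"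
      then obtain p q where "a = poly p (inverse z)" "b = poly q (inverse z)" "p \<in> rees" "q \<in> rees"
        "Polynomial.coeff p 0 = 0" "Polynomial.coeff q 0 = 0" by auto
      then show "a + b \<in> {poly p (inverse z) |p. p \<in> rees \<and> Polynomial.coeff p 0 = 0}"
        using rees_add by (intro CollectI exI[of _ "p + q"]) auto
    next
      fix b s assume "b \<in> B" "s \<in> J"
      then obtain p a where "b = poly p (inverse z)" "p \<in> rees" "s = a * inverse z" "a \<in> I"
        by (auto simp: B_def J_def)
      then show "b * s \<in> {poly p (inverse z) |p. p \<in> rees \<and> Polynomial.coeff p 0 = 0}"
        using rees_mult rees_monom J_poly
        by (intro CollectI exI[of _ "p * Polynomial.monom a 1"]) (auto simp: coeff_mult)
    qed
    ultimately obtain p where p: "poly p (inverse z) = 1" "p \<in> rees" "Polynomial.coeff p 0 = 0" by force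
    define n where "n = Polynomial.degree p"
    have n: "n \<noteq> 0"
    proof
      assume "n = 0"
      then obtain c where "p = [:c:]" unfolding n_def by (auto elim: degree_eq_zeroE)
      then show False using p by simp
    qed
    have "1 = (\<Sum>i\<le>n. Polynomial.coeff p i * inverse z ^ i)" using p(1) by (simp add: poly_altdef n_def)
    also have "\<dots> = (\<Sum>i\<in>{1..n}. Polynomial.coeff p i * inverse z ^ i)"
      using p(3) by (intro sum.mono_neutral_right) (auto simp: Suc_le_eq)
    finally have "z ^ n * 1 = z ^ n * (\<Sum>i\<in>{1..n}. Polynomial.coeff p i * inverse z ^ i)" by simp
    also have "\<dots> = (\<Sum>i\<in>{1..n}. Polynomial.coeff p i * z ^ (n - i))"
      unfolding sum_distrib_left
    proof (rule sum.cong)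
      fix i assume "i \<in> {1..n}"
      then have "z ^ n = z ^ (n - i) * z ^ i" by (simp flip: power_add)
      then show "z ^ n * (Polynomial.coeff p i * inverse z ^ i) = Polynomial.coeff p i * z ^ (n - i)"
        using False by (simp add: field_simps)
    qed simp
    finally have eq: "z ^ n + (\<Sum>i\<in>{1..n}. - Polynomial.coeff p i * z ^ (n - i)) = 0"
      by (simp add: sum_negf)
    have "\<forall>i\<in>{1..n}. - Polynomial.coeff p i \<in> ipow A I i"
      using p(2) A.ideal_neg[OF Ii] by (auto simp: rees_def)
    then show ?thesis unfolding int_closure_def using z n eq
      by (intro CollectI conjI exI[of _ n] exI[of _ "\<lambda>i. - Polynomial.coeff p i"]) auto
  qed
qed

section \<open>Monomial ideals and their integral closures\<close>

lemma (in comm_subring) lin_span_times: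
  assumes "\<And>s t. s \<in> S \<Longrightarrow> t \<in> T \<Longrightarrow> s * t \<in> lin_span A U" "u \<in> lin_span A S" "v \<in> lin_span A T"
  shows "u * v \<in> lin_span A U"
  using assms(2)
proof induction
  case zero
  then show ?case by (simp add: lin_span.zero)
next
  case (step z a s)
  have "s * v \<in> lin_span A U"
    using assms(3)
  proof induction
    case zero
    then show ?case by (simp add: lin_span.zero)
  next
    case (step y b t)
    have "b * (s * t) + s * y \<in> lin_span A U"
      by (rule lin_span_add[OF lin_span_mult[OF assms(1)[OF \<open>s \<in> S\<close> \<open>t \<in> T\<close>] \<open>b \<in> A\<close>] step.IH])
    then show ?case by (simp add: algebra_simps)
  qed
  then have "a * (s * v) + z * v \<in> lin_span A U" using step by (intro lin_span_add[OF lin_span_mult])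
  then show ?case by (simp add: algebra_simps)
qed

lemma ideal_int_closure:
  fixes A :: "'k::field set"
  assumes A: "comm_subring A" and I: "is_ideal A I"
  shows "is_ideal A (int_closure A I)" "I \<subseteq> int_closure A I"
proof -
  interpret A: comm_subring A by (rule A)
  note crit = valuative_criterion[OF A I]
  have IA: "I \<subseteq> A" using I by (auto dest: is_idealD)
  show sub: "I \<subseteq> int_closure A I"
  proof
    fix z assume "z \<in> I"
    then show "z \<in> int_closure A I" unfolding crit using IA valuation_ring.vcov_incl by blast
  qed
  show "is_ideal A (int_closure A I)"
    unfolding is_ideal_def
  proof (intro conjI ballI)
    show "int_closure A I \<subseteq> A" by (rule A.int_closure_subset)
    show "0 \<in> int_closure A I" using sub is_idealD(2)[OF I] by blast
    show "a + b \<in> int_closure A I" if "a \<in> int_closure A I" "b \<in> int_closure A I" for a b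
      using that by (auto simp: crit intro: A.add_closed valuation_ring.vcov_add)
    show "r * a \<in> int_closure A I" if "r \<in> A" "a \<in> int_closure A I" for r a
    proof -
      have "vcov V I (r * a)" if V: "valuation_ring V" "A \<subseteq> V" for V
      proof -
        interpret V: valuation_ring V by (rule V)
        have "vcov V I a" "vdvd V a (r * a)"
          using V \<open>r \<in> A\<close> \<open>a \<in> int_closure A I\<close> by (auto simp: crit intro: V.vdvd_scale)
        then show ?thesis by (rule V.vcov_vdvd)
      qed
      then show ?thesis using that by (auto simp: crit intro: A.mult_closed)
    qed
  qed
qed

text \<open>
  Divisibility of the formal monomials in the variables indexed by \<open>T\<close>.
\<close>
definition mle :: "'i set \<Rightarrow> ('i \<Rightarrow> nat) \<Rightarrow> ('i \<Rightarrow> nat) \<Rightarrow> bool" where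
  "mle T b a \<longleftrightarrow> (\<forall>i\<in>T. b i \<le> a i)"

lemma mle_trans: "mle T a b \<Longrightarrow> mle T b c \<Longrightarrow> mle T a c"
  by (force simp: mle_def)

lemma mon_add: "mon T w (\<lambda>i. a i + b i) = mon T w a * mon T w b"
  by (simp add: mon_def power_add prod.distrib)

lemma mon_times: "mon T w (\<lambda>i. n * a i) = mon T w a ^ n"
  by (simp add: mon_def power_mult prod_power_distrib mult.commute[of n])

lemma mon_zero: "mon T w (\<lambda>_. 0) = 1"
  by (simp add: mon_def)

lemma mon_single:
  assumes "finite T" "i \<in> T" shows "mon T w (\<lambda>j. if j = i then n else 0) = w i ^ n"
proof -
  have "mon T w (\<lambda>j. if j = i then n else 0) = (\<Prod>j\<in>T. if j = i then w j ^ n else 1)"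
    unfolding mon_def by (rule prod.cong) auto
  then show ?thesis using assms by simp
qed

lemma mon_cong: "(\<And>i. i \<in> T \<Longrightarrow> a i = b i) \<Longrightarrow> mon T w a = mon T w b"
  unfolding mon_def by (rule prod.cong) auto

lemma mon_diff:
  assumes "mle T b a" shows "mon T w a = mon T w b * mon T w (\<lambda>i. a i - b i)"
proof -
  have "mon T w a = mon T w (\<lambda>i. b i + (a i - b i))"
    using assms by (intro mon_cong) (auto simp: mle_def)
  then show ?thesis by (simp add: mon_add)
qed

text \<open>
  If \<open>I\<close> is generated by the monomials with exponents in \<open>S\<close>, then these are the exponents of generators of the
  \<open>n\<close>-th power of \<open>I\<close>.
\<close>
primrec nfold :: "('i \<Rightarrow> nat) set \<Rightarrow> nat \<Rightarrow> ('i \<Rightarrow> nat) set" where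
  "nfold S 0 = {\<lambda>_. 0}"
| "nfold S (Suc n) = {\<lambda>i. a i + b i |a b. a \<in> nfold S n \<and> b \<in> S}"

text \<open>
  A local ring with maximal ideal generated by \<open>w\<close> in which the monomials in \<open>w\<close> behave as formal monomials.
  These conditions pass from \<open>R\<close> to its quadratic transform, so that the theory of monomial ideals is
  developed for both rings at once.
\<close>
locale monomial_ring = comm_subring A for A :: "'k::field set" +
  fixes T :: "nat set" and w :: "nat \<Rightarrow> 'k"
  assumes finT: "finite T" and wA: "i \<in> T \<Longrightarrow> w i \<in> A"
    and mon_in_span: "mon T w a \<in> lin_span A (mon T w ` S) \<Longrightarrow> \<exists>b\<in>S. mle T b a"
    and unit_or_in_max: "z \<in> A \<Longrightarrow> z \<in> lin_span A (w ` T) \<or> (\<exists>c\<in>A. c * z = 1)"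
begin

abbreviation M :: "(nat \<Rightarrow> nat) \<Rightarrow> 'k" where "M \<equiv> mon T w"

lemma M_closed: "M a \<in> A"
  unfolding mon_def using wA by (intro prod_closed power_closed) auto

lemma M_nonzero: "M a \<noteq> 0"
  using mon_in_span[of a "{}"] lin_span.zero[of A "{}"] by auto

lemma M_le_of_eq: "M a = M b \<Longrightarrow> mle T b a"
  using mon_in_span[of a "{b}"] lin_span_incl[of "M b" "M ` {b}"] by auto

lemma M_in_ideal_mono: "is_ideal A I \<Longrightarrow> M b \<in> I \<Longrightarrow> mle T b a \<Longrightarrow> M a \<in> I"
  using mon_diff[of T b a w] is_idealD(4)[of A I "M (\<lambda>i. a i - b i)" "M b"] M_closed
  by (simp add: mult.commute)

lemma is_ideal_M_span: "is_ideal A (lin_span A (M ` S))"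
  using M_closed by (intro is_ideal_lin_span) auto

text \<open>
  Modulo the ideal generated by the monomials in \<open>E\<close>, the element \<open>z\<close> is a polynomial in \<open>w\<close> whose nonzero coefficients are units.
  The exponents are normalized to be \<open>0\<close> outside \<open>T\<close> so that distinct exponents give distinct monomials.
\<close>
definition unit_form :: "(nat \<Rightarrow> nat) set \<Rightarrow> 'k \<Rightarrow> bool" where
  "unit_form E z \<longleftrightarrow> (\<exists>E' c. finite E' \<and> E' \<inter> E = {} \<and> (\<forall>a\<in>E'. \<forall>i. i \<notin> T \<longrightarrow> a i = 0) \<and>
     (\<forall>a\<in>E'. c a \<in> A \<and> (\<exists>u\<in>A. u * c a = 1)) \<and> z - (\<Sum>a\<in>E'. c a * M a) \<in> lin_span A (M ` E))"

text \<open>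
  When adding \<open>r * M a\<close> makes the coefficient of \<open>M a\<close> a nonunit, this coefficient is a combination of the elements
  \<open>w i\<close>, and the term can be traded for terms of degree one higher.  The process ends because \<open>E\<close>
  contains all exponents of degree at least \<open>N\<close>.
\<close>
lemma unit_form_add:
  assumes large: "\<And>a. N \<le> sum a T \<Longrightarrow> a \<in> E"
    and "unit_form E z" "r \<in> A" "\<And>i. i \<notin> T \<Longrightarrow> a i = 0" "N \<le> sum a T + n"
  shows "unit_form E (z + r * M a)"
  using assms(2-)
proof (induction n arbitrary: z r a)
  case (0 z r a)
  then obtain E' c where E': "finite E'" "E' \<inter> E = {}" "\<forall>a\<in>E'. \<forall>i. i \<notin> T \<longrightarrow> a i = 0"
    "\<forall>a\<in>E'. c a \<in> A \<and> (\<exists>u\<in>A. u * c a = 1)" "z - (\<Sum>a\<in>E'. c a * M a) \<in> lin_span A (M ` E)"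
    unfolding unit_form_def by blast
  have "r * M a \<in> lin_span A (M ` E)" using 0 large by (intro lin_span_scale) auto
  then have "(z - (\<Sum>a\<in>E'. c a * M a)) + r * M a \<in> lin_span A (M ` E)" using E'(5) by (intro lin_span_add)
  then have "z + r * M a - (\<Sum>a\<in>E'. c a * M a) \<in> lin_span A (M ` E)" by (simp add: algebra_simps)
  then show ?case unfolding unit_form_def using E' by blast
next
  case (Suc n z r a)
  then obtain E' c where E': "finite E'" "E' \<inter> E = {}" "\<forall>a\<in>E'. \<forall>i. i \<notin> T \<longrightarrow> a i = 0"
    "\<forall>a\<in>E'. c a \<in> A \<and> (\<exists>u\<in>A. u * c a = 1)" "z - (\<Sum>a\<in>E'. c a * M a) \<in> lin_span A (M ` E)"
    unfolding unit_form_def by blast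
  show ?case
  proof (cases "a \<in> E")
    case True
    have "r * M a \<in> lin_span A (M ` E)" using Suc.prems True by (intro lin_span_scale) auto
    then have "(z - (\<Sum>a\<in>E'. c a * M a)) + r * M a \<in> lin_span A (M ` E)" using E'(5) by (intro lin_span_add)
    then have "z + r * M a - (\<Sum>a\<in>E'. c a * M a) \<in> lin_span A (M ` E)" by (simp add: algebra_simps)
    then show ?thesis unfolding unit_form_def using E' by blast
  next
    case False
    define c0 where "c0 = (if a \<in> E' then c a else 0)"
    \<comment> \<open>Take the monomial \<open>M a\<close> out of the polynomial and put it back with its new coefficient \<open>r'\<close>.\<close>
    define z0 where "z0 = z - c0 * M a"
    define r' where "r' = c0 + r"
    have eq: "z + r * M a = z0 + r' * M a" by (simp add: z0_def r'_def algebra_simps)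
    have sum0: "(\<Sum>a\<in>E'. c a * M a) = c0 * M a + (\<Sum>a\<in>E' - {a}. c a * M a)"
      using E'(1) by (auto simp: c0_def sum.remove)
    have z0: "z0 - (\<Sum>a\<in>E' - {a}. c a * M a) \<in> lin_span A (M ` E)"
      using E'(5) by (simp add: z0_def sum0 algebra_simps)
    have z0form: "unit_form E z0"
      unfolding unit_form_def using E' z0 by (intro exI[of _ "E' - {a}"] exI[of _ c]) auto
    have r'A: "r' \<in> A" using Suc.prems E'(4) by (auto simp: r'_def c0_def intro: add_closed)
    show ?thesis unfolding eq
    proof (cases "\<exists>u\<in>A. u * r' = 1")
      case True
      have "(\<Sum>b\<in>insert a (E' - {a}). (c(a := r')) b * M b) = r' * M a + (\<Sum>b\<in>E' - {a}. (c(a := r')) b * M b)"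
        by (subst sum.insert) (use E'(1) in auto)
      also have "(\<Sum>b\<in>E' - {a}. (c(a := r')) b * M b) = (\<Sum>b\<in>E' - {a}. c b * M b)"
        by (rule sum.cong) auto
      finally have "z0 + r' * M a - (\<Sum>b\<in>insert a (E' - {a}). (c(a := r')) b * M b) \<in> lin_span A (M ` E)"
        using z0 by (simp add: algebra_simps)
      then show "unit_form E (z0 + r' * M a)"
        unfolding unit_form_def using E' True r'A False Suc.prems(3)
        by (intro exI[of _ "insert a (E' - {a})"] exI[of _ "c(a := r')"]) auto
    next
      case False
      then have "r' \<in> lin_span A (w ` T)" using unit_or_in_max[OF r'A] by blast
      then have "\<forall>z0. unit_form E z0 \<longrightarrow> unit_form E (z0 + r' * M a)"
      proof induction
        case (step q b s)
        then obtain i where i: "i \<in> T" "s = w i" by blast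
        define a' where "a' = (\<lambda>j. a j + (if j = i then 1 else 0))"
        have M': "M a' = M a * w i" unfolding a'_def using finT i by (simp add: mon_add mon_single)
        have sum': "sum a' T = Suc (sum a T)"
          unfolding a'_def using finT i by (simp add: sum.distrib)
        show ?case
        proof (intro allI impI)
          fix z0 assume "unit_form E z0"
          then have "unit_form E (z0 + b * M a')"
            using step.hyps(2) Suc.prems(3,4) i sum' by (intro Suc.IH) (auto simp: a'_def)
          then have "unit_form E (z0 + b * M a' + q * M a)" using step.IH by blast
          then show "unit_form E (z0 + (b * s + q) * M a)" by (simp add: M' i algebra_simps)
        qed
      qed auto
      then show "unit_form E (z0 + r' * M a)" using z0form by blast
    qed
  qed
qed

lemma unit_form_exists:
  assumes large: "\<And>a. N \<le> sum a T \<Longrightarrow> a \<in> E" and z: "z \<in> A"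
  shows "unit_form E z"
proof -
  have "unit_form E 0"
    unfolding unit_form_def by (intro exI[of _ "{}"]) (auto intro: lin_span.zero)
  then have "unit_form E (0 + z * M (\<lambda>_. 0))"
    using z by (intro unit_form_add[OF large, of N _ _ _ N]) auto
  then show ?thesis by (simp add: mon_zero)
qed

lemma M_span_times:
  assumes "\<And>a b. a \<in> E \<Longrightarrow> b \<in> F \<Longrightarrow> (\<lambda>i. a i + b i) \<in> G" "u \<in> lin_span A (M ` E)" "v \<in> lin_span A (M ` F)"
  shows "u * v \<in> lin_span A (M ` G)"
proof (rule lin_span_times[OF _ assms(2,3)])
  fix s t assume "s \<in> M ` E" "t \<in> M ` F"
  then obtain a b where "a \<in> E" "b \<in> F" "s * t = M (\<lambda>i. a i + b i)" by (auto simp: mon_add)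
  then show "s * t \<in> lin_span A (M ` G)" using assms(1) by (auto intro!: lin_span_incl)
qed

lemma ipow_M_span: "ipow A (lin_span A (M ` S)) n \<subseteq> lin_span A (M ` nfold S n)"
proof (induction n)
  case 0
  then show ?case using lin_span_scale[of _ A 1 "{1}"] by (auto simp: mon_zero)
next
  case (Suc n)
  have "{a * b |a b. a \<in> ipow A (lin_span A (M ` S)) n \<and> b \<in> lin_span A (M ` S)} \<subseteq> lin_span A (M ` nfold S (Suc n))"
  proof clarify
    fix a b assume "a \<in> ipow A (lin_span A (M ` S)) n" "b \<in> lin_span A (M ` S)"
    then show "a * b \<in> lin_span A (M ` nfold S (Suc n))"
      using Suc by (intro M_span_times[of "nfold S n" S]) auto
  qed
  then show ?case unfolding ipow.simps(2) by (rule lin_span_subset_span)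
qed

text \<open>
  All terms of an equation of integral dependence for \<open>M a\<close> over a monomial ideal lie in ideals generated by
  monomials, so the leading term \<open>M a ^ n\<close> is divisible by a single monomial of a single term.
\<close>
lemma integral_monomial:
  assumes "M a \<in> int_closure A (lin_span A (M ` S))"
  shows "\<exists>i\<ge>1. \<exists>b\<in>nfold S i. mle T b (\<lambda>j. i * a j)"
proof -
  obtain n c where n: "n \<ge> 1" and c: "\<And>i. i \<in> {1..n} \<Longrightarrow> c i \<in> ipow A (lin_span A (M ` S)) i"
    and eq: "M a ^ n + (\<Sum>i\<in>{1..n}. c i * M a ^ (n - i)) = 0"
    using assms unfolding int_closure_def by blast
  let ?G = "{\<lambda>j. b j + (n - i) * a j |i b. i \<in> {1..n} \<and> b \<in> nfold S i}"
  have "c i * M a ^ (n - i) \<in> lin_span A (M ` ?G)" if i: "i \<in> {1..n}" for i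
  proof (rule M_span_times[of "nfold S i" "{\<lambda>j. (n - i) * a j}"])
    show "c i \<in> lin_span A (M ` nfold S i)" using c[OF i] ipow_M_span by blast
    show "M a ^ (n - i) \<in> lin_span A (M ` {\<lambda>j. (n - i) * a j})" by (intro lin_span_incl) (simp add: mon_times)
  qed (use i in auto)
  then have "- (\<Sum>i\<in>{1..n}. c i * M a ^ (n - i)) \<in> lin_span A (M ` ?G)"
    by (intro lin_span_neg lin_span_sum)
  moreover have "- (\<Sum>i\<in>{1..n}. c i * M a ^ (n - i)) = M (\<lambda>j. n * a j)"
    using eq unfolding mon_times by (metis add_eq_0_iff2 add.inverse_inverse)
  ultimately obtain b i where b: "i \<in> {1..n}" "b \<in> nfold S i" "mle T (\<lambda>j. b j + (n - i) * a j) (\<lambda>j. n * a j)"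
    using mon_in_span[of "\<lambda>j. n * a j" ?G] by auto
  have "mle T b (\<lambda>j. i * a j)"
    unfolding mle_def
  proof
    fix j assume "j \<in> T"
    then have "b j + (n - i) * a j \<le> n * a j" using b(3) by (auto simp: mle_def)
    moreover have "n * a j = (n - i) * a j + i * a j" using b(1) by (simp flip: distrib_right)
    ultimately show "b j \<le> i * a j" by simp
  qed
  then show ?thesis using b by auto
qed

text \<open>
  Suppose \<open>a\<close> is the least exponent of the polynomial in an order of the exponents that is compatible with addition and refines
  divisibility, and all generators of the ideal are larger.  Then in an equation of integral
  dependence the power \<open>M (n a)\<close> occurs in the leading term with a unit coefficient, and every other
  contribution is a combination of strictly larger monomials; but \<open>M (n a)\<close> cannot be such a combination.
\<close>
lemma unit_form_not_integral:
  assumes fin: "finite E" and aE: "a \<in> E"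
    and c: "\<And>b. b \<in> E \<Longrightarrow> c b \<in> A" and u: "u \<in> A" "u * c a = 1"
    and less_add: "\<And>p q r. prec p q \<Longrightarrow> prec (\<lambda>i. p i + r i) (\<lambda>i. q i + r i)"
    and less_trans: "\<And>p q r. prec p q \<Longrightarrow> prec q r \<Longrightarrow> prec p r"
    and less_not_le: "\<And>p q. prec p q \<Longrightarrow> \<not> mle T q p"
    and E: "\<And>b. b \<in> E \<Longrightarrow> b \<noteq> a \<Longrightarrow> prec a b" and S: "\<And>b. b \<in> S \<Longrightarrow> prec a b"
  shows "(\<Sum>b\<in>E. c b * M b) \<notin> int_closure A (lin_span A (M ` S))"
proof
  let ?z = "\<Sum>b\<in>E. c b * M b"
  assume "?z \<in> int_closure A (lin_span A (M ` S))"
  then obtain n r where n: "n \<ge> 1" and r: "\<And>i. i \<in> {1..n} \<Longrightarrow> r i \<in> ipow A (lin_span A (M ` S)) i"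
    and eq: "?z ^ n + (\<Sum>i\<in>{1..n}. r i * ?z ^ (n - i)) = 0"
    unfolding int_closure_def by blast
  \<comment> \<open>Exponents strictly above \<open>n a\<close>, and these together with \<open>n a\<close> itself.\<close>
  define above where "above = (\<lambda>n::nat. {b. prec (\<lambda>i. n * a i) b})"
  define onwards where "onwards = (\<lambda>n::nat. insert (\<lambda>i. n * a i) (above n))"
  have less_add2: "prec (\<lambda>i. p i + p' i) (\<lambda>i. q i + q' i)" if "prec p q" "prec p' q'" for p q p' q'
  proof -
    have "prec (\<lambda>i. q i + p' i) (\<lambda>i. q i + q' i)"
      using less_add[OF that(2), of q] by (simp add: add.commute)
    with less_add[OF that(1), of p'] show ?thesis by (rule less_trans)
  qed
  have above_from: "(\<lambda>i. p i + q i) \<in> above (m + n)" if "p \<in> above m" "q \<in> onwards n" for p q m n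
    using that less_add2[of "\<lambda>i. m * a i" p "\<lambda>i. n * a i" q] less_add[of "\<lambda>i. m * a i" p "\<lambda>i. n * a i"]
    by (auto simp: onwards_def above_def distrib_right)
  have from_from: "(\<lambda>i. p i + q i) \<in> onwards (m + n)" if p: "p \<in> onwards m" and q: "q \<in> onwards n" for p q m n
  proof (cases "p \<in> above m")
    case True
    then show ?thesis using above_from[OF _ q] by (auto simp: onwards_def)
  next
    case False
    then have pm: "p = (\<lambda>i. m * a i)" using p by (auto simp: onwards_def)
    have "prec (\<lambda>i. n * a i) q \<Longrightarrow> prec (\<lambda>i. m * a i + n * a i) (\<lambda>i. m * a i + q i)"
      using less_add[of "\<lambda>i. n * a i" q "\<lambda>i. m * a i"] by (simp add: add.commute)
    then show ?thesis using q by (auto simp: onwards_def above_def pm distrib_right)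
  qed
  have z: "?z = c a * M a + (\<Sum>b\<in>E - {a}. c b * M b)"
    using fin aE by (simp add: sum.remove)
  define t where "t = (\<Sum>b\<in>E - {a}. c b * M b)"
  have t: "t \<in> lin_span A (M ` above 1)"
    unfolding t_def using c E by (intro lin_span_sum lin_span_scale) (auto simp: above_def)
  have above_sub: "lin_span A (M ` above n) \<subseteq> lin_span A (M ` onwards n)" for n
    by (intro lin_span_mono) (auto simp: onwards_def)
  have lead: "c a ^ n * M a ^ n \<in> lin_span A (M ` onwards n)" for n
    using c[OF aE] by (intro lin_span_scale power_closed) (auto simp: onwards_def mon_times)
  have zfrom: "?z \<in> lin_span A (M ` onwards 1)"
    unfolding z t_def[symmetric] using t above_sub lead[of 1] by (intro lin_span_add) auto
  have zpow: "?z ^ k - c a ^ k * M a ^ k \<in> lin_span A (M ` above k) \<and> ?z ^ k \<in> lin_span A (M ` onwards k)" for k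
  proof (induction k)
    case 0
    have "1 \<in> lin_span A (M ` onwards 0)" using lead[of 0] by simp
    then show ?case by (simp add: lin_span.zero)
  next
    case (Suc k)
    have 1: "t * ?z ^ k \<in> lin_span A (M ` above (1 + k))"
      using above_from[of _ 1 _ k] t Suc.IH by (intro M_span_times[of "above 1" "onwards k"]) auto
    have 2: "(?z ^ k - c a ^ k * M a ^ k) * (c a * M a) \<in> lin_span A (M ` above (k + 1))"
      using above_from[of _ k _ 1] lead[of 1] Suc.IH
      by (intro M_span_times[of "above k" "onwards 1" "above (k + 1)" _ "c a * M a"]) auto
    have "?z ^ Suc k = (c a * M a + t) * ?z ^ k" by (simp add: z t_def)
    then have "?z ^ Suc k - c a ^ Suc k * M a ^ Suc k = t * ?z ^ k + (?z ^ k - c a ^ k * M a ^ k) * (c a * M a)"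
      by (simp add: algebra_simps)
    also have "\<dots> \<in> lin_span A (M ` above (Suc k))" using 1 2 by (intro lin_span_add) auto
    finally have 3: "?z ^ Suc k - c a ^ Suc k * M a ^ Suc k \<in> lin_span A (M ` above (Suc k))" .
    have "(?z ^ Suc k - c a ^ Suc k * M a ^ Suc k) + c a ^ Suc k * M a ^ Suc k \<in> lin_span A (M ` onwards (Suc k))"
      using 3 above_sub lead[of "Suc k"] by (intro lin_span_add) blast+
    then have "?z ^ Suc k \<in> lin_span A (M ` onwards (Suc k))" by (simp only: diff_add_cancel)
    then show ?case using 3 by blast
  qed
  have nfold_above: "b \<in> above (Suc k)" if "b \<in> nfold S (Suc k)" for b k
    using that
  proof (induction k arbitrary: b)
    case 0
    then show ?case using S by (auto simp: above_def)
  next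
    case (Suc k)
    then obtain p q where "b = (\<lambda>i. p i + q i)" "p \<in> nfold S (Suc k)" "q \<in> S"
      unfolding nfold.simps(2)[of S "Suc k"] by blast
    then show ?case using Suc.IH S above_from[of p "Suc k" q 1] by (auto simp: onwards_def above_def)
  qed
  have "r i * ?z ^ (n - i) \<in> lin_span A (M ` above n)" if i: "i \<in> {1..n}" for i
  proof -
    obtain k where k: "i = Suc k" using i by (cases i) auto
    have "M ` nfold S i \<subseteq> M ` above i" using nfold_above[of _ k] unfolding k by blast
    then have "r i \<in> lin_span A (M ` above i)"
      using r[OF i] ipow_M_span lin_span_mono[of A A "M ` nfold S i" "M ` above i"] by blast
    then have "r i * ?z ^ (n - i) \<in> lin_span A (M ` above (i + (n - i)))"
      using above_from zpow by (intro M_span_times[of "above i" "onwards (n - i)"]) auto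
    then show ?thesis using i by simp
  qed
  then have "- (\<Sum>i\<in>{1..n}. r i * ?z ^ (n - i)) \<in> lin_span A (M ` above n)"
    by (intro lin_span_neg lin_span_sum)
  then have "?z ^ n \<in> lin_span A (M ` above n)"
    using eq by (metis add_eq_0_iff2)
  then have "?z ^ n - (?z ^ n - c a ^ n * M a ^ n) \<in> lin_span A (M ` above n)"
    by (rule lin_span_diff) (use zpow in blast)
  then have "c a ^ n * M a ^ n \<in> lin_span A (M ` above n)" by simp
  then have "u ^ n * (c a ^ n * M a ^ n) \<in> lin_span A (M ` above n)"
    by (rule lin_span_mult[OF _ power_closed[OF u(1)]])
  moreover have "u ^ n * (c a ^ n * M a ^ n) = M (\<lambda>i. n * a i)"
    using u(2) by (simp add: mon_times mult.assoc[symmetric] power_mult_distrib[symmetric])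
  ultimately obtain b where "prec (\<lambda>i. n * a i) b" "mle T b (\<lambda>i. n * a i)"
    using mon_in_span by (auto simp: above_def)
  then show False using less_not_le by blast
qed

end

text \<open>
  The lexicographic order serves to break ties between monomials of equal value.
\<close>
definition lexless :: "nat set \<Rightarrow> (nat \<Rightarrow> nat) \<Rightarrow> (nat \<Rightarrow> nat) \<Rightarrow> bool" where
  "lexless T a b \<longleftrightarrow> (\<exists>k\<in>T. a k < b k \<and> (\<forall>i\<in>T. i < k \<longrightarrow> a i = b i))"

lemma lexless_trans: assumes "lexless T a b" "lexless T b c" shows "lexless T a c"
proof -
  obtain k l where k: "k \<in> T" "a k < b k" "\<forall>i\<in>T. i < k \<longrightarrow> a i = b i"
    and l: "l \<in> T" "b l < c l" "\<forall>i\<in>T. i < l \<longrightarrow> b i = c i"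
    using assms unfolding lexless_def by blast
  show ?thesis
    unfolding lexless_def using k l
    by (cases k l rule: linorder_cases) (auto intro!: bexI[of _ "min k l"] simp: min_def)
qed

lemma lexless_total: assumes "a \<noteq> b" "\<And>i. i \<notin> T \<Longrightarrow> a i = b i" shows "lexless T a b \<or> lexless T b a"
proof -
  define k where "k = (LEAST k. a k \<noteq> b k)"
  have "\<exists>k. a k \<noteq> b k" using assms(1) by auto
  then have k: "a k \<noteq> b k" unfolding k_def by (rule LeastI_ex)
  have less: "a i = b i" if "i < k" for i using not_less_Least[of i] that unfolding k_def by blast
  have "k \<in> T" using k assms(2) by blast
  then show ?thesis using k less unfolding lexless_def by (metis linorder_neqE_nat)
qed

context monomial_ring
begin

text \<open>
  The integral closure of a monomial ideal primary to the maximal ideal is a monomial ideal.  Modulo the monomials in \<open>H\<close>, an element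
  of \<open>H\<close> is a polynomial with unit coefficients in monomials outside \<open>H\<close>.  If such a polynomial is nonzero, some valuation gives one
  of its monomials a smaller value than all of \<open>S\<close>.  Ordering monomials by value, and lexicographically if values
  agree, its least monomial contradicts \<open>unit_form_not_integral\<close>.
\<close>
lemma int_closure_monomial:
  assumes S: "S \<noteq> {}" and pow: "\<And>i. i \<in> T \<Longrightarrow> w i ^ K \<in> int_closure A (lin_span A (M ` S))"
  defines "H \<equiv> int_closure A (lin_span A (M ` S))"
  shows "H = lin_span A (M ` {a. M a \<in> H})"
proof
  let ?I = "lin_span A (M ` S)"
  have I: "is_ideal A ?I" by (rule is_ideal_M_span)
  have H: "is_ideal A H" unfolding H_def by (rule ideal_int_closure[OF comm_subring_axioms I])
  show sub: "lin_span A (M ` {a. M a \<in> H}) \<subseteq> H" by (intro lin_span_subset_ideal[OF H]) auto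
  show "H \<subseteq> lin_span A (M ` {a. M a \<in> H})"
  proof
    fix z assume z: "z \<in> H"
    have large: "a \<in> {a. M a \<in> H}" if a: "Suc (card T * K) \<le> sum a T" for a
    proof -
      have "\<exists>i\<in>T. K \<le> a i"
      proof (rule ccontr)
        assume "\<not> ?thesis"
        then have "sum a T \<le> (\<Sum>i\<in>T. K)" by (intro sum_mono) auto
        then show False using a by simp
      qed
      then obtain i where i: "i \<in> T" "K \<le> a i" by blast
      have "M (\<lambda>j. if j = i then K else 0) \<in> H" using pow[OF i(1)] finT i by (simp add: mon_single H_def)
      then show ?thesis using M_in_ideal_mono[OF H] i by (auto simp: mle_def)
    qed
    have "unit_form {a. M a \<in> H} z"
      by (rule unit_form_exists[OF large is_idealD(1)[OF H z]])
    then obtain E c where E: "finite E" "E \<inter> {a. M a \<in> H} = {}" "\<And>a i. a \<in> E \<Longrightarrow> i \<notin> T \<Longrightarrow> a i = 0"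
      "\<And>a. a \<in> E \<Longrightarrow> c a \<in> A \<and> (\<exists>u\<in>A. u * c a = 1)"
      and h: "z - (\<Sum>a\<in>E. c a * M a) \<in> lin_span A (M ` {a. M a \<in> H})"
      unfolding unit_form_def by blast
    have "z - (z - (\<Sum>a\<in>E. c a * M a)) \<in> H"
      by (rule ideal_diff[OF H z]) (use h sub in blast)
    then have zH: "(\<Sum>a\<in>E. c a * M a) \<in> H" by simp
    have "E = {}"
    proof (rule ccontr)
      assume "E \<noteq> {}"
      \<comment> \<open>Any monomial of the polynomial yields a suitable valuation; the least one for that valuation is the leading one.\<close>
      then obtain a0 where a0: "a0 \<in> E" by blast
      then have "M a0 \<notin> int_closure A ?I" using E(2) by (auto simp: H_def)
      then obtain V where V: "valuation_ring V" "A \<subseteq> V" "\<not> vcov V ?I (M a0)"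
        using valuative_criterion[OF comm_subring_axioms I] M_closed by blast
      interpret V: valuation_ring V by (rule V)
      define le where "le = (\<lambda>a b. vdvd V (M a) (M b))"
      define prec where "prec = (\<lambda>a b. \<not> le b a \<or> (le a b \<and> le b a \<and> lexless T a b))"
      have le_total: "le a b \<or> le b a" for a b unfolding le_def by (rule V.vdvd_total)
      have le_trans: "le a b \<Longrightarrow> le b c \<Longrightarrow> le a c" for a b c unfolding le_def by (rule V.vdvd_trans)
      have less_le: "prec a b \<Longrightarrow> le a b" for a b unfolding prec_def using le_total by blast
      have less_trans: "prec p r" if "prec p q" "prec q r" for p q r
        using that le_total le_trans lexless_trans unfolding prec_def by meson
      have le_add: "le (\<lambda>i. p i + r i) (\<lambda>i. q i + r i) \<longleftrightarrow> le p q" for p q r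
        unfolding le_def mon_add using V.vdvd_cancel[OF M_nonzero[of r]] by (simp add: mult.commute)
      have less_add: "prec (\<lambda>i. p i + r i) (\<lambda>i. q i + r i)" if "prec p q" for p q r
        using that unfolding prec_def le_add lexless_def by auto
      have mle_le: "le q p" if "mle T q p" for p q
        using mon_diff[OF that, of w] M_closed V(2) unfolding le_def vdvd_def by blast
      have less_not_le: "\<not> mle T q p" if "prec p q" for p q
        using that mle_le[of q p] unfolding prec_def lexless_def mle_def by force
      have less_total: "prec p q \<or> prec q p" if "p \<in> E" "q \<in> E" "p \<noteq> q" for p q
    proof -
        have "p i = q i" if "i \<notin> T" for i using E(3)[OF \<open>p \<in> E\<close> that] E(3)[OF \<open>q \<in> E\<close> that] by simp
        then have "lexless T p q \<or> lexless T q p" by (rule lexless_total[OF \<open>p \<noteq> q\<close>])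
        then show ?thesis using le_total[of p q] unfolding prec_def by blast
      qed
      have irrefl: "\<not> prec p p" for p using less_not_le[of p p] by (auto simp: mle_def)
        have least: "\<exists>a\<in>E'. \<forall>b\<in>E'. b \<noteq> a \<longrightarrow> prec a b" if "finite E'" "E' \<noteq> {}" "E' \<subseteq> E" for E'
          using that
        proof (induction E' rule: finite_ne_induct)
          case (insert x F)
          then obtain a where a: "a \<in> F" "\<forall>b\<in>F. b \<noteq> a \<longrightarrow> prec a b" by blast
          then have "prec x a \<or> prec a x" using insert less_total[of x a] by blast
          then show ?case
          proof
            assume "prec x a"
            then have "prec x b" if "b \<in> F" for b
              using a(2) that less_trans[of x a b] by (cases "b = a") auto
            then show ?thesis by blast
          qed (use a in blast)
        qed auto
      obtain a where a: "a \<in> E" "\<forall>b\<in>E. b \<noteq> a \<longrightarrow> prec a b"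
        using least[OF E(1) \<open>E \<noteq> {}\<close> order_refl] by (rule bexE)
      have Sprec: "prec a b" if b: "b \<in> S" for b
      proof -
        have "\<not> le b a0" using V(3) b lin_span_incl unfolding vcov_def le_def by blast
        moreover have "le a a0" using a(2) a0 less_le[of a a0] by (cases "a = a0") (auto simp: le_def)
        ultimately show ?thesis using le_trans[of b a a0] unfolding prec_def by blast
      qed
      obtain u where u: "u \<in> A" "u * c a = 1" using E(4)[OF a(1)] by blast
      have "(\<Sum>b\<in>E. c b * M b) \<notin> int_closure A ?I"
      proof (rule unit_form_not_integral[of E a c u prec S])
        show "c b \<in> A" if "b \<in> E" for b using E(4)[OF that] by simp
        show "prec a b" if "b \<in> E" "b \<noteq> a" for b using a(2) that by simp
        show "prec (\<lambda>i. p i + r i) (\<lambda>i. q i + r i)" if "prec p q" for p q r using that by (rule less_add)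
        show "prec p r" if "prec p q" "prec q r" for p q r using that by (rule less_trans)
        show "\<not> mle T q p" if "prec p q" for p q using that by (rule less_not_le)
      qed (use E(1) a(1) u Sprec in simp_all)
      then show False using zH by (simp add: H_def)
    qed
    then show "z \<in> lin_span A (M ` {a. M a \<in> H})" using h by simp
  qed
qed

definition min_exps :: "'k set \<Rightarrow> (nat \<Rightarrow> nat) set" where
  "min_exps I = {a. M a \<in> I \<and> (\<forall>b. M b \<in> I \<longrightarrow> mle T b a \<longrightarrow> mle T a b)}"

lemma min_exps_below: "M a \<in> I \<Longrightarrow> \<exists>b\<in>min_exps I. mle T b a"
proof (induction "sum a T" arbitrary: a rule: less_induct)
  case less
  show ?case
  proof (cases "a \<in> min_exps I")
    case True
    then show ?thesis by (auto simp: mle_def)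
  next
    case False
    then obtain b where b: "M b \<in> I" "mle T b a" "\<not> mle T a b" using less.prems by (auto simp: min_exps_def)
    then have "sum b T < sum a T"
      using finT by (intro sum_strict_mono_ex1) (auto simp: mle_def not_le)
    then show ?thesis using less.hyps[OF _ b(1)] b(2) mle_trans by blast
  qed
qed

lemma span_min_exps:
  assumes "I = lin_span A (M ` S)" shows "I = lin_span A (M ` min_exps I)"
proof
  have I: "is_ideal A I" unfolding assms by (rule is_ideal_M_span)
  show "lin_span A (M ` min_exps I) \<subseteq> I"
    by (intro lin_span_subset_ideal[OF I]) (auto simp: min_exps_def)
  show "I \<subseteq> lin_span A (M ` min_exps I)"
  proof (subst assms, intro lin_span_subset_span subsetI)
    fix s assume "s \<in> M ` S"
    then obtain a where a: "s = M a" "M a \<in> I" using assms lin_span_incl by auto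
    then obtain b where "b \<in> min_exps I" "mle T b a" using min_exps_below by blast
    then show "s \<in> lin_span A (M ` min_exps I)"
      using M_in_ideal_mono[OF is_ideal_M_span] lin_span_incl a(1) by blast
  qed
qed

text \<open>
  A monomial ideal has exactly one irredundant set of monomial generators, formed by its minimal monomials.
\<close>
lemma union_irredundant_gens:
  assumes I: "I = lin_span A (M ` S)"
  shows "\<Union>{S. S \<subseteq> range M \<and> lin_span A S = I \<and> (\<forall>S'. S' \<subset> S \<longrightarrow> lin_span A S' \<noteq> I)} = M ` min_exps I"
proof (intro equalityI subsetI)
  fix s assume "s \<in> \<Union>{S. S \<subseteq> range M \<and> lin_span A S = I \<and> (\<forall>S'. S' \<subset> S \<longrightarrow> lin_span A S' \<noteq> I)}"
  then obtain G where G: "s \<in> G" "G \<subseteq> range M" "lin_span A G = I" "\<And>S'. S' \<subset> G \<Longrightarrow> lin_span A S' \<noteq> I" by blast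
  obtain F where F: "G = M ` F" using G(2) subset_image_iff[of G M UNIV] by blast
  obtain a where a: "s = M a" using G(1,2) by blast
  have aI: "M a \<in> I" using G(1,3) a lin_span_incl by blast
  have "mle T a b" if b: "M b \<in> I" "mle T b a" for b
  proof -
    obtain c where c: "c \<in> F" "mle T c b" using mon_in_span[of b F] b(1) G(3) F by auto
    have "M c = M a"
    proof (rule ccontr)
      assume ne: "M c \<noteq> M a"
      have "M c \<in> lin_span A (G - {M a})" using c(1) F ne by (intro lin_span_incl) auto
      then have "M (\<lambda>i. a i - c i) * M c \<in> lin_span A (G - {M a})" using M_closed by (rule lin_span_mult)
      moreover have "M a = M c * M (\<lambda>i. a i - c i)" using mle_trans[OF c(2) b(2)] by (rule mon_diff)
      ultimately have "M a \<in> lin_span A (G - {M a})" by (simp only: mult.commute)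
      then have "G \<subseteq> lin_span A (G - {M a})" using lin_span_incl[of _ "G - {M a}"] by blast
      then have "lin_span A G \<subseteq> lin_span A (G - {M a})" by (rule lin_span_subset_span)
      then have "I \<subseteq> lin_span A (G - {M a})" by (simp only: G(3))
      moreover have "lin_span A (G - {M a}) \<subseteq> I" using lin_span_mono[of A A "G - {M a}" G] G(3) by auto
      ultimately show False using G(4)[of "G - {M a}"] G(1) a by blast
    qed
    then have "mle T a c" using M_le_of_eq[of c a] by simp
    then show ?thesis using c(2) by (rule mle_trans)
  qed
  then show "s \<in> M ` min_exps I" using a aI by (auto simp: min_exps_def)
next
  fix s assume s: "s \<in> M ` min_exps I"
  have "lin_span A S' \<noteq> I" if S': "S' \<subset> M ` min_exps I" for S'
  proof
    assume eq: "lin_span A S' = I"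
    obtain F where F: "F \<subseteq> min_exps I" "S' = M ` F"
      using psubset_imp_subset[OF S'] unfolding subset_image_iff by blast
    obtain a where a: "a \<in> min_exps I" "M a \<notin> S'" using S' by blast
    have "M a \<in> lin_span A (M ` F)" using a(1) eq F(2) by (auto simp: min_exps_def)
    then obtain b where b: "b \<in> F" "mle T b a" using mon_in_span by blast
    then have "mle T a b" using a(1) F(1) by (auto simp: min_exps_def)
    then have "M a = M b" using b(2) by (intro mon_cong) (auto simp: mle_def intro: antisym)
    then show False using a(2) b(1) F(2) by auto
  qed
  then show "s \<in> \<Union>{S. S \<subseteq> range M \<and> lin_span A S = I \<and> (\<forall>S'. S' \<subset> S \<longrightarrow> lin_span A S' \<noteq> I)}"
    using s span_min_exps[OF I] by (intro UnionI[of "M ` min_exps I"]) auto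
qed

end

section \<open>The local quadratic transform\<close>

text \<open>
  The index \<open>1\<close> of the parameter \<open>x\<close> would otherwise be rewritten to \<open>Suc 0\<close>.
\<close>
declare One_nat_def [simp del]

text \<open>
  Here \<open>w 1\<close> is the parameter \<open>x\<close> and \<open>w j\<close> is \<open>y j\<close> for \<open>j \<in> {2..d}\<close>.  The corresponding parameters of the
  quadratic transform are called \<open>v\<close>, so that \<open>v 1\<close> is \<open>x\<close> and \<open>v j\<close> is \<open>u j\<close>; \<open>tdeg\<close> is the
  degree in the \<open>u j\<close>.
\<close>
locale quadratic_chart = monomial_ring A "{1..d}" w for A :: "'k::field set" and d w +
  assumes d_pos: "1 \<le> d"
begin

abbreviation x :: 'k where "x \<equiv> w 1"
abbreviation "T \<equiv> {1..d}"

definition v :: "nat \<Rightarrow> 'k" where "v i = (if i = 1 then x else w i / x)"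

definition tdeg :: "(nat \<Rightarrow> nat) \<Rightarrow> nat" where "tdeg b = (\<Sum>j\<in>{2..d}. b j)"

lemma T_split: "T = insert 1 {2..d}" using d_pos by auto

lemma x_nonzero: "x \<noteq> 0"
  using M_nonzero[of "\<lambda>j. if j = 1 then 1 else 0"] mon_single[OF finT, of 1 w 1] d_pos by auto

lemma xA: "x \<in> A" using wA[of 1] d_pos by simp

lemma mon_split: "mon T f a = f 1 ^ a 1 * (\<Prod>j\<in>{2..d}. f j ^ a j)"
  unfolding mon_def T_split by (subst prod.insert) auto

lemma mon_v: "mon T v b * x ^ tdeg b = x ^ b 1 * (\<Prod>j\<in>{2..d}. w j ^ b j)"
proof -
  have "(\<Prod>j\<in>{2..d}. v j ^ b j) * x ^ tdeg b = (\<Prod>j\<in>{2..d}. v j ^ b j * x ^ b j)"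
    by (simp add: tdeg_def power_sum prod.distrib)
  also have "\<dots> = (\<Prod>j\<in>{2..d}. w j ^ b j)"
    by (rule prod.cong) (use x_nonzero in \<open>auto simp: v_def power_divide\<close>)
  finally have "(\<Prod>j\<in>{2..d}. v j ^ b j) * x ^ tdeg b = (\<Prod>j\<in>{2..d}. w j ^ b j)" .
  then show ?thesis by (simp add: mon_split v_def mult.assoc)
qed

lemma mon_v_shift:
  assumes "tdeg b \<le> b 1 + k"
  shows "x ^ k * mon T v b = mon T w (b(1 := b 1 + k - tdeg b))"
proof -
  have "(x ^ k * mon T v b) * x ^ tdeg b = x ^ (b 1 + k) * (\<Prod>j\<in>{2..d}. w j ^ b j)"
    using mon_v[of b] by (simp add: power_add mult_ac)
  also have "x ^ (b 1 + k) = x ^ (b 1 + k - tdeg b) * x ^ tdeg b"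
    using assms by (simp flip: power_add)
  finally have "x ^ k * mon T v b = x ^ (b 1 + k - tdeg b) * (\<Prod>j\<in>{2..d}. w j ^ b j)"
    using x_nonzero by (simp add: mult_ac)
  also have "(\<Prod>j\<in>{2..d}. w j ^ b j) = (\<Prod>j\<in>{2..d}. w j ^ (b(1 := b 1 + k - tdeg b)) j)"
    by (rule prod.cong) auto
  finally show ?thesis by (simp add: mon_split[of w])
qed

lemma tdeg_add: "tdeg (\<lambda>i. a i + b i) = tdeg a + tdeg b"
  by (simp add: tdeg_def sum.distrib)

lemma tdeg_mono: "(\<And>j. j \<in> {2..d} \<Longrightarrow> a j \<le> b j) \<Longrightarrow> tdeg a \<le> tdeg b"
  unfolding tdeg_def by (rule sum_mono) auto

text \<open>
  Membership over \<open>A\<close> is tested after multiplication by a high power of \<open>x\<close>, which turns all monomials in \<open>v\<close> into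
  monomials in \<open>w\<close>.  Divisibility of these leaves the two inequalities stated here, because the
  exponent of \<open>x\<close> becomes \<open>b 1 + k - tdeg b\<close>.
\<close>
lemma mon_v_in_A_span:
  assumes "mon T v a \<in> lin_span A (mon T v ` S)"
  shows "\<exists>b\<in>S. (\<forall>j\<in>{2..d}. b j \<le> a j) \<and> b 1 + tdeg a \<le> a 1 + tdeg b"
proof -
  \<comment> \<open>Exponents in \<open>w\<close> of the monomial \<open>x ^ k * mon T v b\<close>; the subtraction is exact in the cases used.\<close>
  define sh where "sh = (\<lambda>k b. b(1 := b 1 + k - tdeg b))"
  have shift: "x ^ k * mon T v b = mon T w (sh k b)" if "tdeg b \<le> b 1 + k" for k b
    using mon_v_shift[OF that] by (simp add: sh_def)
  have "\<exists>K. \<forall>k\<ge>K. x ^ k * z \<in> lin_span A (mon T w ` {sh k b |b. b \<in> S \<and> tdeg b \<le> b 1 + k})"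
    if "z \<in> lin_span A (mon T v ` S)" for z
    using that
  proof induction
    case zero
    then show ?case by (auto intro: lin_span.zero)
  next
    case (step z a s)
    then obtain K b where K: "\<And>k. k \<ge> K \<Longrightarrow> x ^ k * z \<in> lin_span A (mon T w ` {sh k b |b. b \<in> S \<and> tdeg b \<le> b 1 + k})"
      and b: "b \<in> S" "s = mon T v b" by blast
    show ?case
    proof (intro exI[of _ "K + tdeg b"] allI impI)
      fix k assume k: "K + tdeg b \<le> k"
      have "a * mon T w (sh k b) + x ^ k * z \<in> lin_span A (mon T w ` {sh k b |b. b \<in> S \<and> tdeg b \<le> b 1 + k})"
      proof (rule lin_span.step)
        show "mon T w (sh k b) \<in> mon T w ` {sh k b |b. b \<in> S \<and> tdeg b \<le> b 1 + k}"
          using b(1) k by (intro imageI CollectI exI[of _ b]) simp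
      qed (use k K[of k] step.hyps in simp_all)
      moreover have "x ^ k * (a * s + z) = a * (x ^ k * mon T v b) + x ^ k * z"
        by (simp add: b(2) algebra_simps)
      ultimately show "x ^ k * (a * s + z) \<in> lin_span A (mon T w ` {sh k b |b. b \<in> S \<and> tdeg b \<le> b 1 + k})"
        using shift[of b k] k by simp
    qed
  qed
  then obtain K where K: "\<And>k. k \<ge> K \<Longrightarrow> x ^ k * mon T v a \<in> lin_span A (mon T w ` {sh k b |b. b \<in> S \<and> tdeg b \<le> b 1 + k})"
    using assms by blast
  define k where "k = K + tdeg a"
  have "mon T w (sh k a) \<in> lin_span A (mon T w ` {sh k b |b. b \<in> S \<and> tdeg b \<le> b 1 + k})"
    using K[of k] shift[of a k] by (simp add: k_def)
  then obtain b where b: "b \<in> S" "tdeg b \<le> b 1 + k" "mle T (sh k b) (sh k a)"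
    using mon_in_span by blast
  have "b 1 + k - tdeg b \<le> a 1 + k - tdeg a"
    using b(3) d_pos unfolding mle_def sh_def by (auto dest!: bspec[of _ _ 1])
  then have "b 1 + tdeg a \<le> a 1 + tdeg b" using b(2) by (simp add: k_def)
  moreover have "b j \<le> a j" if "j \<in> {2..d}" for j
    using b(3)[unfolded mle_def, rule_format, of j] that by (simp add: sh_def)
  ultimately show ?thesis using b(1) by blast
qed

text \<open>
  The affine chart \<open>R[\<mm>/x]\<close>: its elements are the linear combinations over \<open>R\<close> of the monomials in \<open>u 2, \<dots>, u d\<close>.
\<close>
definition B :: "'k set" where "B = lin_span A (mon T v ` {b. b 1 = 0})"

lemma mon_v_B: "b 1 = 0 \<Longrightarrow> mon T v b \<in> B"
  unfolding B_def by (intro lin_span_incl) auto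

lemma A_sub_B: "A \<subseteq> B"
proof
  fix a assume "a \<in> A"
  then have "a * mon T v (\<lambda>_. 0) \<in> B" unfolding B_def by (intro lin_span_scale) auto
  then show "a \<in> B" by (simp add: mon_zero)
qed

lemma B_mult:
  assumes "a \<in> B" "b \<in> B" shows "a * b \<in> B"
  using assms unfolding B_def
proof (rule lin_span_times[rotated])
  fix s t assume "s \<in> mon T v ` {b. b 1 = 0}" "t \<in> mon T v ` {b. b 1 = 0}"
  then obtain p q where "s = mon T v p" "t = mon T v q" "p 1 = 0" "q 1 = 0" by blast
  then show "s * t \<in> lin_span A (mon T v ` {b. b 1 = 0})"
    using mon_v_B[of "\<lambda>i. p i + q i"] by (simp add: B_def mon_add)
qed

lemma comm_subring_B: "comm_subring B"
proof
  show "1 \<in> B" using A_sub_B by auto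
  show "a + b \<in> B" if "a \<in> B" "b \<in> B" for a b using that unfolding B_def by (rule lin_span_add)
  show "- a \<in> B" if "a \<in> B" for a using that unfolding B_def by (rule lin_span_neg)
qed (rule B_mult)

sublocale B: comm_subring B by (rule comm_subring_B)

lemma vB: "i \<in> T \<Longrightarrow> v i \<in> B"
proof (cases "i = 1")
  case True
  then show ?thesis using xA A_sub_B by (auto simp: v_def)
next
  case False
  assume "i \<in> T"
  then show ?thesis
    using mon_v_B[of "\<lambda>j. if j = i then 1 else 0"] mon_single[OF finT, of i v 1] False by simp
qed

lemma mon_vB: "mon T v a \<in> B"
  unfolding mon_def using vB by (intro B.prod_closed B.power_closed) auto

text \<open>
  The localization of \<open>B\<close> at this ideal is the quadratic transform \<open>R1\<close>.
\<close>
definition P :: "'k set" where "P = lin_span B (v ` T)"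

lemma P_ideal: "is_ideal B P" unfolding P_def using vB by (intro B.is_ideal_lin_span) auto

lemma wP: "i \<in> T \<Longrightarrow> w i \<in> P"
proof -
  assume i: "i \<in> T"
  have "w i = (if i = 1 then 1 else x) * v i" using x_nonzero by (auto simp: v_def)
  also have "\<dots> \<in> P" unfolding P_def using i xA A_sub_B by (intro lin_span_scale) auto
  finally show ?thesis .
qed

lemma max_sub_P: "lin_span A (w ` T) \<subseteq> P"
proof (rule lin_span_least)
  show "a * s \<in> P" if "a \<in> A" "s \<in> w ` T" for a s
    using that wP A_sub_B by (auto intro: is_idealD(4)[OF P_ideal])
qed (auto intro: is_idealD(2,3)[OF P_ideal])

text \<open>
  An element of the span over \<open>B\<close> is a combination over \<open>A\<close> of the products of the generators with monomials in
  \<open>u 2, \<dots>, u d\<close>, and \<open>mon_v_in_A_span\<close> applies to these products.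
\<close>
lemma mon_in_span_B:
  assumes "mon T v a \<in> lin_span B (mon T v ` S)" shows "\<exists>b\<in>S. mle T b a"
proof -
  let ?S = "{\<lambda>i. s i + c i |s c. s \<in> S \<and> c 1 = 0}"
  have "lin_span B (mon T v ` S) \<subseteq> lin_span A (mon T v ` ?S)"
  proof (rule lin_span_least)
    fix b s assume "b \<in> B" "s \<in> mon T v ` S"
    then have "b \<in> lin_span A (mon T v ` {b. b 1 = 0})" "s \<in> lin_span A {s}" and s: "s \<in> mon T v ` S"
      using lin_span_incl by (auto simp: B_def)
    from this(1,2) show "b * s \<in> lin_span A (mon T v ` ?S)"
    proof (rule lin_span_times[rotated])
      fix p q assume "p \<in> mon T v ` {b. b 1 = 0}" "q \<in> {s}"
      then obtain c e where ce: "p = mon T v c" "c 1 = 0" "q = mon T v e" "e \<in> S" using s by blast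
      then have "p * q = mon T v (\<lambda>i. e i + c i)" by (simp add: mon_add mult.commute)
      then show "p * q \<in> lin_span A (mon T v ` ?S)" using ce by (auto intro!: lin_span_incl)
    qed
  qed (auto intro: lin_span.zero lin_span_add)
  then obtain s c where sc: "s \<in> S" "c 1 = 0" "\<forall>j\<in>{2..d}. s j + c j \<le> a j"
    "s 1 + c 1 + tdeg a \<le> a 1 + tdeg (\<lambda>i. s i + c i)"
    using mon_v_in_A_span[of a ?S] assms by fastforce
  have "tdeg (\<lambda>i. s i + c i) \<le> tdeg a" using sc(3) by (intro tdeg_mono) auto
  then have "s 1 \<le> a 1" using sc(4) by simp
  moreover have "s j \<le> a j" if "j \<in> {2..d}" for j using sc(3) that by (meson add_leE)
  ultimately have "mle T s a" unfolding mle_def T_split by auto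
  then show ?thesis using sc(1) by blast
qed

definition unit_exp :: "nat \<Rightarrow> nat \<Rightarrow> nat" where "unit_exp i = (\<lambda>j. if j = i then 1 else 0)"

lemma mon_unit_exp: "i \<in> T \<Longrightarrow> mon T v (unit_exp i) = v i"
  unfolding unit_exp_def using mon_single[OF finT, of i v 1] by simp

lemma v_image: "v ` T = mon T v ` (unit_exp ` T)"
  using mon_unit_exp by (auto simp: image_image intro: rev_image_eqI)

lemma one_notin_P: "1 \<notin> P"
proof
  assume "1 \<in> P"
  then have "mon T v (\<lambda>_. 0) \<in> lin_span B (mon T v ` (unit_exp ` T))"
    by (simp only: P_def v_image mon_zero)
  then obtain i where "i \<in> T" "mle T (unit_exp i) (\<lambda>_. 0)" using mon_in_span_B by blast
  then show False by (auto simp: mle_def unit_exp_def split: if_splits)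
qed

lemma B_mod_P: "b \<in> B \<Longrightarrow> \<exists>r\<in>A. b - r \<in> P"
  unfolding B_def
proof (induction rule: lin_span.induct)
  case zero
  show ?case by (rule bexI[of _ 0]) (auto intro: is_idealD(2)[OF P_ideal])
next
  case (step z a s)
  then obtain r b where r: "r \<in> A" "z - r \<in> P" and b: "s = mon T v b" by blast
  show ?case
  proof (cases "\<exists>i\<in>T. b i \<noteq> 0")
    case False
    then have "s = 1" unfolding b by (subst mon_cong[of T b "\<lambda>_. 0"]) (auto simp: mon_zero)
    then show ?thesis using r step.hyps by (intro bexI[of _ "a + r"]) (auto simp: algebra_simps intro: add_closed)
  next
    case True
    then obtain i where i: "i \<in> T" "b i \<noteq> 0" by blast
    then have "mle T (unit_exp i) b" by (auto simp: mle_def unit_exp_def)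
    then have "s = v i * mon T v (\<lambda>j. b j - unit_exp i j)"
      unfolding b mon_unit_exp[OF i(1), symmetric] by (rule mon_diff)
    then have "a * s = (a * mon T v (\<lambda>j. b j - unit_exp i j)) * v i" by (simp add: mult_ac)
    also have "\<dots> \<in> P" unfolding P_def using i step.hyps A_sub_B mon_vB
      by (intro lin_span_scale B_mult) auto
    finally have "a * s + (z - r) \<in> P" using r(2) by (rule is_idealD(3)[OF P_ideal])
    then show ?thesis using r(1) by (intro bexI[of _ r]) (auto simp: algebra_simps)
  qed
qed

lemma unit_mod_P:
  assumes "c \<in> B" "c \<notin> P" shows "\<exists>r\<in>A. \<exists>s\<in>A. s * r = 1 \<and> c - r \<in> P"
proof -
  obtain r where r: "r \<in> A" "c - r \<in> P" using B_mod_P[OF assms(1)] by blast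
  have "r \<notin> lin_span A (w ` T)"
  proof
    assume "r \<in> lin_span A (w ` T)"
    then have "(c - r) + r \<in> P" using r(2) max_sub_P by (intro is_idealD(3)[OF P_ideal]) auto
    then show False using assms(2) by simp
  qed
  then show ?thesis using unit_or_in_max[OF r(1)] r by blast
qed

lemma P_complement_mult:
  assumes "b \<in> B" "b \<notin> P" "c \<in> B" "c \<notin> P" shows "b * c \<notin> P"
proof
  assume bc: "b * c \<in> P"
  obtain r s where r: "r \<in> A" "s \<in> A" "s * r = 1" "b - r \<in> P" using unit_mod_P assms by blast
  obtain r' s' where r': "r' \<in> A" "s' \<in> A" "s' * r' = 1" "c - r' \<in> P" using unit_mod_P assms by blast
  have "c * (b - r) \<in> P" using assms(3) r(4) by (rule is_idealD(4)[OF P_ideal])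
  moreover have "r * (c - r') \<in> P" using r(1) A_sub_B r'(4) by (intro is_idealD(4)[OF P_ideal]) auto
  ultimately have "b * c - c * (b - r) - r * (c - r') \<in> P" using bc by (intro B.ideal_diff[OF P_ideal])
  then have "(s * s') * (b * c - c * (b - r) - r * (c - r')) \<in> P"
    using r(2) r'(2) A_sub_B by (intro is_idealD(4)[OF P_ideal]) (auto intro: B_mult)
  moreover have "(s * s') * (b * c - c * (b - r) - r * (c - r')) = (s * r) * (s' * r')"
    by (simp add: algebra_simps)
  ultimately show False using r(3) r'(3) one_notin_P by simp
qed

definition R1 :: "'k set" where "R1 = {b / c |b c. b \<in> B \<and> c \<in> B \<and> c \<notin> P}"

lemma B_sub_R1: "B \<subseteq> R1"
proof
  fix b assume "b \<in> B"
  then show "b \<in> R1" unfolding R1_def using one_notin_P by (intro CollectI exI[of _ b] exI[of _ 1]) auto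
qed

lemma outside_P_nonzero: "c \<notin> P \<Longrightarrow> c \<noteq> 0"
  using is_idealD(2)[OF P_ideal] by auto

lemma comm_subring_R1: "comm_subring R1"
proof
  show "1 \<in> R1" using B_sub_R1 by auto
  show "- a \<in> R1" if a: "a \<in> R1" for a
  proof -
    obtain b c where "a = b / c" "b \<in> B" "c \<in> B" "c \<notin> P" using a unfolding R1_def by blast
    then show ?thesis unfolding R1_def
      by (intro CollectI exI[of _ "- b"] exI[of _ c]) (auto intro: B.neg_closed)
  qed
  fix a a' assume "a \<in> R1" "a' \<in> R1"
  then obtain b c b' c' where bc: "a = b / c" "b \<in> B" "c \<in> B" "c \<notin> P" "a' = b' / c'" "b' \<in> B" "c' \<in> B" "c' \<notin> P"
    unfolding R1_def by blast
  note nz = outside_P_nonzero[OF bc(4)] outside_P_nonzero[OF bc(8)]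
  have cc: "c * c' \<in> B" "c * c' \<notin> P" using bc B_mult P_complement_mult by auto
  have "a + a' = (b * c' + b' * c) / (c * c')" using bc nz by (simp add: field_simps)
  moreover have "b * c' + b' * c \<in> B" using bc by (intro B.add_closed B_mult)
  ultimately show "a + a' \<in> R1" unfolding R1_def using cc by blast
  have "a * a' = (b * b') / (c * c')" using bc by simp
  moreover have "b * b' \<in> B" using bc by (intro B_mult)
  ultimately show "a * a' \<in> R1" unfolding R1_def using cc by blast
qed

sublocale R1: comm_subring R1 by (rule comm_subring_R1)

lemma clear_denominators:
  assumes "S \<subseteq> B" "z \<in> lin_span R1 S" shows "\<exists>c\<in>B. c \<notin> P \<and> c * z \<in> lin_span B S"
  using assms(2)
proof induction
  case zero
  show ?case using one_notin_P by (intro bexI[of _ 1]) (auto intro: lin_span.zero)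
next
  case (step z a s)
  obtain c where c: "c \<in> B" "c \<notin> P" "c * z \<in> lin_span B S" using step.IH by blast
  obtain b e where be: "a = b / e" "b \<in> B" "e \<in> B" "e \<notin> P" using step.hyps(2) unfolding R1_def by blast
  have "(c * b) * s + e * (c * z) \<in> lin_span B S"
    by (rule lin_span_add[OF lin_span_scale[OF B_mult[OF c(1) be(2)] step.hyps(3)] B.lin_span_mult[OF c(3) be(3)]])
  moreover have "(c * e) * (a * s + z) = (c * b) * s + e * (c * z)"
    using outside_P_nonzero[OF be(4)] by (simp add: be(1) algebra_simps)
  ultimately show ?case using c be P_complement_mult B_mult by (intro bexI[of _ "c * e"]) auto
qed

text \<open>
  After clearing denominators, \<open>c * M a\<close> lies in the span over \<open>B\<close> for some \<open>c \<notin> P\<close>.  Such a \<open>c\<close> is a unit of \<open>A\<close> up to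
  an element of \<open>P\<close>, whose product with the monomial is a combination of proper multiples of it; these
  cannot divide the monomial in \<open>mon_in_span_B\<close>.
\<close>
lemma mon_in_span_R1:
  assumes "mon T v a \<in> lin_span R1 (mon T v ` S)" shows "\<exists>b\<in>S. mle T b a"
proof -
  obtain c where c: "c \<in> B" "c \<notin> P" "c * mon T v a \<in> lin_span B (mon T v ` S)"
    using clear_denominators[of "mon T v ` S" "mon T v a"] mon_vB assms by blast
  obtain r s where r: "r \<in> A" "s \<in> A" "s * r = 1" "c - r \<in> P" using unit_mod_P c by blast
  let ?S = "S \<union> (\<lambda>i j. a j + unit_exp i j) ` T"
  have "(c - r) * mon T v a \<in> lin_span B (mon T v ` ?S)"
  proof (rule B.lin_span_times)
    show "c - r \<in> lin_span B (v ` T)" using r(4) by (simp add: P_def)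
    show "mon T v a \<in> lin_span B {mon T v a}" by (intro B.lin_span_incl) auto
    fix p q assume "p \<in> v ` T" "q \<in> {mon T v a}"
    then obtain i where i: "i \<in> T" "p = v i" "q = mon T v a" by blast
    then have "p * q = mon T v (\<lambda>j. a j + unit_exp i j)"
      by (simp add: mon_add mon_unit_exp mult.commute)
    then show "p * q \<in> lin_span B (mon T v ` ?S)" using i(1) by (auto intro!: B.lin_span_incl)
  qed
  moreover have "c * mon T v a \<in> lin_span B (mon T v ` ?S)"
    using c(3) lin_span_mono[of B B "mon T v ` S" "mon T v ` ?S"] by blast
  ultimately have "c * mon T v a - (c - r) * mon T v a \<in> lin_span B (mon T v ` ?S)"
    by (rule B.lin_span_diff[rotated])
  then have "s * (c * mon T v a - (c - r) * mon T v a) \<in> lin_span B (mon T v ` ?S)"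
    by (rule B.lin_span_mult) (use r A_sub_B in blast)
  moreover have "s * (c * mon T v a - (c - r) * mon T v a) = (s * r) * mon T v a"
    by (simp add: algebra_simps)
  ultimately obtain b where b: "b \<in> ?S" "mle T b a" using r(3) mon_in_span_B[of a ?S] by auto
  moreover have "\<not> mle T (\<lambda>j. a j + unit_exp i j) a" if "i \<in> T" for i
    using that by (auto simp: mle_def unit_exp_def)
  ultimately show ?thesis by blast
qed

lemma monomial_ring_R1: "monomial_ring R1 T v"
proof
  show "finite T" by simp
  show "v i \<in> R1" if "i \<in> T" for i using vB[OF that] B_sub_R1 by blast
  show "\<exists>b\<in>S. mle T b a" if "mon T v a \<in> lin_span R1 (mon T v ` S)" for a S
    using that by (rule mon_in_span_R1)
  fix z assume "z \<in> R1"
  then obtain b c where bc: "z = b / c" "b \<in> B" "c \<in> B" "c \<notin> P" unfolding R1_def by blast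
  show "z \<in> lin_span R1 (v ` T) \<or> (\<exists>c\<in>R1. c * z = 1)"
  proof (cases "b \<in> P")
    case True
    have "P \<subseteq> lin_span R1 (v ` T)" unfolding P_def using B_sub_R1 by (intro lin_span_mono) auto
    moreover have "1 / c \<in> R1" unfolding R1_def
      using bc by (intro CollectI exI[of _ 1] exI[of _ c]) simp
    ultimately have "(1 / c) * b \<in> lin_span R1 (v ` T)"
      using True by (intro R1.lin_span_mult) auto
    then show ?thesis using bc by simp
  next
    case False
    have "c / b \<in> R1" using bc False unfolding R1_def by blast
    moreover have "(c / b) * z = 1" using bc False outside_P_nonzero by (auto simp: field_simps)
    ultimately show ?thesis by blast
  qed
qed

sublocale N: monomial_ring R1 T v by (rule monomial_ring_R1)

end

text \<open>
  Equality of integral closures is equality of all extensions to valuation rings.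
\<close>
lemma int_closure_eqI:
  fixes A :: "'k::field set"
  assumes "comm_subring A" "is_ideal A I" "is_ideal A J"
    and "\<And>V. valuation_ring V \<Longrightarrow> A \<subseteq> V \<Longrightarrow> (\<forall>z\<in>I. vcov V J z) \<and> (\<forall>z\<in>J. vcov V I z)"
  shows "int_closure A I = int_closure A J"
proof -
  have "vcov V I z \<longleftrightarrow> vcov V J z" if "valuation_ring V" "A \<subseteq> V" for V z
    using valuation_ring.vcov_trans[OF that(1)] assms(4)[OF that] by blast
  then show ?thesis
    unfolding set_eq_iff valuative_criterion[OF assms(1,2)] valuative_criterion[OF assms(1,3)] by blast
qed

lemma int_closure_idem:
  fixes A :: "'k::field set"
  assumes A: "comm_subring A" and I: "is_ideal A I"
  shows "int_closure A (int_closure A I) = int_closure A I"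
proof (rule int_closure_eqI[OF A ideal_int_closure(1)[OF A I] I], intro conjI ballI)
  fix V z assume V: "valuation_ring V" "A \<subseteq> V"
  show "vcov V I z" if "z \<in> int_closure A I"
    using that V by (simp add: valuative_criterion[OF A I])
  show "vcov V (int_closure A I) z" if "z \<in> I"
    using that ideal_int_closure(2)[OF A I] valuation_ring.vcov_incl[OF V(1)] by blast
qed

section \<open>Products of complete inverse transforms\<close>

lemma (in valuation_ring) vdvd_least:
  assumes "finite F" "F \<noteq> {}" shows "\<exists>l\<in>F. \<forall>j\<in>F. vdvd V (f l) (f j)"
  using assms
proof (induction F rule: finite_ne_induct)
  case (insert a F)
  then obtain l where l: "l \<in> F" "\<forall>j\<in>F. vdvd V (f l) (f j)" by blast
  show ?case
  proof (cases "vdvd V (f a) (f l)")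
    case True
    then show ?thesis using l(2) vdvd_trans by (intro bexI[of _ a]) auto
  next
    case False
    then have "vdvd V (f l) (f a)" by (rule not_vdvd_imp_vdvd)
    then show ?thesis using l by (intro bexI[of _ l]) auto
  qed
qed auto

lemma (in valuation_ring) vdvd_prod:
  "(\<And>i. i \<in> F \<Longrightarrow> vdvd V (f i) (g i)) \<Longrightarrow> vdvd V (prod f F) (prod g F)"
  by (induction F rule: infinite_finite_induct) (auto intro: vdvd_mult)

lemma (in valuation_ring) vdvd_power_le: "a \<in> V \<Longrightarrow> k \<le> l \<Longrightarrow> vdvd V (a ^ k) (a ^ l)"
  using power_closed[of a "l - k"] by (auto simp: vdvd_def simp flip: power_add intro!: bexI[of _ "a ^ (l - k)"])

definition ideal_times :: "'a::comm_ring_1 set \<Rightarrow> 'a set \<Rightarrow> 'a set \<Rightarrow> 'a set" where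
  "ideal_times A I J = lin_span A {a * b |a b. a \<in> I \<and> b \<in> J}"

lemma (in comm_subring) is_ideal_times:
  "I \<subseteq> A \<Longrightarrow> J \<subseteq> A \<Longrightarrow> is_ideal A (ideal_times A I J)"
  unfolding ideal_times_def by (intro is_ideal_lin_span) (auto intro: mult_closed)

lemma vcov_ideal_times:
  assumes V: "valuation_ring V" "A \<subseteq> V" and ne: "I \<noteq> {}" "J \<noteq> {}"
    and IS: "\<And>a. a \<in> I \<Longrightarrow> vcov V S a" and JT: "\<And>b. b \<in> J \<Longrightarrow> vcov V T b"
    and z: "z \<in> ideal_times A I J"
  shows "vcov V {s * t |s t. s \<in> S \<and> t \<in> T} z"
proof -
  interpret V: valuation_ring V by (rule V)
  have "vcov V {a * b |a b. a \<in> I \<and> b \<in> J} z"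
    using z ne unfolding ideal_times_def by (intro V.vcov_span[OF V(2)]) auto
  then show ?thesis
  proof (rule V.vcov_trans)
    fix t assume "t \<in> {a * b |a b. a \<in> I \<and> b \<in> J}"
    then show "vcov V {s * t |s t. s \<in> S \<and> t \<in> T} t" using IS JT by (auto intro: V.vcov_mult)
  qed
qed

definition single :: "nat \<Rightarrow> nat \<Rightarrow> nat \<Rightarrow> nat" where "single j n = (\<lambda>i. if i = j then n else 0)"

context monomial_ring
begin

lemma M_single: "j \<in> T \<Longrightarrow> M (single j n) = w j ^ n"
  unfolding single_def using finT by (simp add: mon_single)

lemma ideal_power_mono:
  assumes "is_ideal A I" "j \<in> T" "w j ^ k \<in> I" "k \<le> l" shows "w j ^ l \<in> I"
proof -
  have "mle T (single j k) (single j l)" using assms(4) by (auto simp: mle_def single_def)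
  moreover have "M (single j k) \<in> I" using assms(3) M_single[OF assms(2), of k] by simp
  ultimately have "M (single j l) \<in> I" by (rule M_in_ideal_mono[OF assms(1), rotated])
  then show ?thesis by (simp add: M_single[OF assms(2)])
qed

lemma min_expsD: "a \<in> min_exps I \<Longrightarrow> M a \<in> I"
  "a \<in> min_exps I \<Longrightarrow> M b \<in> I \<Longrightarrow> mle T b a \<Longrightarrow> mle T a b"
  by (auto simp: min_exps_def)

lemma mem_min_exps:
  assumes "M b \<in> M ` min_exps I" shows "b \<in> min_exps I"
proof -
  obtain a where a: "a \<in> min_exps I" "M b = M a" using assms by blast
  have le: "mle T a b" "mle T b a"
    by (rule M_le_of_eq[OF a(2)], rule M_le_of_eq[OF a(2)[symmetric]])
  have "mle T b c" if c: "M c \<in> I" "mle T c b" for c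
    using le(2) min_expsD(2)[OF a(1) c(1) mle_trans[OF c(2) le(2)]] by (rule mle_trans)
  then show ?thesis using min_expsD(1)[OF a(1)] a(2) by (simp add: min_exps_def)
qed

lemma single_min_exps:
  "j \<in> T \<Longrightarrow> w j ^ k \<in> M ` min_exps I \<Longrightarrow> single j k \<in> min_exps I"
  by (rule mem_min_exps) (simp add: M_single)

lemma pure_power_in_min:
  assumes I: "is_ideal A I" and min: "single j n \<in> min_exps I" and j: "j \<in> T"
    and a: "M a \<in> I" "\<And>l. l \<in> T \<Longrightarrow> l \<noteq> j \<Longrightarrow> a l = 0"
  shows "n \<le> a j"
proof (rule ccontr)
  assume "\<not> n \<le> a j"
  then have "mle T a (single j n)" using a(2) by (auto simp: mle_def single_def)
  then have "mle T (single j n) a" by (rule min_expsD(2)[OF min a(1)])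
  then show False using \<open>\<not> n \<le> a j\<close> j by (auto simp: mle_def single_def dest!: bspec[of _ _ j])
qed

lemma span_product_min_exps:
  assumes I: "I = lin_span A (M ` min_exps I)" and I': "I' = lin_span A (M ` min_exps I')"
  shows "ideal_times A I I' = lin_span A (M ` {\<lambda>i. a i + a' i |a a'. a \<in> min_exps I \<and> a' \<in> min_exps I'})"
    (is "_ = lin_span A (M ` ?S)")
proof
  show "ideal_times A I I' \<subseteq> lin_span A (M ` ?S)"
    unfolding ideal_times_def
  proof (rule lin_span_subset_span, clarify)
    fix a b assume "a \<in> I" "b \<in> I'"
    then have "a \<in> lin_span A (M ` min_exps I)" "b \<in> lin_span A (M ` min_exps I')" using I I' by auto
    then show "a * b \<in> lin_span A (M ` ?S)" by (rule M_span_times[rotated]) blast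
  qed
  show "lin_span A (M ` ?S) \<subseteq> ideal_times A I I'"
    unfolding ideal_times_def
  proof (intro lin_span_mono subsetI)
    fix s assume "s \<in> M ` ?S"
    then obtain a a' where "s = M a * M a'" "a \<in> min_exps I" "a' \<in> min_exps I'"
      by (auto simp: mon_add)
    moreover from this have "M a \<in> I" "M a' \<in> I'" by (blast intro: min_expsD)+
    ultimately show "s \<in> {a * b |a b. a \<in> I \<and> b \<in> I'}" by blast
  qed simp
qed

lemma nfold_pure:
  assumes "c \<in> nfold S i" "\<And>s. s \<in> S \<Longrightarrow> (\<forall>l\<in>T. l \<noteq> j \<longrightarrow> s l = 0) \<Longrightarrow> n \<le> s j"
    "\<forall>l\<in>T. l \<noteq> j \<longrightarrow> c l = 0"
  shows "i * n \<le> c j"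
  using assms(1,3)
proof (induction i arbitrary: c)
  case (Suc i)
  then obtain a b where "c = (\<lambda>i. a i + b i)" "a \<in> nfold S i" "b \<in> S" by auto
  then have "i * n \<le> a j" "n \<le> b j" using Suc assms(2)[of b] by auto
  then show ?case using \<open>c = _\<close> by simp
qed simp

text \<open>
  A power of \<open>w j\<close> that is integral over \<open>I I'\<close> has a power divisible by a product of the corresponding number of generators of \<open>I I'\<close>; these
  are powers of \<open>w j\<close> as well, so each of them has exponent at least \<open>n + n'\<close>.
\<close>
lemma single_min_exps_star:
  assumes I: "is_ideal A I" "single j n \<in> min_exps I" and I': "is_ideal A I'" "single j n' \<in> min_exps I'"
    and j: "j \<in> T"
  defines "S \<equiv> {\<lambda>i. a i + a' i |a a'. a \<in> min_exps I \<and> a' \<in> min_exps I'}"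
  shows "single j (n + n') \<in> min_exps (int_closure A (lin_span A (M ` S)))"
proof -
  have "(\<lambda>i. single j n i + single j n' i) \<in> S" using I(2) I'(2) unfolding S_def by blast
  moreover have "(\<lambda>i. single j n i + single j n' i) = single j (n + n')" by (auto simp: single_def)
  ultimately have "M (single j (n + n')) \<in> lin_span A (M ` S)" by (auto intro: lin_span_incl)
  then have mem: "M (single j (n + n')) \<in> int_closure A (lin_span A (M ` S))"
    using ideal_int_closure(2)[OF comm_subring_axioms is_ideal_M_span] by blast
  have "mle T (single j (n + n')) b"
    if b: "M b \<in> int_closure A (lin_span A (M ` S))" "mle T b (single j (n + n'))" for b
  proof -
    have pure_S: "n + n' \<le> s j" if s: "s \<in> S" "\<forall>l\<in>T. l \<noteq> j \<longrightarrow> s l = 0" for s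
    proof -
      obtain a a' where a: "s = (\<lambda>i. a i + a' i)" "a \<in> min_exps I" "a' \<in> min_exps I'"
        using s(1) unfolding S_def by blast
      have "n \<le> a j" using s(2) a(1) by (intro pure_power_in_min[OF I j min_expsD(1)[OF a(2)]]) auto
      moreover have "n' \<le> a' j" using s(2) a(1) by (intro pure_power_in_min[OF I' j min_expsD(1)[OF a(3)]]) auto
      ultimately show ?thesis using a(1) by simp
    qed
    obtain i c where c: "i \<ge> 1" "c \<in> nfold S i" "mle T c (\<lambda>l. i * b l)" using integral_monomial[OF b(1)] by blast
    have "c l = 0" if "l \<in> T" "l \<noteq> j" for l
    proof -
      have "b l = 0" using b(2) that by (auto simp: mle_def single_def)
      then show ?thesis using c(3) that by (auto simp: mle_def)
    qed
    then have "i * (n + n') \<le> c j" by (intro nfold_pure[OF c(2) pure_S]) auto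
    also have "c j \<le> i * b j" using c(3) j by (auto simp: mle_def)
    finally have "n + n' \<le> b j" using c(1) by simp
    then show ?thesis by (auto simp: mle_def single_def)
  qed
  then show ?thesis using mem by (auto simp: min_exps_def)
qed

text \<open>
  Used for \<open>A = R1\<close> and valuation rings above \<open>R[\<mm>/x]\<close>.  Such a ring contains the parameters of \<open>R1\<close> but may fail to
  contain \<open>R1\<close>, so that the valuative criterion over \<open>R1\<close> does not apply to it and the monomial form of integral
  dependence is used instead.
\<close>
lemma vcov_of_integral_monomial:
  assumes V: "valuation_ring V" "\<And>i. i \<in> T \<Longrightarrow> w i \<in> V"
    and a: "M a \<in> int_closure A (lin_span A (M ` S))"
  shows "\<exists>s\<in>S. vdvd V (M s) (M a)"
proof (rule ccontr)
  interpret V: valuation_ring V by (rule V)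
  assume no: "\<not> ?thesis"
  have MV: "M b \<in> V" for b unfolding mon_def using V(2) by (intro V.prod_closed V.power_closed)
  have strict: "\<not> vdvd V (M c) (M a ^ Suc k)" if "c \<in> nfold S (Suc k)" for c k
    using that
  proof (induction k arbitrary: c)
    case 0
    then show ?case using no by auto
  next
    case (Suc k)
    then obtain p q where pq: "c = (\<lambda>i. p i + q i)" "p \<in> nfold S (Suc k)" "q \<in> S"
      unfolding nfold.simps(2)[of S "Suc k"] by blast
    have "vdvd V (M a) (M q)" using no pq(3) by (blast intro: V.not_vdvd_imp_vdvd)
    then have "\<not> vdvd V (M p * M q) (M a ^ Suc k * M a)"
      using Suc.IH[OF pq(2)] M_nonzero by (intro V.not_vdvd_mult)
    then show ?case by (simp add: pq(1) mon_add mult_ac)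
  qed
  obtain i c where c: "i \<ge> 1" "c \<in> nfold S i" "mle T c (\<lambda>l. i * a l)" using integral_monomial[OF a] by blast
  have "vdvd V (M c) (M (\<lambda>l. i * a l))"
    using mon_diff[OF c(3), of w] MV unfolding vdvd_def by blast
  moreover obtain k where "i = Suc k" using c(1) by (cases i) auto
  ultimately show False using strict[of c k] c(2) unfolding mon_times by blast
qed

lemma is_ideal_max: "is_ideal A (lin_span A (w ` T))"
  using wA by (intro is_ideal_lin_span) auto

lemma max_power_vdvd:
  assumes V: "valuation_ring V" "A \<subseteq> V" and l: "\<And>j. j \<in> T \<Longrightarrow> vdvd V (w l) (w j)"
  shows "q \<in> ipow A (lin_span A (w ` T)) n \<Longrightarrow> vdvd V (w l ^ n) q"
proof (induction n arbitrary: q)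
  case 0
  then show ?case using V by (auto simp: vdvd_def)
next
  case (Suc n)
  interpret V: valuation_ring V by (rule V)
  have span: "a \<in> S \<Longrightarrow> vdvd V g a" if "S = lin_span A G" "\<And>s. s \<in> G \<Longrightarrow> vdvd V g s" for S G g a
  proof -
    have "S \<subseteq> {a. vdvd V g a}" unfolding that(1)
      using that(2) V(2) by (intro lin_span_least) (auto intro: V.vdvd_add V.vdvd_scale)
    then show "a \<in> S \<Longrightarrow> vdvd V g a" by blast
  qed
  have m: "vdvd V (w l) b" if "b \<in> lin_span A (w ` T)" for b using span[OF refl _ that] l by blast
  show ?case
  proof (rule span[OF ipow.simps(2) _ Suc.prems])
    fix s assume "s \<in> {a * b |a b. a \<in> ipow A (lin_span A (w ` T)) n \<and> b \<in> lin_span A (w ` T)}"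
    then obtain a b where "s = a * b" "vdvd V (w l ^ n) a" "vdvd V (w l) b" using m Suc.IH by blast
    then show "vdvd V (w l ^ Suc n) s" using V.vdvd_mult[of "w l ^ n" a "w l" b] by (simp add: mult.commute)
  qed
qed

lemma power_in_max_power: "l \<in> T \<Longrightarrow> w l ^ n \<in> ipow A (lin_span A (w ` T)) n"
proof (induction n)
  case (Suc n)
  then have "w l ^ n * w l \<in> ipow A (lin_span A (w ` T)) (Suc n)"
    unfolding ipow.simps(2) by (intro lin_span_incl) (auto intro: lin_span_incl)
  then show ?case by (simp add: mult.commute)
qed simp

end

context quadratic_chart
begin

definition cit_gens :: "nat \<Rightarrow> 'k set \<Rightarrow> 'k set" where
  "cit_gens e I = {x ^ e * \<alpha> |\<alpha>. \<alpha> \<in> N.M ` N.min_exps I} \<union> {w j ^ e |j. j \<in> {2..d}}"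

definition cit :: "nat \<Rightarrow> 'k set \<Rightarrow> 'k set" where
  "cit e I = int_closure A (lin_span A (cit_gens e I))"

lemma vdvd_mon_v:
  assumes V: "valuation_ring V" and vV: "\<And>i. i \<in> T \<Longrightarrow> v i \<in> V" and l: "\<And>j. j \<in> {2..d} \<Longrightarrow> vdvd V (v l) (v j)"
  shows "vdvd V (v l ^ tdeg a) (mon T v a)"
proof -
  interpret V: valuation_ring V by (rule V)
  have "vdvd V (\<Prod>j\<in>{2..d}. v l ^ a j) (\<Prod>j\<in>{2..d}. v j ^ a j)"
    using l by (intro V.vdvd_prod V.vdvd_power)
  moreover have "(\<Prod>j\<in>{2..d}. v l ^ a j) = v l ^ tdeg a" by (simp add: tdeg_def power_sum)
  moreover have "v 1 ^ a 1 \<in> V" using vV d_pos by (intro V.power_closed) auto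
  ultimately show ?thesis unfolding mon_split by (simp add: V.vdvd_scale)
qed

text \<open>
  With \<open>e\<close> the largest exponent \<open>n j\<close>, this bounds \<open>\<delta>\<close> by \<open>e\<close>.  If \<open>N.M a\<close> violates the bound, divide it by some \<open>v i\<close> with \<open>i \<ge> 2\<close> that occurs in it.  The
  quotient still has degree at least \<open>e\<close> in \<open>v 2, \<dots>, v d\<close>, hence in every valuation ring it is a multiple of
  \<open>v l ^ e \<in> I\<close>, where \<open>v l\<close> has the least value among these.  So the quotient is integral over \<open>I\<close>, against minimality.
\<close>
lemma tdeg_min_exps:
  assumes d: "2 \<le> d" and I: "is_ideal R1 I" and closed: "int_closure R1 I = I"
    and pow: "\<And>j. j \<in> {2..d} \<Longrightarrow> v j ^ e \<in> I" and a: "a \<in> N.min_exps I"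
  shows "tdeg a \<le> a 1 + e"
proof (rule ccontr)
  assume n: "\<not> tdeg a \<le> a 1 + e"
  then have "tdeg a \<noteq> 0" by simp
  then obtain i where i: "i \<in> {2..d}" "a i \<noteq> 0" unfolding tdeg_def by (meson sum.neutral)
  \<comment> \<open>The exponents of \<open>M a / v i\<close>.\<close>
  define a' where "a' = (\<lambda>j. a j - (if j = i then 1 else 0))"
  have "tdeg a = tdeg (\<lambda>j. a' j + (if j = i then 1 else 0))"
    unfolding tdeg_def using i by (intro sum.cong) (auto simp: a'_def)
  also have "\<dots> = tdeg a' + 1" unfolding tdeg_add using i by (simp add: tdeg_def)
  finally have ta': "e \<le> tdeg a'" using n by simp
  have "N.M a' \<in> int_closure R1 I"
    unfolding valuative_criterion[OF comm_subring_R1 I]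
  proof (intro conjI allI impI)
    show "N.M a' \<in> R1" by (rule N.M_closed)
    fix V assume V: "valuation_ring V" "R1 \<subseteq> V"
    interpret V: valuation_ring V by (rule V)
    have vV: "v i \<in> V" if "i \<in> T" for i using N.wA[OF that] V by blast
    obtain l where l: "l \<in> {2..d}" "\<And>j. j \<in> {2..d} \<Longrightarrow> vdvd V (v l) (v j)"
      using V.vdvd_least[of "{2..d}" v] d by auto
    have "vdvd V (v l ^ e) (v l ^ tdeg a')" using vV l ta' by (intro V.vdvd_power_le) auto
    then have "vdvd V (v l ^ e) (N.M a')" using vdvd_mon_v[OF V(1) vV l(2), of a'] V.vdvd_trans by blast
    then show "vcov V I (N.M a')" using pow[OF l(1)] unfolding vcov_def by blast
  qed
  moreover have "mle T a' a" by (auto simp: mle_def a'_def)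
  ultimately have "mle T a a'" using N.min_expsD(2)[OF a] closed by blast
  then have "a i \<le> a' i" using i by (auto simp: mle_def)
  then show False using i by (simp add: a'_def)
qed

lemma min_exps_first_bound:
  assumes I: "is_ideal R1 I" and pow: "x ^ K \<in> I" and a: "a \<in> N.min_exps I"
  shows "a 1 \<le> K"
proof (rule ccontr)
  assume n: "\<not> a 1 \<le> K"
  have 1: "1 \<in> T" using d_pos by simp
  have "N.M (single 1 K) \<in> I" using pow N.M_single[OF 1] by (simp add: v_def)
  moreover have "mle T (single 1 K) a" using n by (auto simp: mle_def single_def)
  ultimately have "mle T a (single 1 K)" by (rule N.min_expsD(2)[OF a])
  then show False using n 1 by (auto simp: mle_def single_def dest!: bspec[of _ _ 1])
qed

lemma cit_gens_closed:
  assumes "\<And>a. a \<in> N.min_exps I \<Longrightarrow> tdeg a \<le> a 1 + e" shows "cit_gens e I \<subseteq> A"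
proof
  fix g assume "g \<in> cit_gens e I"
  then consider a where "g = x ^ e * mon T v a" "a \<in> N.min_exps I" | j where "j \<in> {2..d}" "g = w j ^ e"
    unfolding cit_gens_def by blast
  then show "g \<in> A"
  proof cases
    case 1
    then show ?thesis using mon_v_shift[OF assms] M_closed by simp
  next
    case 2
    then show ?thesis using wA by (auto intro: power_closed)
  qed
qed

text \<open>
  If \<open>x\<close> has the least value, the generators \<open>y j ^ e\<close> are redundant in \<open>V\<close>.
\<close>
lemma cit_gens_vdvd_x:
  assumes V: "valuation_ring V" and xmin: "\<And>j. j \<in> T \<Longrightarrow> vdvd V x (w j)" and AV: "A \<subseteq> V"
    and n: "\<And>j. j \<in> {2..d} \<Longrightarrow> single j (n j) \<in> N.min_exps I \<and> n j \<le> e" and g: "g \<in> cit_gens e I"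
  shows "\<exists>a\<in>N.min_exps I. vdvd V (x ^ e * mon T v a) g"
proof -
  interpret V: valuation_ring V by (rule V)
  consider a where "g = x ^ e * mon T v a" "a \<in> N.min_exps I" | j where "j \<in> {2..d}" "g = w j ^ e"
    using g unfolding cit_gens_def by blast
  then show ?thesis
  proof cases
    case 1
    then show ?thesis by (intro bexI[of _ a]) auto
  next
    case 2
    have jT: "j \<in> T" and j1: "j \<noteq> 1" using 2(1) by auto
    have vj: "w j = x * v j" using x_nonzero j1 by (simp add: v_def)
    have "vdvd V (x * 1) (x * v j)" using xmin[OF jT] vj by simp
    then have "vdvd V 1 (v j)" using V.vdvd_cancel[OF x_nonzero] by blast
    then have "v j \<in> V" by (auto simp: vdvd_def)
    then have "vdvd V (v j ^ n j) (v j ^ e)" using n[OF 2(1)] by (intro V.vdvd_power_le) auto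
    then have "vdvd V (x ^ e * mon T v (single j (n j))) g"
      unfolding 2(2) vj power_mult_distrib N.M_single[OF jT] by (intro V.vdvd_mult) auto
    then show ?thesis using n[OF 2(1)] by blast
  qed
qed

text \<open>
  All generators are monomials of degree at least \<open>e\<close> in the parameters \<open>w\<close>.
\<close>
lemma cit_gens_vdvd_y:
  assumes V: "valuation_ring V" "A \<subseteq> V" and l: "l \<in> T" and lmin: "\<And>j. j \<in> T \<Longrightarrow> vdvd V (w l) (w j)"
    and e: "\<And>a. a \<in> N.min_exps I \<Longrightarrow> tdeg a \<le> a 1 + e" and g: "g \<in> cit_gens e I"
  shows "vdvd V (w l ^ e) g"
proof -
  interpret V: valuation_ring V by (rule V)
  consider a where "g = x ^ e * mon T v a" "a \<in> N.min_exps I" | j where "j \<in> {2..d}" "g = w j ^ e"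
    using g unfolding cit_gens_def by blast
  then show ?thesis
  proof cases
    case 1
    \<comment> \<open>The generator as a monomial in \<open>w\<close>; no truncation occurs in the exponent of \<open>x\<close>.\<close>
    define b where "b = a(1 := a 1 + e - tdeg a)"
    have g: "g = mon T w b" using mon_v_shift[OF e[OF 1(2)]] 1(1) by (simp add: b_def)
    have "sum b T = b 1 + tdeg b" unfolding T_split tdeg_def by (subst sum.insert) auto
    also have "tdeg b = tdeg a" unfolding tdeg_def by (rule sum.cong) (auto simp: b_def)
    finally have "e \<le> sum b T" using e[OF 1(2)] by (simp add: b_def)
    then have "vdvd V (w l ^ e) (w l ^ sum b T)" using wA[OF l] V(2) by (intro V.vdvd_power_le) auto
    moreover have "vdvd V (\<Prod>j\<in>T. w l ^ b j) (\<Prod>j\<in>T. w j ^ b j)"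
      using lmin by (intro V.vdvd_prod V.vdvd_power)
    ultimately show ?thesis unfolding g mon_def power_sum by (rule V.vdvd_trans)
  next
    case 2
    then show ?thesis using lmin by (auto intro: V.vdvd_power)
  qed
qed

text \<open>
  The comparison of both sides in a valuation ring, according to the parameter \<open>w l\<close> of least value.  The
  further conclusions say that \<open>H\<close>, which is \<open>I * I'\<close>, satisfies the same hypotheses as \<open>I\<close> and \<open>I'\<close>, with
  exponents \<open>n j + n' j\<close>.
\<close>
theorem cit_star_product:
  fixes I I' :: "'k set" and n n' :: "nat \<Rightarrow> nat"
  assumes d: "2 \<le> d"
    and I: "I = lin_span R1 (N.M ` S0)" and I': "I' = lin_span R1 (N.M ` S0')"
    and closed: "int_closure R1 I = I" "int_closure R1 I' = I'"
    and n_ball: "\<forall>j\<in>{2..d}. single j (n j) \<in> N.min_exps I \<and> n j \<le> e"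
    and n'_ball: "\<forall>j\<in>{2..d}. single j (n' j) \<in> N.min_exps I' \<and> n' j \<le> e'"
    and e''_ball: "\<forall>j\<in>{2..d}. n j + n' j \<le> e''"
    and k: "k + e'' = e + e'"
    and x: "x ^ K \<in> I" "x ^ K' \<in> I'"
  defines "H \<equiv> int_closure R1 (ideal_times R1 I I')"
  shows "int_closure A (ideal_times A (cit e I) (cit e' I')) =
      int_closure A (ideal_times A (ipow A (lin_span A (w ` T)) k) (cit e'' H))"
    and "H = lin_span R1 (N.M ` {a. N.M a \<in> H})" and "is_ideal R1 H"
    and "int_closure R1 H = H" and "x ^ (K + K') \<in> H"
    and "\<And>j. j \<in> {2..d} \<Longrightarrow> single j (n j + n' j) \<in> N.min_exps H"
proof -
  note n = bspec[OF n_ball] and n' = bspec[OF n'_ball] and e'' = bspec[OF e''_ball]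
  define S where "S = {\<lambda>i. a i + a' i |a a'. a \<in> N.min_exps I \<and> a' \<in> N.min_exps I'}"
  have Ii: "is_ideal R1 I" "is_ideal R1 I'" unfolding I I' by (rule N.is_ideal_M_span)+
  have prod: "ideal_times R1 I I' = lin_span R1 (N.M ` S)"
    unfolding S_def using N.span_min_exps[OF I] N.span_min_exps[OF I'] by (rule N.span_product_min_exps)
  have H: "H = int_closure R1 (lin_span R1 (N.M ` S))" by (simp add: H_def prod)
  show Hi: "is_ideal R1 H" unfolding H by (rule ideal_int_closure(1)[OF comm_subring_R1 N.is_ideal_M_span])
  show closedH: "int_closure R1 H = H" unfolding H by (rule int_closure_idem[OF comm_subring_R1 N.is_ideal_M_span])
  have times_H: "a * b \<in> H" if "a \<in> I" "b \<in> I'" for a b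
  proof -
    have "a * b \<in> ideal_times R1 I I'" unfolding ideal_times_def using that by (intro R1.lin_span_incl) blast
    then show ?thesis unfolding H prod using ideal_int_closure(2)[OF comm_subring_R1 N.is_ideal_M_span] by blast
  qed
  show xH: "x ^ (K + K') \<in> H" using times_H[OF x] by (simp add: power_add)
  have minH: "single j (n j + n' j) \<in> N.min_exps H" if j: "j \<in> {2..d}" for j
    unfolding H S_def using n[OF j] n'[OF j] j by (intro N.single_min_exps_star Ii) auto
  then show "\<And>j. j \<in> {2..d} \<Longrightarrow> single j (n j + n' j) \<in> N.min_exps H" .
  have vjH: "v j ^ (n j + n' j) \<in> H" if j: "j \<in> {2..d}" for j
    using N.min_expsD(1)[OF minH[OF j]] N.M_single[of j] j by simp
  have "2 \<in> {2..d}" using d by simp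
  then have Sne: "S \<noteq> {}" using n[of 2] n'[of 2] unfolding S_def by blast
  \<comment> \<open>One exponent that works for all parameters at once.\<close>
  have pow: "v i ^ (K + K' + e'') \<in> H" if i: "i \<in> T" for i
  proof (cases "i = 1")
    case True
    then show ?thesis using N.ideal_power_mono[OF Hi i, of "K + K'"] xH by (simp add: v_def)
  next
    case False
    then have "i \<in> {2..d}" using i by simp
    then show ?thesis using N.ideal_power_mono[OF Hi i vjH] e''[of i] by simp
  qed
  show Hspan: "H = lin_span R1 (N.M ` {a. N.M a \<in> H})"
    using N.int_closure_monomial[OF Sne, of "K + K' + e''"] pow unfolding H by blast
  have vje: "v j ^ e \<in> I" "v j ^ e' \<in> I'" "v j ^ e'' \<in> H" if j: "j \<in> {2..d}" for j
  proof -
    have jT: "j \<in> T" using j by simp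
    show "v j ^ e \<in> I" "v j ^ e' \<in> I'"
      using N.ideal_power_mono[OF Ii(1) jT, of "n j" e] N.ideal_power_mono[OF Ii(2) jT, of "n' j" e']
        N.min_expsD(1)[of "single j (n j)" I] N.min_expsD(1)[of "single j (n' j)" I']
        n[OF j] n'[OF j] N.M_single[OF jT] by auto
    show "v j ^ e'' \<in> H" using N.ideal_power_mono[OF Hi jT vjH[OF j]] e''[OF j] by simp
  qed
  have deg: "a \<in> N.min_exps I \<Longrightarrow> tdeg a \<le> a 1 + e" "a \<in> N.min_exps I' \<Longrightarrow> tdeg a \<le> a 1 + e'"
    "a \<in> N.min_exps H \<Longrightarrow> tdeg a \<le> a 1 + e''" for a
    using tdeg_min_exps[OF d Ii(1) closed(1) vje(1)] tdeg_min_exps[OF d Ii(2) closed(2) vje(2)]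
      tdeg_min_exps[OF d Hi closedH vje(3)] by blast+
  have gensA: "cit_gens e I \<subseteq> A" "cit_gens e' I' \<subseteq> A" "cit_gens e'' H \<subseteq> A"
    using cit_gens_closed deg by blast+
  have spans: "is_ideal A (lin_span A (cit_gens e I))" "is_ideal A (lin_span A (cit_gens e' I'))"
    "is_ideal A (lin_span A (cit_gens e'' H))"
    using gensA is_ideal_lin_span by blast+
  have citA: "cit e I \<subseteq> A" "cit e' I' \<subseteq> A" "cit e'' H \<subseteq> A" unfolding cit_def by (rule int_closure_subset)+
  have gens_ne: "cit_gens f K \<noteq> {}" for f K using \<open>2 \<in> {2..d}\<close> unfolding cit_gens_def by blast
  let ?m = "lin_span A (w ` T)"
  have mA: "?m \<subseteq> A" using is_ideal_max by (auto dest: is_idealD)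
  have mk: "is_ideal A (ipow A ?m k)" by (rule is_ideal_ipow[OF mA])
  have cov_cit: "vcov V (cit_gens f K) a"
    if "valuation_ring V" "A \<subseteq> V" "is_ideal A (lin_span A (cit_gens f K))" "a \<in> cit f K" for V f K a
  proof -
    have "vcov V (lin_span A (cit_gens f K)) a"
      using that valuative_criterion[OF comm_subring_axioms that(3)] unfolding cit_def by blast
    then show ?thesis
      using valuation_ring.vcov_trans[OF that(1)] valuation_ring.vcov_span[OF that(1,2) gens_ne] by blast
  qed
  have cit_gens_in: "g \<in> cit f K" if "is_ideal A (lin_span A (cit_gens f K))" "g \<in> cit_gens f K" for g f K
    using that ideal_int_closure(2)[OF comm_subring_axioms that(1)] lin_span_incl unfolding cit_def by blast
  have cit_ne: "cit e I \<noteq> {}" "cit e' I' \<noteq> {}" "cit e'' H \<noteq> {}"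
    using cit_gens_in spans gens_ne by blast+
  have mk_ne: "ipow A ?m k \<noteq> {}" using is_idealD(2)[OF mk] by blast
  show "int_closure A (ideal_times A (cit e I) (cit e' I')) =
      int_closure A (ideal_times A (ipow A ?m k) (cit e'' H))"
  proof (rule int_closure_eqI[OF comm_subring_axioms])
    show "is_ideal A (ideal_times A (cit e I) (cit e' I'))" using citA by (intro is_ideal_times)
    show "is_ideal A (ideal_times A (ipow A ?m k) (cit e'' H))"
      using citA mk by (intro is_ideal_times) (auto dest: is_idealD)
    fix V assume V: "valuation_ring V" "A \<subseteq> V"
    interpret V: valuation_ring V by (rule V)
    have wV: "w i \<in> V" if "i \<in> T" for i using wA[OF that] V(2) by blast
    have inI: "g * h \<in> ideal_times A (cit e I) (cit e' I')" if "g \<in> cit_gens e I" "h \<in> cit_gens e' I'" for g h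
      unfolding ideal_times_def using that cit_gens_in spans by (intro lin_span_incl) blast
    have inH: "q * h \<in> ideal_times A (ipow A ?m k) (cit e'' H)" if "q \<in> ipow A ?m k" "h \<in> cit_gens e'' H" for q h
      unfolding ideal_times_def using that cit_gens_in spans by (intro lin_span_incl) blast
    have covI: "vcov V {g * h |g h. g \<in> cit_gens e I \<and> h \<in> cit_gens e' I'} z"
      if "z \<in> ideal_times A (cit e I) (cit e' I')" for z
      using vcov_ideal_times[OF V cit_ne(1,2) cov_cit[OF V spans(1)] cov_cit[OF V spans(2)] that] .
    have covH: "vcov V {q * h |q h. q \<in> ipow A ?m k \<and> h \<in> cit_gens e'' H} z"
      if "z \<in> ideal_times A (ipow A ?m k) (cit e'' H)" for z
      using vcov_ideal_times[OF V mk_ne cit_ne(3) V.vcov_incl cov_cit[OF V spans(3)] that] .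
    obtain l where l: "l \<in> T" "\<And>j. j \<in> T \<Longrightarrow> vdvd V (w l) (w j)"
      using V.vdvd_least[of T w] d_pos by auto
    have reduce: "(\<forall>z\<in>ideal_times A (cit e I) (cit e' I'). vcov V (ideal_times A (ipow A ?m k) (cit e'' H)) z) \<and>
        (\<forall>z\<in>ideal_times A (ipow A ?m k) (cit e'' H). vcov V (ideal_times A (cit e I) (cit e' I')) z)"
      if 1: "\<And>g h. g \<in> cit_gens e I \<Longrightarrow> h \<in> cit_gens e' I' \<Longrightarrow>
            \<exists>q\<in>ipow A ?m k. \<exists>h'\<in>cit_gens e'' H. vdvd V (q * h') (g * h)"
        and 2: "\<And>q h'. q \<in> ipow A ?m k \<Longrightarrow> h' \<in> cit_gens e'' H \<Longrightarrow>
            \<exists>g\<in>cit_gens e I. \<exists>h\<in>cit_gens e' I'. vdvd V (g * h) (q * h')"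
    proof (intro conjI ballI)
      fix z assume "z \<in> ideal_times A (cit e I) (cit e' I')"
      then show "vcov V (ideal_times A (ipow A ?m k) (cit e'' H)) z"
      proof (rule V.vcov_trans[OF covI])
        fix t assume "t \<in> {g * h |g h. g \<in> cit_gens e I \<and> h \<in> cit_gens e' I'}"
        then show "vcov V (ideal_times A (ipow A ?m k) (cit e'' H)) t"
          using 1 inH unfolding vcov_def by blast
      qed
    next
      fix z assume "z \<in> ideal_times A (ipow A ?m k) (cit e'' H)"
      then show "vcov V (ideal_times A (cit e I) (cit e' I')) z"
      proof (rule V.vcov_trans[OF covH])
        fix t assume "t \<in> {q * h |q h. q \<in> ipow A ?m k \<and> h \<in> cit_gens e'' H}"
        then show "vcov V (ideal_times A (cit e I) (cit e' I')) t"
          using 2 inI unfolding vcov_def by blast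
      qed
    qed
    show "(\<forall>z\<in>ideal_times A (cit e I) (cit e' I'). vcov V (ideal_times A (ipow A ?m k) (cit e'' H)) z) \<and>
        (\<forall>z\<in>ideal_times A (ipow A ?m k) (cit e'' H). vcov V (ideal_times A (cit e I) (cit e' I')) z)"
    proof (cases "l = 1")
      case True
      have xmin: "vdvd V x (w j)" if "j \<in> T" for j using l(2)[OF that] True by simp
      have vV: "v i \<in> V" if i: "i \<in> T" for i
      proof (cases "i = 1")
        case True
        then show ?thesis using wV[OF i] by (simp add: v_def)
      next
        case False
        then have "vdvd V (x * 1) (x * v i)" using xmin[OF i] x_nonzero by (simp add: v_def)
        then have "vdvd V 1 (v i)" using V.vdvd_cancel[OF x_nonzero] by blast
        then show ?thesis by (auto simp: vdvd_def)
      qed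
      have MV: "N.M a \<in> V" for a unfolding mon_def using vV by (intro V.prod_closed V.power_closed)
      have nH: "single j (n j + n' j) \<in> N.min_exps H \<and> n j + n' j \<le> e''" if "j \<in> {2..d}" for j
        using minH e'' that by blast
      show ?thesis
      proof (rule reduce)
        fix g h assume "g \<in> cit_gens e I" "h \<in> cit_gens e' I'"
        then obtain a a' where a: "a \<in> N.min_exps I" "vdvd V (x ^ e * N.M a) g"
          and a': "a' \<in> N.min_exps I'" "vdvd V (x ^ e' * N.M a') h"
          using cit_gens_vdvd_x[OF V(1) xmin V(2) n] cit_gens_vdvd_x[OF V(1) xmin V(2) n'] by blast
        have "N.M (\<lambda>i. a i + a' i) \<in> H"
          unfolding mon_add using a(1) a'(1) by (intro times_H N.min_expsD)
        then obtain b where b: "b \<in> N.min_exps H" "mle T b (\<lambda>i. a i + a' i)" using N.min_exps_below by blast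
        have "vdvd V (N.M b) (N.M (\<lambda>i. a i + a' i))"
          using mon_diff[OF b(2), of v] MV unfolding vdvd_def by blast
        then have "vdvd V (x ^ (k + e'') * N.M b) (x ^ (e + e') * N.M (\<lambda>i. a i + a' i))"
          unfolding k by (intro V.vdvd_mult) auto
        also have "x ^ (e + e') * N.M (\<lambda>i. a i + a' i) = (x ^ e * N.M a) * (x ^ e' * N.M a')"
          by (simp add: mon_add power_add mult_ac)
        also have "x ^ (k + e'') * N.M b = x ^ k * (x ^ e'' * N.M b)" by (simp add: power_add mult_ac)
        finally have "vdvd V (x ^ k * (x ^ e'' * N.M b)) (g * h)"
          using V.vdvd_mult[OF a(2) a'(2)] V.vdvd_trans by blast
        moreover have "x ^ k \<in> ipow A ?m k" using power_in_max_power[of 1] d_pos by simp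
        moreover have "x ^ e'' * N.M b \<in> cit_gens e'' H" using b(1) unfolding cit_gens_def by blast
        ultimately show "\<exists>q\<in>ipow A ?m k. \<exists>h'\<in>cit_gens e'' H. vdvd V (q * h') (g * h)" by blast
      next
        fix q h' assume q: "q \<in> ipow A ?m k" and "h' \<in> cit_gens e'' H"
        then obtain b where b: "b \<in> N.min_exps H" "vdvd V (x ^ e'' * N.M b) h'"
          using cit_gens_vdvd_x[OF V(1) xmin V(2) nH] by blast
        have "N.M b \<in> int_closure R1 (lin_span R1 (N.M ` S))" using N.min_expsD(1)[OF b(1)] by (simp add: H)
        then obtain s where s: "s \<in> S" "vdvd V (N.M s) (N.M b)"
          using N.vcov_of_integral_monomial[OF V(1) vV] by blast
        then obtain a a' where a: "a \<in> N.min_exps I" "a' \<in> N.min_exps I'" "s = (\<lambda>i. a i + a' i)"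
          unfolding S_def by blast
        have xq: "vdvd V (x ^ k) q" using max_power_vdvd[OF V l(2) q] True by simp
        have "vdvd V (x ^ k * (x ^ e'' * N.M s)) (x ^ k * (x ^ e'' * N.M b))"
          using s(2) by (intro V.vdvd_mult) auto
        also have "x ^ k * (x ^ e'' * N.M s) = x ^ (k + e'') * N.M s" by (simp add: power_add mult_ac)
        also have "\<dots> = (x ^ e * N.M a) * (x ^ e' * N.M a')"
          unfolding k a(3) by (simp add: mon_add power_add mult_ac)
        finally have "vdvd V ((x ^ e * N.M a) * (x ^ e' * N.M a')) (q * h')"
          using V.vdvd_mult[OF xq b(2)] V.vdvd_trans by blast
        moreover have "x ^ e * N.M a \<in> cit_gens e I" "x ^ e' * N.M a' \<in> cit_gens e' I'"
          using a(1,2) unfolding cit_gens_def by blast+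
        ultimately show "\<exists>g\<in>cit_gens e I. \<exists>h\<in>cit_gens e' I'. vdvd V (g * h) (q * h')" by blast
      qed
    next
      case False
      then have l2: "l \<in> {2..d}" using l(1) by simp
      have pow_gen: "w l ^ f \<in> cit_gens f K" for f K using l2 unfolding cit_gens_def by blast
      show ?thesis
      proof (rule reduce)
        fix g h assume "g \<in> cit_gens e I" "h \<in> cit_gens e' I'"
        then have "vdvd V (w l ^ e) g" "vdvd V (w l ^ e') h"
          using cit_gens_vdvd_y[OF V l deg(1)] cit_gens_vdvd_y[OF V l deg(2)] by blast+
        then have "vdvd V (w l ^ e * w l ^ e') (g * h)" by (rule V.vdvd_mult)
        then have "vdvd V (w l ^ k * w l ^ e'') (g * h)" by (simp flip: power_add add: k)
        then show "\<exists>q\<in>ipow A ?m k. \<exists>h'\<in>cit_gens e'' H. vdvd V (q * h') (g * h)"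
          using power_in_max_power[OF l(1)] pow_gen by blast
      next
        fix q h' assume "q \<in> ipow A ?m k" "h' \<in> cit_gens e'' H"
        then have "vdvd V (w l ^ k) q" "vdvd V (w l ^ e'') h'"
          using max_power_vdvd[OF V l(2)] cit_gens_vdvd_y[OF V l deg(3)] by blast+
        then have "vdvd V (w l ^ k * w l ^ e'') (q * h')" by (rule V.vdvd_mult)
        then have "vdvd V (w l ^ e * w l ^ e') (q * h')" by (simp flip: power_add add: k)
        then show "\<exists>g\<in>cit_gens e I. \<exists>h\<in>cit_gens e' I'. vdvd V (g * h) (q * h')"
          using pow_gen by blast
      qed
    qed
  qed
qed

end

section \<open>Passage to ring records\<close>

lemma ring_on_simps [simp]:
  "carrier (ring_on A) = A" "(\<otimes>\<^bsub>ring_on A\<^esub>) = (*)" "(\<oplus>\<^bsub>ring_on A\<^esub>) = (+)"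
  "\<one>\<^bsub>ring_on A\<^esub> = 1" "\<zero>\<^bsub>ring_on A\<^esub> = 0"
  by (auto simp: ring_on_def ring_of_type_algebra_def)

lemma field_ring_simps [simp]:
  "carrier field_ring = UNIV" "(\<otimes>\<^bsub>field_ring\<^esub>) = (*)" "(\<oplus>\<^bsub>field_ring\<^esub>) = (+)"
  "\<one>\<^bsub>field_ring\<^esub> = 1" "\<zero>\<^bsub>field_ring\<^esub> = 0"
  by (auto simp: ring_of_type_algebra_def)

lemma field_ring_neg: "\<ominus>\<^bsub>field_ring\<^esub> a = - (a :: 'k::field)"
proof -
  interpret F: cring "field_ring :: 'k ring" by rule
  show ?thesis using F.minus_equality[of "- a" a] by simp
qed

lemma comm_subring_of_subring:
  assumes "subring A (field_ring :: 'k::field ring)" shows "comm_subring A"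
proof -
  interpret F: cring "field_ring :: 'k ring" by rule
  show ?thesis
    using subringE[OF assms] by unfold_locales (auto simp: field_ring_neg)
qed

lemma cring_ring_on: assumes "comm_subring (A :: 'k::field set)" shows "cring (ring_on A)"
proof -
  interpret comm_subring A by (rule assms)
  show ?thesis
  proof (intro cringI abelian_groupI comm_monoidI)
    fix a assume "a \<in> carrier (ring_on A)"
    then show "\<exists>b\<in>carrier (ring_on A). b \<oplus>\<^bsub>ring_on A\<^esub> a = \<zero>\<^bsub>ring_on A\<^esub>"
      by (intro bexI[of _ "- a"]) (auto intro: neg_closed)
  qed (auto simp: algebra_simps intro: add_closed mult_closed)
qed

locale field_subring = comm_subring A for A :: "'k::field set"
begin

sublocale R: cring "ring_on A" by (rule cring_ring_on) (rule comm_subring_axioms)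

lemma ideal_iff: "ideal I (ring_on A) \<longleftrightarrow> is_ideal A I"
proof
  assume "ideal I (ring_on A)"
  then interpret I: ideal I "ring_on A" .
  show "is_ideal A I"
    unfolding is_ideal_def using I.a_subset I.zero_closed I.a_closed I.I_l_closed by auto
next
  assume I: "is_ideal A I"
  have right: "a * r \<in> I" if "a \<in> I" "r \<in> A" for a r
    using is_idealD(4)[OF I that(2,1)] by (simp add: mult.commute)
  show "ideal I (ring_on A)"
  proof (rule idealI[OF R.ring_axioms])
    show "subgroup I (add_monoid (ring_on A))"
    proof (rule R.add.subgroupI)
      show "I \<subseteq> carrier (ring_on A)" using is_idealD(1)[OF I] by auto
      show "I \<noteq> {}" using is_idealD(2)[OF I] by auto
      fix a assume a: "a \<in> I"
      then have "\<ominus>\<^bsub>ring_on A\<^esub> a = - a"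
        using R.minus_equality[of "- a" a] ideal_neg[OF I a] is_idealD(1)[OF I] by auto
      then show "\<ominus>\<^bsub>ring_on A\<^esub> a \<in> I" using ideal_neg[OF I a] by simp
    qed (auto intro: is_idealD(3)[OF I])
  qed (use is_idealD(4)[OF I] right in simp_all)
qed

lemma genideal_eq: assumes "S \<subseteq> A" shows "genideal (ring_on A) S = lin_span A S"
proof
  have "is_ideal A (lin_span A S)" using assms by (rule is_ideal_lin_span)
  then show "genideal (ring_on A) S \<subseteq> lin_span A S"
    unfolding genideal_def ideal_iff using lin_span_incl by blast
  show "lin_span A S \<subseteq> genideal (ring_on A) S"
    unfolding genideal_def ideal_iff using lin_span_subset_ideal by blast
qed

lemma ideal_prod_eq:
  assumes I: "is_ideal A I" and J: "is_ideal A J"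
  shows "ideal_prod (ring_on A) I J = ideal_times A I J"
proof
  show "ideal_prod (ring_on A) I J \<subseteq> ideal_times A I J"
  proof
    fix z assume "z \<in> ideal_prod (ring_on A) I J"
    then show "z \<in> ideal_times A I J"
      by induction (auto simp: ideal_times_def intro: lin_span_incl lin_span_add)
  qed
  have "is_ideal A (ideal_prod (ring_on A) I J)"
    using R.ideal_prod_is_ideal[of I J] I J by (simp add: ideal_iff)
  then show "ideal_times A I J \<subseteq> ideal_prod (ring_on A) I J"
    unfolding ideal_times_def using ideal_prod.prod[of _ I _ J "ring_on A"]
    by (intro lin_span_subset_ideal) auto
qed

lemma ideal_power_eq:
  assumes I: "is_ideal A I" shows "ideal_power (ring_on A) I n = ipow A I n"
proof (induction n)
  case 0
  then show ?case by (simp add: ideal_power_def nat_pow_def ideals_set_def)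
next
  case (Suc n)
  have IA: "I \<subseteq> A" using is_idealD(1)[OF I] by blast
  have "ideal_power (ring_on A) I (Suc n) = ideal_prod (ring_on A) (ideal_power (ring_on A) I n) I"
    by (simp add: ideal_power_def nat_pow_def ideals_set_def)
  then show ?case
    using Suc ideal_prod_eq[OF is_ideal_ipow[OF IA] I] by (simp add: ideal_times_def)
qed

lemma pow_eq: "a [^]\<^bsub>ring_on A\<^esub> (n::nat) = a ^ n"
  by (induction n) (auto simp: mult.commute)

lemma finsum_eq:
  assumes "finite F" "\<And>i. i \<in> F \<Longrightarrow> f i \<in> A" shows "finsum (ring_on A) f F = sum f F"
  using assms
proof (induction F rule: finite_induct)
  case (insert i F)
  then show ?case using R.finsum_insert[of F i f] by auto
qed simp

lemma integral_closure_eq: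
  assumes I: "is_ideal A I" shows "integral_closure (ring_on A) I = int_closure A I"
proof -
  have IA: "I \<subseteq> A" using is_idealD(1)[OF I] by blast
  have eq: "z [^]\<^bsub>ring_on A\<^esub> n \<oplus>\<^bsub>ring_on A\<^esub> (\<Oplus>\<^bsub>ring_on A\<^esub>i\<in>{1..n}. a i \<otimes>\<^bsub>ring_on A\<^esub> z [^]\<^bsub>ring_on A\<^esub> (n - i))
      = z ^ n + (\<Sum>i\<in>{1..n}. a i * z ^ (n - i))"
    if "z \<in> A" "\<forall>i\<in>{1..n}. a i \<in> ipow A I i" for z n a
  proof -
    have "a i \<in> A" if i: "i \<in> {1..n}" for i
      using is_idealD(1)[OF is_ideal_ipow[OF IA, of i], of "a i"] i \<open>\<forall>i\<in>{1..n}. a i \<in> ipow A I i\<close> by blast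
    then show ?thesis
      using that by (subst finsum_eq) (auto simp: pow_eq intro!: mult_closed power_closed)
  qed
  then show ?thesis
    unfolding integral_closure_def int_closure_def ideal_power_eq[OF I] ring_on_simps(1,5)
    by (intro Collect_cong conj_cong refl ex_cong1) (subst eq, assumption+, rule refl)
qed

lemma prime_in_of_primeideal: assumes "primeideal P (ring_on A)" shows "prime_in A P"
proof -
  interpret P: primeideal P "ring_on A" by (rule assms)
  have P: "is_ideal A P" using P.ideal_axioms by (simp add: ideal_iff)
  have "1 \<notin> P"
  proof
    assume "1 \<in> P"
    then have "A \<subseteq> P" using is_idealD(4)[OF P, of _ 1] by auto
    then show False using P.I_notcarr is_idealD(1)[OF P] by auto
  qed
  then show ?thesis using P P.I_prime by (auto simp: prime_in_def)
qed

lemma noetherian_subring_of_noetherian_ring: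
  assumes "noetherian_ring (ring_on A)" shows "noetherian_subring A"
proof
  interpret N: noetherian_ring "ring_on A" by (rule assms)
  fix F :: "'k set set" assume F: "F \<noteq> {}" "\<And>I. I \<in> F \<Longrightarrow> is_ideal A I"
  have "\<Union>C \<in> F" if C: "C \<noteq> {}" "subset.chain F C" for C
  proof -
    have "subset.chain {I. ideal I (ring_on A)} C"
      using C(2) F(2) unfolding subset.chain_def ideal_iff by blast
    then have "\<Union>C \<in> C" by (rule N.ideal_chain_is_trivial[OF C(1)])
    then show ?thesis using C(2) unfolding subset.chain_def by blast
  qed
  then show "\<exists>M\<in>F. \<forall>I\<in>F. M \<subseteq> I \<longrightarrow> I = M" by (rule subset_Zorn_nonempty[OF F(1)])
qed

text \<open>
  An element outside \<open>m\<close> is a unit because an ideal maximal among the proper ideals containing it would be a second maximal ideal.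
\<close>
lemma noetherian_local_subring_of_local_ring:
  assumes "noetherian_ring (ring_on A)" "local_ring (ring_on A) m" shows "noetherian_local_subring A m"
proof -
  interpret N: noetherian_subring A using noetherian_subring_of_noetherian_ring[OF assms(1)] .
  have max: "maximalideal m (ring_on A)" and only: "\<And>N. maximalideal N (ring_on A) \<Longrightarrow> N = m"
    using assms(2) by (auto simp: local_ring_def)
  interpret m: maximalideal m "ring_on A" by (rule max)
  show ?thesis
  proof
    show "prime_in A m"
      by (rule prime_in_of_primeideal) (rule R.maximalideal_prime[OF max])
    fix a assume a: "a \<in> A" "a \<notin> m"
    show "\<exists>b\<in>A. a * b = 1"
    proof (rule ccontr)
      assume no: "\<not> ?thesis"
      have "1 \<notin> lin_span A {a}"
      proof
        assume "1 \<in> lin_span A {a}"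
        moreover have "lin_span A {} \<subseteq> {0}" by (rule lin_span_least) auto
        ultimately obtain b where "b \<in> A" "1 - b * a = 0" using lin_span_insert[of 1 a "{}"] by blast
        then show False using no by (auto simp: mult.commute)
      qed
      moreover have "is_ideal A (lin_span A {a})" using a(1) by (intro is_ideal_lin_span) auto
      ultimately have mem: "lin_span A {a} \<in> {I. is_ideal A I \<and> 1 \<notin> I \<and> a \<in> I}" using lin_span_incl[of a "{a}"] by auto
      obtain N where N: "is_ideal A N" "1 \<notin> N" "a \<in> N"
        and Nmax: "\<And>I. is_ideal A I \<Longrightarrow> 1 \<notin> I \<Longrightarrow> a \<in> I \<Longrightarrow> N \<subseteq> I \<Longrightarrow> I = N"
        using N.obtain_maximal_ideal[OF mem, of thesis] by blast
      have "maximalideal N (ring_on A)"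
      proof (intro maximalidealI)
        show "ideal N (ring_on A)" using N(1) by (simp add: ideal_iff)
        show "carrier (ring_on A) \<noteq> N" using N(2) by auto
        fix J assume J: "ideal J (ring_on A)" "N \<subseteq> J" "J \<subseteq> carrier (ring_on A)"
        have Ji: "is_ideal A J" using J(1) by (simp add: ideal_iff)
        show "J = N \<or> J = carrier (ring_on A)"
        proof (cases "1 \<in> J")
          case True
          then have "A \<subseteq> J" using is_idealD(4)[OF Ji, of _ 1] by auto
          then show ?thesis using J(3) by auto
        next
          case False
          then show ?thesis using Nmax[OF Ji] J(2) N(3) by blast
        qed
      qed
      then show False using only a(2) N(3) by blast
    qed
  qed
qed

text \<open>
  The supremum is finite, so it is attained by a chain of length at least \<open>d\<close>; its last \<open>d\<close> steps form the required
  chain.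
\<close>
lemma chain_of_krull_dim:
  assumes "krull_dim (ring_on A) = enat d" "1 \<le> d" shows "\<exists>P. chain_above A d P"
proof -
  let ?L = "{enat n |n. \<exists>P. (\<forall>i\<le>n. primeideal (P i) (ring_on A)) \<and> (\<forall>i<n. P i \<subset> P (Suc i))}"
  have "\<not> Sup ?L \<le> enat (d - 1)" using assms by (simp add: krull_dim_def)
  then obtain l where l: "l \<in> ?L" "\<not> l \<le> enat (d - 1)" by (meson Sup_least)
  from l(1) obtain n P where lP: "l = enat n" "\<forall>i\<le>n. primeideal (P i) (ring_on A)"
    "\<forall>i<n. P i \<subset> P (Suc i)" by blast
  have n: "d \<le> n" using l(2) lP(1) by simp
  note P = lP(2)[rule_format] lP(3)[rule_format]
  have "chain_above A k (P (d - k))" if "k \<le> d" for k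
    using that
  proof (induction k)
    case 0
    then show ?case using P(1) n by (auto intro: prime_in_of_primeideal)
  next
    case (Suc k)
    have "P (d - Suc k) \<subset> P (Suc (d - Suc k))" using Suc.prems n by (intro P(2)) auto
    moreover have "Suc (d - Suc k) = d - k" using Suc.prems by simp
    ultimately show ?case using Suc P(1) n by (auto intro: prime_in_of_primeideal)
  qed
  then show ?thesis by blast
qed

end

lemma monomial_eq_mon: "1 \<le> d \<Longrightarrow> monomial d x v a = mon {1..d} (v(1 := x)) a"
proof -
  assume "1 \<le> d"
  then have split: "{1..d} = insert 1 {2..d}" by auto
  have "(\<Prod>j\<in>{2..d}. (v(1 := x)) j ^ a j) = (\<Prod>j\<in>{2..d}. v j ^ a j)" by (rule prod.cong) auto
  then show ?thesis unfolding monomial_def mon_def split by (subst prod.insert) auto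
qed

context quadratic_chart
begin

context
  fixes y :: "nat \<Rightarrow> 'k"
  assumes wy: "w = y(1 := x)"
begin

interpretation FA: field_subring A by unfold_locales
interpretation FB: field_subring B by unfold_locales
interpretation FR1: field_subring R1 by unfold_locales

lemma wy_j: "j \<in> {2..d} \<Longrightarrow> w j = y j"
  by (subst wy) auto

lemma params_image: "insert x (y ` {2..d}) = w ` T"
  using wy_j by (auto simp: T_split image_iff)

lemma v_eq: "v = (transform_param x y)(1 := x)"
proof
  fix i
  have "i \<noteq> 1 \<Longrightarrow> w i = y i" by (subst wy) simp
  then show "v i = ((transform_param x y)(1 := x)) i" by (simp add: v_def transform_param_def)
qed

lemma transform_image: "insert x (transform_param x y ` {2..d}) = v ` T"
  unfolding v_eq by (auto simp: T_split image_iff)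

lemma monomial_v: "monomial d x (transform_param x y) = N.M"
  using monomial_eq_mon[OF d_pos] by (auto simp: v_eq)

lemma param_ideal_A: "param_ideal A d x y = lin_span A (w ` T)"
  unfolding param_ideal_def params_image using wA by (intro FA.genideal_eq) auto

text \<open>
  The span \<open>B\<close> is a ring that contains \<open>A\<close> and the generators \<open>a / x\<close>, and conversely the monomials in
  \<open>u 2, \<dots>, u d\<close> are products of these generators.
\<close>
lemma blowup_chart_eq: "blowup_chart A d x y = B"
proof
  let ?G = "A \<union> {a / x |a. a \<in> param_ideal A d x y}"
  show "blowup_chart A d x y \<subseteq> B"
  proof
    have frac: "a / x \<in> B" if "a \<in> lin_span A (w ` T)" for a
    proof -
      have "lin_span A (w ` T) \<subseteq> {a. a / x \<in> B}"
      proof (rule lin_span_least)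
        show "a + b \<in> {a. a / x \<in> B}" if "a \<in> {a. a / x \<in> B}" "b \<in> {a. a / x \<in> B}" for a b
          using that by (auto simp: add_divide_distrib intro: B.add_closed)
        fix a s assume "a \<in> A" "s \<in> w ` T"
        then obtain i where i: "i \<in> T" "s = w i" by blast
        have "s / x = (if i = 1 then 1 else v i)" using x_nonzero i(2) by (auto simp: v_def)
        then have "s / x \<in> B" using vB[OF i(1)] by auto
        then have "a * (s / x) \<in> B" using \<open>a \<in> A\<close> A_sub_B by (intro B_mult) auto
        then show "a * s \<in> {a. a / x \<in> B}" by simp
      qed simp
      then show ?thesis using that by blast
    qed
    fix z assume "z \<in> blowup_chart A d x y"
    then have "z \<in> generate_ring field_ring ?G" by (simp add: blowup_chart_def)
    then show "z \<in> B"
      by induction (use frac A_sub_B in \<open>auto simp: param_ideal_A field_ring_neg intro: B.neg_closed B.add_closed B_mult\<close>)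
  qed
  have closed: "comm_subring (blowup_chart A d x y)"
  proof -
    interpret F: cring "field_ring :: 'k ring" by rule
    have "subring (blowup_chart A d x y) field_ring"
      unfolding blowup_chart_def by (rule F.generate_ring_is_subring) auto
    then show ?thesis by (rule comm_subring_of_subring)
  qed
  then interpret C: comm_subring "blowup_chart A d x y" .
  have incl: "?G \<subseteq> blowup_chart A d x y"
    unfolding blowup_chart_def by (auto intro: generate_ring.incl)
  show "B \<subseteq> blowup_chart A d x y"
    unfolding B_def
  proof (rule lin_span_least)
    fix a s assume a: "a \<in> A" and "s \<in> N.M ` {b. b 1 = 0}"
    then obtain b where b: "s = N.M b" "b 1 = 0" by blast
    have "v j \<in> blowup_chart A d x y" if "j \<in> {2..d}" for j
    proof -
      have "w j \<in> param_ideal A d x y" using that unfolding param_ideal_A by (intro lin_span_incl) auto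
      then have "w j / x \<in> blowup_chart A d x y" using incl by blast
      then show ?thesis using that by (simp add: v_def)
    qed
    then have "s \<in> blowup_chart A d x y"
      unfolding b(1) mon_split b(2) by (auto intro!: C.prod_closed C.power_closed)
    then show "a * s \<in> blowup_chart A d x y" using a incl by (intro C.mult_closed) auto
  qed (auto intro: C.add_closed)
qed

lemma quadratic_transform_eq: "quadratic_transform A d x y = R1"
proof -
  have "param_ideal B d x (transform_param x y) = P"
    unfolding param_ideal_def transform_image P_def using vB by (intro FB.genideal_eq) auto
  then show ?thesis unfolding quadratic_transform_def blowup_chart_eq Let_def R1_def by simp
qed

lemma Delta1_eq:
  assumes "I = lin_span R1 (N.M ` S)" shows "Delta1 A d x y I = N.M ` N.min_exps I"
proof -
  have gen: "genideal (ring_on R1) S = lin_span R1 S" if "S \<subseteq> range N.M" for S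
    using that N.M_closed by (intro FR1.genideal_eq) auto
  have "Delta1 A d x y I = \<Union>{S. S \<subseteq> range N.M \<and> lin_span R1 S = I \<and> (\<forall>S'. S' \<subset> S \<longrightarrow> lin_span R1 S' \<noteq> I)}"
    unfolding Delta1_def quadratic_transform_eq min_monomial_gens_def monomial_v
  proof (intro arg_cong[of _ _ Union] Collect_cong conj_cong refl)
    fix S assume S: "S \<subseteq> range N.M"
    then show "(genideal (ring_on R1) S = I) = (lin_span R1 S = I)" by (simp only: gen)
    have "genideal (ring_on R1) S' = lin_span R1 S'" if "S' \<subset> S" for S'
      using that S by (intro gen) blast
    then show "(\<forall>S'. S' \<subset> S \<longrightarrow> genideal (ring_on R1) S' \<noteq> I) = (\<forall>S'. S' \<subset> S \<longrightarrow> lin_span R1 S' \<noteq> I)"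
      by simp
  qed
  then show ?thesis unfolding N.union_irredundant_gens[OF assms] .
qed

text \<open>
  Two bounds make the maximum in the definition of \<open>\<delta>\<close> a maximum over a finite set: \<open>tdeg_min_exps\<close> from above, and from below
  the bound \<open>K\<close> on the exponent of \<open>x\<close> in a minimal monomial.  The maximum \<open>e\<close> is attained at a pure power
  of some \<open>u j\<close>.
\<close>
lemma CIT_eq:
  assumes d: "2 \<le> d" and I: "I = lin_span R1 (N.M ` S)" and closed: "int_closure R1 I = I"
    and n: "\<And>j. j \<in> {2..d} \<Longrightarrow> single j (n j) \<in> N.min_exps I" and K: "x ^ K \<in> I"
    and e: "e = Max (n ` {2..d})"
  shows "CIT A d x y I = cit e I"
proof -
  have Ii: "is_ideal R1 I" unfolding I by (rule N.is_ideal_M_span)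
  have ne: "n j \<le> e" if "j \<in> {2..d}" for j unfolding e using that by (intro Max_ge) auto
  have vje: "v j ^ e \<in> I" if j: "j \<in> {2..d}" for j
    using N.ideal_power_mono[OF Ii _ _ ne[OF j]] N.min_expsD(1)[OF n[OF j]] N.M_single[of j] j by simp
  have deg: "tdeg a \<le> a 1 + e" if "a \<in> N.min_exps I" for a
    by (rule tdeg_min_exps[OF d Ii closed vje that])
  have nu: "- nu_x d a = int (tdeg a) - int (a 1)" for a by (simp add: nu_x_def tdeg_def)
  let ?D = "{- nu_x d a |a. monomial d x (transform_param x y) a \<in> Delta1 A d x y I}"
  have min: "N.M a \<in> N.M ` N.min_exps I \<longleftrightarrow> a \<in> N.min_exps I" for a
    by (rule iffI, erule N.mem_min_exps, erule imageI)
  have D: "?D = {int (tdeg a) - int (a 1) |a. a \<in> N.min_exps I}"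
    unfolding nu monomial_v Delta1_eq[OF I] min by (rule refl)
  have bounds: "t \<le> int e" "- int K \<le> t" if t: "t \<in> ?D" for t
  proof -
    obtain a where a: "t = int (tdeg a) - int (a 1)" "a \<in> N.min_exps I" using t unfolding D by blast
    show "t \<le> int e" "- int K \<le> t" using deg[OF a(2)] min_exps_first_bound[OF Ii K a(2)] a(1) by simp_all
  qed
  have "?D \<subseteq> {- int K..int e}" using bounds by (intro subsetI) (simp only: atLeastAtMost_iff simp_thms)
  then have "finite ?D" by (rule finite_subset) simp
  moreover have "int e \<in> ?D"
  proof -
    have "Max (n ` {2..d}) \<in> n ` {2..d}" using d by (intro Max_in) auto
    then obtain j where j: "j \<in> {2..d}" "n j = e" unfolding e by auto
    have "tdeg (single j e) = e" using j(1) by (simp add: tdeg_def single_def)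
    moreover have "single j e 1 = 0" using j(1) by (simp add: single_def)
    ultimately have "int e = int (tdeg (single j e)) - int (single j e 1)" by simp
    then show ?thesis unfolding D using n[OF j(1)] j(2) by blast
  qed
  ultimately have delta: "cit_delta A d x y I = int e"
    unfolding cit_delta_def by (rule_tac Max_eqI) (assumption, rule bounds(1), assumption+)
  have gens: "{x ^ e * \<alpha> |\<alpha>. \<alpha> \<in> Delta1 A d x y I} \<union> {y j ^ e |j. j \<in> {2..d}} = cit_gens e I"
    unfolding Delta1_eq[OF I] cit_gens_def using wy_j by (auto 4 3)
  have gA: "cit_gens e I \<subseteq> A" by (rule cit_gens_closed[OF deg])
  show ?thesis
    unfolding CIT_def delta nat_int Let_def gens FA.genideal_eq[OF gA] cit_def
    by (rule FA.integral_closure_eq[OF is_ideal_lin_span[OF gA]])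
qed

lemma star_product_A:
  assumes "is_ideal A I" "is_ideal A J"
  shows "star_product (ring_on A) I J = int_closure A (ideal_times A I J)"
  using assms is_ideal_times[of I J]
  by (auto simp: star_product_def FA.ideal_prod_eq dest: is_idealD intro!: FA.integral_closure_eq)

lemma star_product_R1:
  assumes "is_ideal R1 I" "is_ideal R1 J"
  shows "star_product (ring_on R1) I J = int_closure R1 (ideal_times R1 I J)"
  using assms R1.is_ideal_times[of I J]
  by (auto simp: star_product_def FR1.ideal_prod_eq dest: is_idealD intro!: FR1.integral_closure_eq)

lemma monomial_ideal_span:
  assumes "monomial_ideal (ring_on R1) d x (transform_param x y) I"
  obtains S where "I = lin_span R1 (N.M ` S)"
proof -
  obtain G where G: "G \<subseteq> range N.M" "I = genideal (ring_on R1) G"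
    using assms unfolding monomial_ideal_def monomial_v by blast
  then obtain S where "G = N.M ` S" using subset_image_iff by metis
  moreover have "genideal (ring_on R1) G = lin_span R1 G"
    using G(1) N.M_closed by (intro FR1.genideal_eq) auto
  ultimately show ?thesis using G(2) that by blast
qed

lemma CIT_star_CIT:
  fixes I I' :: "'k set" and n n' :: "nat \<Rightarrow> nat"
  assumes d: "3 \<le> d"
    and I: "monomial_ideal (ring_on R1) d x (transform_param x y) I" "complete_ideal (ring_on R1) I"
    and I': "monomial_ideal (ring_on R1) d x (transform_param x y) I'" "complete_ideal (ring_on R1) I'"
    and K: "x ^ K \<in> I" "x ^ K' \<in> I'"
    and n: "\<And>j. j \<in> {2..d} \<Longrightarrow> v j ^ n j \<in> Delta1 A d x y I"
    and n': "\<And>j. j \<in> {2..d} \<Longrightarrow> v j ^ n' j \<in> Delta1 A d x y I'"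
  defines "k \<equiv> int (Max (n ` {2..d})) + int (Max (n' ` {2..d})) - int (Max ((\<lambda>j. n j + n' j) ` {2..d}))"
  shows "0 \<le> k \<and> star_product (ring_on A) (CIT A d x y I) (CIT A d x y I') =
    star_product (ring_on A) (ideal_power (ring_on A) (lin_span A (w ` T)) (nat k))
      (CIT A d x y (star_product (ring_on R1) I I'))"
proof -
  have d2: "2 \<le> d" using d by simp
  obtain S where S: "I = lin_span R1 (N.M ` S)" using monomial_ideal_span[OF I(1)] .
  obtain S' where S': "I' = lin_span R1 (N.M ` S')" using monomial_ideal_span[OF I'(1)] .
  have Ii: "is_ideal R1 I" "is_ideal R1 I'" unfolding S S' by (rule N.is_ideal_M_span)+
  have closed: "int_closure R1 I = I" "int_closure R1 I' = I'"
    using I(2) I'(2) FR1.integral_closure_eq Ii by (simp_all add: complete_ideal_def)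
  define e where "e = Max (n ` {2..d})"
  define e' where "e' = Max (n' ` {2..d})"
  define e'' where "e'' = Max ((\<lambda>j. n j + n' j) ` {2..d})"
  have ne: "n j \<le> e" "n' j \<le> e'" "n j + n' j \<le> e''" if "j \<in> {2..d}" for j
    unfolding e_def e'_def e''_def using that by (intro Max_ge; force)+
  have sn: "single j (n j) \<in> N.min_exps I" "single j (n' j) \<in> N.min_exps I'" if j: "j \<in> {2..d}" for j
    using n[OF j] n'[OF j] j unfolding Delta1_eq[OF S] Delta1_eq[OF S'] by (auto intro: N.single_min_exps)
  have "e'' \<in> (\<lambda>j. n j + n' j) ` {2..d}" unfolding e''_def using d by (intro Max_in) auto
  then have e''le: "e'' \<le> e + e'" using ne(1,2) by (auto intro: add_mono)
  have k: "k = int (e + e' - e'')" using e''le unfolding k_def e_def[symmetric] e'_def[symmetric] e''_def[symmetric] by simp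
  have keq: "nat k + e'' = e + e'" using e''le by (simp add: k)
  define H where "H = int_closure R1 (ideal_times R1 I I')"
  have sn1: "\<forall>j\<in>{2..d}. single j (n j) \<in> N.min_exps I \<and> n j \<le> e"
    "\<forall>j\<in>{2..d}. single j (n' j) \<in> N.min_exps I' \<and> n' j \<le> e'"
    "\<forall>j\<in>{2..d}. n j + n' j \<le> e''"
    using sn ne by auto
  note main = cit_star_product[OF d2 S S' closed sn1 keq K, folded H_def]
  have H: "star_product (ring_on R1) I I' = H" unfolding H_def by (rule star_product_R1[OF Ii])
  have C: "CIT A d x y I = cit e I" by (rule CIT_eq[OF d2 S closed(1) sn(1) K(1) e_def])
  have C': "CIT A d x y I' = cit e' I'" by (rule CIT_eq[OF d2 S' closed(2) sn(2) K(2) e'_def])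
  have CH: "CIT A d x y H = cit e'' H"
    by (rule CIT_eq[OF d2 main(2,4) main(6,5) e''_def])
  have citi: "is_ideal A (cit f J)" if "\<And>a. a \<in> N.min_exps J \<Longrightarrow> tdeg a \<le> a 1 + f" for f J
    unfolding cit_def using cit_gens_closed[OF that]
    by (intro ideal_int_closure comm_subring_axioms is_ideal_lin_span)
  have vj: "v j ^ e \<in> I" "v j ^ e' \<in> I'" "v j ^ e'' \<in> H" if j: "j \<in> {2..d}" for j
    using N.ideal_power_mono[OF Ii(1) _ _ ne(1)[OF j]] N.ideal_power_mono[OF Ii(2) _ _ ne(2)[OF j]]
      N.ideal_power_mono[OF main(3) _ _ ne(3)[OF j]] N.min_expsD(1)[OF sn(1)[OF j]]
      N.min_expsD(1)[OF sn(2)[OF j]] N.min_expsD(1)[OF main(6)[OF j]] N.M_single[of j] j by simp_all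
  have ideals: "is_ideal A (cit e I)" "is_ideal A (cit e' I')" "is_ideal A (cit e'' H)"
    using tdeg_min_exps[OF d2 Ii(1) closed(1) vj(1)] tdeg_min_exps[OF d2 Ii(2) closed(2) vj(2)]
      tdeg_min_exps[OF d2 main(3,4) vj(3)] by (auto intro!: citi)
  have m: "is_ideal A (lin_span A (w ` T))" by (rule is_ideal_max)
  then have mA: "lin_span A (w ` T) \<subseteq> A" by (auto dest: is_idealD)
  have "star_product (ring_on A) (cit e I) (cit e' I') =
      star_product (ring_on A) (ideal_power (ring_on A) (lin_span A (w ` T)) (nat k)) (cit e'' H)"
    unfolding FA.ideal_power_eq[OF m] star_product_A[OF ideals(1,2)]
      star_product_A[OF is_ideal_ipow[OF mA] ideals(3)] by (rule main(1))
  then show ?thesis unfolding H C C' CH using k by simp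
qed

end

end

theorem theorem4p16:
  fixes A :: "'k::field set" and d :: nat and x :: 'k and y :: "nat \<Rightarrow> 'k"
    and m I1 I1' :: "'k set" and n n' :: "nat \<Rightarrow> nat"
  defines "R \<equiv> ring_on A"
    and "u \<equiv> transform_param x y"
    and "R1 \<equiv> ring_on (quadratic_transform A d x y)"
    and "m1 \<equiv> param_ideal (quadratic_transform A d x y) d x (transform_param x y)"
    and "N \<equiv> int (Max (n ` {2..d})) + int (Max (n' ` {2..d})) - int (Max ((\<lambda>j. n j + n' j) ` {2..d}))"
  assumes "subring A field_ring"
    and "regular_local_ring R m" and "equicharacteristic R m"
    and "krull_dim R = enat d" and "d \<ge> 3"
    and "x \<in> A" and "\<forall>j\<in>{2..d}. y j \<in> A" and "m = param_ideal A d x y"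
    and "monomial_ideal R1 d x u I1" and "complete_ideal R1 I1" and "primary_to R1 m1 I1"
    and "monomial_ideal R1 d x u I1'" and "complete_ideal R1 I1'" and "primary_to R1 m1 I1'"
    and "\<forall>j\<in>{2..d}. u j ^ n j \<in> Delta1 A d x y I1"
    and "\<forall>j\<in>{2..d}. u j ^ n' j \<in> Delta1 A d x y I1'"
  shows "N \<ge> 0 \<and>
    star_product R (CIT A d x y I1) (CIT A d x y I1') =
    star_product R (ideal_power R m (nat N)) (CIT A d x y (star_product R1 I1 I1'))"
proof -
  note subring = assms(6) and regular = assms(7) and dim = assms(9) and d = assms(10)
    and xA = assms(11) and yA = assms(12) and m = assms(13)
  interpret FA: field_subring A
    unfolding field_subring_def by (rule comm_subring_of_subring[OF subring])
  define w where "w = y(1 := x)"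
  have d1: "1 \<le> d" using d by simp
  have w1: "w 1 = x" by (simp add: w_def)
  have wA: "w i \<in> A" if "i \<in> {1..d}" for i using that xA yA by (auto simp: w_def)
  have split: "{1..d} = insert 1 {2..d}" using d1 by auto
  have "insert x (y ` {2..d}) = w ` {1..d}" by (auto simp: split w_def)
  then have mspan: "m = lin_span A (w ` {1..d})"
    unfolding m param_ideal_def using wA by (subst FA.genideal_eq) auto
  interpret L: noetherian_local_subring A m
    using regular unfolding regular_local_ring_def R_def
    by (intro FA.noetherian_local_subring_of_local_ring) auto
  obtain P where chain: "chain_above A (card {1..d}) P"
    using FA.chain_of_krull_dim[OF dim[unfolded R_def] d1] by auto
  have zero: "prime_in A {0}" by (auto simp: prime_in_def is_ideal_def)
  have wm: "w ` {1..d} \<subseteq> m" unfolding mspan using FA.lin_span_incl by blast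
  interpret Q: prime_sequence A "{1..d}" w
    by (rule L.regular_parameters[OF _ wm _ zero chain]) (auto simp: mspan)
  interpret M: quadratic_chart A d w
  proof
    show "\<exists>b\<in>S. mle {1..d} b a" if "mon {1..d} w a \<in> lin_span A (mon {1..d} w ` S)" for a S
      using Q.mon_in_span[OF that] by (simp add: mle_def)
    show "z \<in> lin_span A (w ` {1..d}) \<or> (\<exists>c\<in>A. c * z = 1)" if "z \<in> A" for z
      using L.unit_outside[OF that] by (auto simp: mspan mult.commute)
  qed (use wA d1 in auto)
  have wy: "w = y(1 := w 1)" by (simp add: w_def)
  have R1: "R1 = ring_on M.R1" unfolding R1_def using M.quadratic_transform_eq[OF wy] w1 by simp
  have v: "M.v = u(1 := x)" unfolding u_def using M.v_eq[OF wy] w1 by simp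
  have vj: "M.v j = u j" if "j \<in> {2..d}" for j using that by (simp add: v)
  have xpow: "\<exists>K. x ^ K \<in> I" if "primary_to R1 m1 I" for I
  proof -
    interpret FR1: field_subring M.R1 by unfold_locales
    have "x \<in> m1" unfolding m1_def param_ideal_def genideal_def by blast
    then have "x \<in> ideal_radical R1 I" using that by (simp add: primary_to_def)
    then show ?thesis by (auto simp: ideal_radical_def R1 FR1.pow_eq)
  qed
  obtain K K' where "x ^ K \<in> I1" "x ^ K' \<in> I1'" using xpow assms(16,19) by blast
  then show ?thesis
    using M.CIT_star_CIT[OF wy d, of I1 I1' K K' n n'] assms(14,15,17,18,20,21) vj
    unfolding N_def R_def mspan w1 R1 u_def by simp
qed

end
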